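(* Let $\Omega$ be a domain in $\mathbb C^n$. Suppose $u=(u_1,\ldots,u_N):\Omega\to\mathbb C^N$ belongs to $H^1_{loc}(\Omega)$ and satisfies $$|\bar\partial u|\le V|u|\quad\text{a.e. in }\Omega$$ for some $V\in L^2_{loc}(\Omega)$. If $u$ vanishes in a nonempty open subset of $\Omega$, then $u$ vanishes identically on $\Omega$.
   Context: A domain is a connected open set. $H^1_{loc}(\Omega)$ is the local Sobolev space of functions whose weak derivatives up to order $1$ are in $L^2_{loc}(\Omega)$ (componentwise for vector-valued functions). For $u\in H^1_{loc}(\Omega)$, $\bar\partial u$ is understood as a (vector of) $(0,1)$ form(s) with distributional components $\bar\partial_j u_k=\partial u_k/\partial\bar z_j$, and $$|\bar\partial u|=\Big(\sum_{j=1}^n\sum_{k=1}^N|\bar\partial_j u_k|^2\Big)^{1/2},\qquad |u|=\Big(\sum_{k=1}^N|u_k|^2\Big)^{1/2}.$$ Vanishing is understood in the almost-everywhere sense, for $u$ as an element of $H^1_{loc}(\Omega)$. *)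

theory Defs
  imports "HOL-Analysis.Analysis"
begin

text \<open>
  Locally \<open>p\<close>-integrable functions. Functions on \<open>\<Omega>\<close> are represented by total functions
  of which only the values on \<open>\<Omega>\<close> matter; measurability is Lebesgue measurability.
\<close>

definition Lp_loc :: "nat \<Rightarrow> 'a::euclidean_space set \<Rightarrow>
    ('a \<Rightarrow> 'b::{real_normed_vector, second_countable_topology}) \<Rightarrow> bool" where
  "Lp_loc p \<Omega> f \<longleftrightarrow>
     f \<in> borel_measurable (lebesgue_on \<Omega>) \<and>
     (\<forall>K. compact K \<and> K \<subseteq> \<Omega> \<longrightarrow> integrable (lebesgue_on K) (\<lambda>x. norm (f x) ^ p))"

text \<open>\<open>C\<^sup>k\<close> functions on the whole space, by iterated partial derivatives in real directions.\<close>

primrec C_k :: "nat \<Rightarrow> ('a::euclidean_space \<Rightarrow> 'b::real_normed_vector) \<Rightarrow> bool" where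
  "C_k 0 f \<longleftrightarrow> continuous_on UNIV f"
| "C_k (Suc k) f \<longleftrightarrow>
     (\<forall>x. f differentiable (at x)) \<and>
     (\<forall>b\<in>Basis. C_k k (\<lambda>x. frechet_derivative f (at x) b))"

definition test_function :: "'a::euclidean_space set \<Rightarrow> ('a \<Rightarrow> complex) \<Rightarrow> bool" where
  "test_function \<Omega> \<phi> \<longleftrightarrow>
     (\<forall>k. C_k k \<phi>) \<and>
     compact (closure {x. \<phi> x \<noteq> 0}) \<and> closure {x. \<phi> x \<noteq> 0} \<subseteq> \<Omega>"

definition has_weak_deriv ::
    "'a::euclidean_space set \<Rightarrow> 'a \<Rightarrow> ('a \<Rightarrow> complex) \<Rightarrow> ('a \<Rightarrow> complex) \<Rightarrow> bool" where
  "has_weak_deriv \<Omega> v f g \<longleftrightarrow>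
     Lp_loc 1 \<Omega> f \<and> Lp_loc 1 \<Omega> g \<and>
     (\<forall>\<phi>. test_function \<Omega> \<phi> \<longrightarrow>
        (LINT x|lebesgue_on \<Omega>. f x * frechet_derivative \<phi> (at x) v) =
        - (LINT x|lebesgue_on \<Omega>. g x * \<phi> x))"

text \<open>
  \<open>H\<^sup>1\<close>-regularity is with respect to the real structure: \<open>Basis\<close> of \<open>complex ^ 'n\<close> consists of
  the \<open>2n\<close> real directions \<open>axis j 1\<close> (for \<open>x\<^sub>j\<close>) and \<open>axis j \<i>\<close> (for \<open>y\<^sub>j\<close>).
\<close>

definition H1_loc :: "(complex ^ 'n) set \<Rightarrow> (complex ^ 'n \<Rightarrow> complex ^ 'm) \<Rightarrow> bool" where
  "H1_loc \<Omega> u \<longleftrightarrow>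
     (\<forall>k. Lp_loc 2 \<Omega> (\<lambda>x. u x $ k) \<and>
          (\<forall>b\<in>Basis. \<exists>g. Lp_loc 2 \<Omega> g \<and> has_weak_deriv \<Omega> b (\<lambda>x. u x $ k) g))"

text \<open>The classical \<open>\<partial>/\<partial>\<close>\<open>z\<close>-bar operator \<open>1/2 (\<partial>/\<partial>x\<^sub>j + \<i> \<partial>/\<partial>y\<^sub>j)\<close> on smooth functions.\<close>

definition dbar :: "'n \<Rightarrow> (complex ^ 'n \<Rightarrow> complex) \<Rightarrow> complex ^ 'n \<Rightarrow> complex" where
  "dbar j \<phi> x =
     (frechet_derivative \<phi> (at x) (axis j 1) + \<i> * frechet_derivative \<phi> (at x) (axis j \<i>)) / 2"

text \<open>
  \<open>g\<close> represents the distribution \<open>dbar j f\<close>. Such a \<open>g\<close> is unique up to null sets, so it is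
  given by a relation instead of choosing a representative.
\<close>

definition has_weak_dbar ::
    "(complex ^ 'n) set \<Rightarrow> 'n \<Rightarrow> (complex ^ 'n \<Rightarrow> complex) \<Rightarrow> (complex ^ 'n \<Rightarrow> complex) \<Rightarrow> bool" where
  "has_weak_dbar \<Omega> j f g \<longleftrightarrow>
     Lp_loc 1 \<Omega> f \<and> Lp_loc 1 \<Omega> g \<and>
     (\<forall>\<phi>. test_function \<Omega> \<phi> \<longrightarrow>
        (LINT x|lebesgue_on \<Omega>. f x * dbar j \<phi> x) = - (LINT x|lebesgue_on \<Omega>. g x * \<phi> x))"

end

theory Submission
  imports Defs
begin

text \<open>
  The square integrability of \<open>V\<close> survives restriction to almost every complex line parallel to
  a coordinate axis, so the heart of the matter is one complex variable \<open>w\<close>. Suppose that \<open>u\<close>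
  vanishes for \<open>\<bar>w\<bar> < a\<close>, and let \<open>a < r < s\<close>. The weight \<open>w\<^sup>-\<^sup>m\<close> is holomorphic where \<open>u\<close> lives, so
  after a cutoff between \<open>r\<close> and \<open>s\<close> Cauchy's formula bounds \<open>\<bar>w\<bar>\<^sup>-\<^sup>m \<bar>u\<bar>\<close> on the disc of radius \<open>r\<close> by the
  potential, with kernel \<open>1 / \<bar>z - w\<bar>\<close>, of \<open>\<bar>w\<bar>\<^sup>-\<^sup>m V \<bar>u\<bar>\<close> over \<open>a \<le> \<bar>w\<bar> < r\<close>, plus \<open>r\<^sup>-\<^sup>m\<close> times a function
  that does not depend on \<open>m\<close>. If the first term can be absorbed, the second one shows that
  \<open>(r / \<bar>w\<bar>)\<^sup>m \<bar>u\<bar>\<close> stays bounded in the mean as \<open>m\<close> grows, and \<open>u\<close> vanishes for \<open>\<bar>w\<bar> < r\<close>.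

  Absorption needs a norm in which \<open>f \<mapsto>\<close> potential of \<open>V f\<close> is bounded by \<open>\<parallel>V\<parallel>\<close> in \<open>L\<^sup>2\<close>. The norm of
  \<open>L\<^sup>2\<close> does not serve, but the norm of \<open>L\<^sup>2(\<omega>)\<close> does, where the weight \<open>\<omega>\<close> is the Riesz potential
  \<open>V\<^sup>2 * \<bar>z\<bar>\<^sup>-\<^sup>1\<^sup>/\<^sup>2\<close> (\<open>cauchy_transform_weighted_bound\<close>); only the exponents of three Riesz kernels have
  to match. On a thin annulus the integral of \<open>V\<^sup>2\<close> is small, so the absorption works there
  (\<open>annulus_step\<close>), and a supremum over radii covers the whole disc (\<open>plane_unique_continuation\<close>).
  Absorbing a term requires that it is finite beforehand. This is where \<open>H\<^sup>1\<close> enters: it bounds \<open>\<bar>u\<bar>\<close>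
  by the potential of a square integrable function. The weak d-bar derivative in \<open>L\<^sup>2\<close> is used for
  the finiteness and the one controlled by \<open>V \<bar>u\<bar>\<close> for the absorption, so the two representatives
  never have to be compared.

  Cauchy's formula is needed as an inequality, almost everywhere on almost every line
  (\<open>weak_dbar_cauchy_inequality\<close>). It is obtained in all variables at once: the weak derivative is
  tested with the kernel \<open>cnj w / (\<bar>w\<bar>\<^sup>2 + e\<^sup>2)\<close> in one variable times a bump of width \<open>e\<close> in
  the others, and \<open>e\<close> tends to 0. The limit exists because translations are continuous in \<open>L\<^sup>1\<close>.

  Finally, zeros spread over a polydisc one coordinate at a time (\<open>polydisc_propagation\<close>), and over
  a domain by connectedness.
\<close>

section \<open>Smooth functions\<close>

definition smooth :: "('a::euclidean_space \<Rightarrow> 'b::real_normed_vector) \<Rightarrow> bool" where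
  "smooth f \<longleftrightarrow> (\<forall>k. C_k k f)"

lemma C_k_SucI:
  assumes "\<And>x. (f has_derivative f' x) (at x)" and "\<And>b. b \<in> Basis \<Longrightarrow> C_k k (\<lambda>x. f' x b)"
  shows "C_k (Suc k) f"
proof -
  have "frechet_derivative f (at x) = f' x" for x
    using frechet_derivative_at[OF assms(1)] by simp
  then show ?thesis
    using assms by (auto simp: differentiable_def)
qed

lemma C_k_Suc_has_derivative:
  "C_k (Suc k) f \<Longrightarrow> (f has_derivative frechet_derivative f (at x)) (at x)"
  using frechet_derivative_works by auto

lemma C_k_SucD: "C_k (Suc k) f \<Longrightarrow> C_k k f"
proof (induction k arbitrary: f)
  case 0
  then show ?case
    by (auto intro!: continuous_at_imp_continuous_on differentiable_imp_continuous_within)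
next
  case (Suc k)
  then show ?case by simp
qed

lemma C_k_const: "C_k k (\<lambda>x. c)"
proof (induction k arbitrary: c)
  case (Suc k)
  show ?case by (rule C_k_SucI[where f' = "\<lambda>x b. 0"]) (use Suc in auto)
qed simp

lemma C_k_add: "C_k k f \<Longrightarrow> C_k k g \<Longrightarrow> C_k k (\<lambda>x. f x + g x)"
proof (induction k arbitrary: f g)
  case (Suc k)
  show ?case
    by (rule C_k_SucI[OF has_derivative_add[OF Suc.prems[THEN C_k_Suc_has_derivative]]])
       (use Suc in auto)
qed (auto intro: continuous_intros)

lemma (in bounded_linear) C_k_comp:
  fixes g :: "'x::euclidean_space \<Rightarrow> 'a"
  shows "C_k k g \<Longrightarrow> C_k k (\<lambda>x. f (g x))"
proof (induction k arbitrary: g)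
  case (Suc k)
  show ?case
    by (rule C_k_SucI[OF has_derivative[OF C_k_Suc_has_derivative[OF Suc.prems]]])
       (use Suc in auto)
qed (auto intro: continuous_on)

lemma C_k_bounded_linear:
  assumes "bounded_linear L"
  shows "C_k k L"
proof (cases k)
  case 0
  then show ?thesis using assms by (simp add: linear_continuous_on)
next
  case (Suc k')
  show ?thesis unfolding Suc
    by (rule C_k_SucI[OF bounded_linear_imp_has_derivative[OF assms]]) (rule C_k_const)
qed

lemma (in bounded_bilinear) C_k_prod:
  fixes f :: "'x::euclidean_space \<Rightarrow> 'a"
  shows "C_k k f \<Longrightarrow> C_k k g \<Longrightarrow> C_k k (\<lambda>x. prod (f x) (g x))"
proof (induction k arbitrary: f g)
  case (Suc k)
  show ?case
    by (rule C_k_SucI[OF FDERIV[OF Suc.prems[THEN C_k_Suc_has_derivative]]])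
       (use Suc.prems[THEN C_k_SucD] Suc in \<open>auto intro!: C_k_add\<close>)
qed (auto intro: continuous_on)

lemmas C_k_mult = bounded_bilinear.C_k_prod[OF bounded_bilinear_mult]

lemma C_k_inverse:
  fixes f :: "'x::euclidean_space \<Rightarrow> 'a::real_normed_field"
  assumes "\<And>x. f x \<noteq> 0"
  shows "C_k k f \<Longrightarrow> C_k k (\<lambda>x. inverse (f x))"
proof (induction k)
  case (Suc k)
  have inv: "C_k k (\<lambda>x. inverse (f x))" using Suc C_k_SucD by blast
  have "C_k k (\<lambda>x. - (inverse (f x) * frechet_derivative f (at x) b * inverse (f x)))"
    if "b \<in> Basis" for b
    using Suc.prems that inv
    by (intro bounded_linear.C_k_comp[OF bounded_linear_minus[OF bounded_linear_ident]] C_k_mult)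
       auto
  then show ?case
    by (rule C_k_SucI[OF Deriv.has_derivative_inverse[OF assms C_k_Suc_has_derivative[OF Suc.prems]]])
qed (use assms in \<open>auto intro!: continuous_intros\<close>)

lemma C_k_compose_real:
  fixes g :: "'x::euclidean_space \<Rightarrow> real" and F :: "real \<Rightarrow> real"
  shows "C_k k F \<Longrightarrow> C_k k g \<Longrightarrow> C_k k (\<lambda>x. F (g x))"
proof (induction k arbitrary: F g)
  case 0
  then show ?case
    by (auto intro: continuous_on_compose2)
next
  case (Suc k)
  let ?F' = "\<lambda>t. frechet_derivative F (at t) 1"
  have lin: "frechet_derivative F (at t) s = ?F' t * s" for t s
    using linear_scale[OF has_derivative_linear[OF C_k_Suc_has_derivative[OF Suc.prems(1)]], of t s 1]
    by simp
  have der: "((\<lambda>x. F (g x)) has_derivative (\<lambda>h. ?F' (g x) * frechet_derivative g (at x) h)) (at x)"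
    for x
    using has_derivative_compose[OF C_k_Suc_has_derivative[OF Suc.prems(2)]
        C_k_Suc_has_derivative[OF Suc.prems(1)], of x]
    unfolding lin[of _ "frechet_derivative g _ _"] by simp
  show ?case
    by (rule C_k_SucI[OF der])
       (use Suc.prems[THEN C_k_SucD] Suc in \<open>auto intro!: C_k_mult\<close>)
qed

lemma smooth_has_derivative:
  "smooth f \<Longrightarrow> (f has_derivative frechet_derivative f (at x)) (at x)"
  unfolding smooth_def using C_k_Suc_has_derivative by blast

lemma smooth_continuous: "smooth f \<Longrightarrow> continuous_on UNIV f"
  unfolding smooth_def by (metis C_k.simps(1))

lemma smooth_derivative: "smooth f \<Longrightarrow> b \<in> Basis \<Longrightarrow> smooth (\<lambda>x. frechet_derivative f (at x) b)"
  unfolding smooth_def by (metis C_k.simps(2))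

lemma smooth_const: "smooth (\<lambda>x. c)"
  and smooth_add: "smooth f \<Longrightarrow> smooth g \<Longrightarrow> smooth (\<lambda>x. f x + g x)"
  and smooth_bounded_linear: "bounded_linear L \<Longrightarrow> smooth L"
  and smooth_compose_real: "smooth F \<Longrightarrow> smooth r \<Longrightarrow> smooth (\<lambda>x. F (r x :: real) :: real)"
  unfolding smooth_def
  by (auto intro: C_k_const C_k_add C_k_bounded_linear C_k_compose_real)

lemma smooth_bounded_linear_comp:
  assumes "bounded_linear L" shows "smooth f \<Longrightarrow> smooth (\<lambda>x. L (f x))"
  using bounded_linear.C_k_comp[OF assms] unfolding smooth_def by auto

lemma smooth_mult:
  fixes f g :: "'a::euclidean_space \<Rightarrow> 'b::real_normed_algebra"
  shows "smooth f \<Longrightarrow> smooth g \<Longrightarrow> smooth (\<lambda>x. f x * g x)"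
  unfolding smooth_def by (auto intro: C_k_mult)

lemma smooth_power:
  fixes f :: "'a::euclidean_space \<Rightarrow> 'b::real_normed_algebra_1"
  shows "smooth f \<Longrightarrow> smooth (\<lambda>x. f x ^ m)"
  by (induction m) (auto intro: smooth_mult smooth_const)

lemma smooth_inverse:
  fixes f :: "'a::euclidean_space \<Rightarrow> 'b::real_normed_field"
  shows "smooth f \<Longrightarrow> (\<And>x. f x \<noteq> 0) \<Longrightarrow> smooth (\<lambda>x. inverse (f x))"
  unfolding smooth_def by (auto intro: C_k_inverse)

lemma smooth_divide:
  fixes f g :: "'a::euclidean_space \<Rightarrow> 'b::real_normed_field"
  shows "smooth f \<Longrightarrow> smooth g \<Longrightarrow> (\<And>x. g x \<noteq> 0) \<Longrightarrow> smooth (\<lambda>x. f x / g x)"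
  unfolding divide_inverse by (intro smooth_mult smooth_inverse)

lemma smooth_diff:
  assumes "smooth f" "smooth g" shows "smooth (\<lambda>x. f x - g x)"
  using smooth_add[OF assms(1) smooth_bounded_linear_comp[OF bounded_linear_minus[OF bounded_linear_ident] assms(2)]]
  by simp

lemma smooth_of_real:
  "smooth f \<Longrightarrow> smooth (\<lambda>x. of_real (f x) :: 'b::{real_normed_algebra_1})"
  by (rule smooth_bounded_linear_comp[OF bounded_linear_of_real])

lemma smooth_sum:
  "(\<And>i. i \<in> I \<Longrightarrow> smooth (f i)) \<Longrightarrow> smooth (\<lambda>x. \<Sum>i\<in>I. f i x)"
  by (induction I rule: infinite_finite_induct) (auto intro: smooth_const smooth_add)

subsection \<open>Flat functions\<close>

text \<open>
  The derivative of a member of this family is a linear combination of two other members, so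
  one induction over the order of differentiation gives the smoothness of all of them. The
  member \<open>n = 0\<close> is the usual smooth function that is flat at the origin.
\<close>

definition flat :: "nat \<Rightarrow> real \<Rightarrow> real" where
  "flat n t = (if t > 0 then inverse t ^ n * exp (- inverse t) else 0)"

lemma flat_tendsto_0: "(flat n \<longlongrightarrow> 0) (at 0)"
proof (rule filterlim_split_at)
  show "(flat n \<longlongrightarrow> 0) (at_left 0)"
    by (rule tendsto_eventually) (auto simp: eventually_at_left_field flat_def intro!: exI[of _ "-1"])
  have "((\<lambda>t::real. inverse t ^ n / exp (inverse t)) \<longlongrightarrow> 0) (at_right 0)"
    by (rule filterlim_compose[OF tendsto_power_div_exp_0 filterlim_inverse_at_top_right])
  moreover have "eventually (\<lambda>t::real. inverse t ^ n / exp (inverse t) = flat n t) (at_right 0)"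
    by (auto simp: eventually_at_right_field flat_def exp_minus divide_inverse intro!: exI[of _ 1])
  ultimately show "(flat n \<longlongrightarrow> 0) (at_right 0)"
    by (rule Lim_transform_eventually)
qed

lemma flat_has_derivative:
  "(flat n has_real_derivative (flat (n + 2) t - real n * flat (n + 1) t)) (at t)"
proof -
  consider "t > 0" | "t < 0" | "t = 0" by linarith
  then show ?thesis
  proof cases
    case 1
    have "((\<lambda>t. inverse t ^ n * exp (- inverse t)) has_real_derivative
       (flat (n + 2) t - real n * flat (n + 1) t)) (at t)"
    proof (cases n)
      case 0
      then show ?thesis using 1
        by (auto intro!: derivative_eq_intros simp: flat_def power2_eq_square)
    next
      case (Suc k)
      then show ?thesis using 1
        by (auto intro!: derivative_eq_intros simp: flat_def power2_eq_square algebra_simps)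
          (cases k; simp)
    qed
    then show ?thesis
      by (rule has_field_derivative_transform_within_open[where S = "{0<..}"])
        (use 1 in \<open>auto simp: flat_def\<close>)
  next
    case 2
    have "((\<lambda>t. 0) has_real_derivative (flat (n + 2) t - real n * flat (n + 1) t)) (at t)"
      using 2 by (auto simp: flat_def)
    then show ?thesis
      by (rule has_field_derivative_transform_within_open[where S = "{..<0}"])
        (use 2 in \<open>auto simp: flat_def\<close>)
  next
    case 3
    have "eventually (\<lambda>h. flat (Suc n) h = (flat n (0 + h) - flat n 0) / h) (at 0)"
      by (auto simp: eventually_at_filter flat_def divide_inverse)
    with flat_tendsto_0[of "Suc n"] have "(\<lambda>h. (flat n (0 + h) - flat n 0) / h) \<midarrow>0\<rightarrow> 0"
      by (rule Lim_transform_eventually)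
    then show ?thesis
      using 3 by (simp add: DERIV_def flat_def)
  qed
qed

lemma smooth_flat: "smooth (flat n)"
proof -
  have "C_k k (flat n)" for k
  proof (induction k arbitrary: n)
    case 0
    show ?case
      by (auto intro!: continuous_at_imp_continuous_on DERIV_isCont flat_has_derivative)
  next
    case (Suc k)
    have "C_k k (\<lambda>t. (flat (n + 2) t + - real n * flat (n + 1) t) * 1)"
      by (intro C_k_mult C_k_add C_k_const Suc)
    then show ?case
      by (intro C_k_SucI[OF flat_has_derivative[unfolded has_field_derivative_def]])
         (auto simp: Basis_real_def)
  qed
  then show ?thesis by (simp add: smooth_def)
qed

lemma flat_nonneg: "flat n t \<ge> 0" and flat_pos: "t > 0 \<Longrightarrow> flat n t > 0"
  and flat_eq_0: "t \<le> 0 \<Longrightarrow> flat n t = 0"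
  by (auto simp: flat_def)

section \<open>Riesz kernels in the plane\<close>

lemma nn_integral_lborel_shift:
  fixes c :: "'a::euclidean_space"
  assumes [measurable]: "f \<in> borel_measurable borel"
  shows "(\<integral>\<^sup>+x. f (c + x) \<partial>lborel) = (\<integral>\<^sup>+x. f x \<partial>lborel)"
proof -
  have "(\<integral>\<^sup>+x. f x \<partial>lborel) = (\<integral>\<^sup>+x. f x \<partial>distr lborel borel ((+) c))"
    by (simp add: lborel_distr_plus)
  also have "\<dots> = (\<integral>\<^sup>+x. f (c + x) \<partial>lborel)"
    by (rule nn_integral_distr) auto
  finally show ?thesis by simp
qed

lemma nn_integral_lborel_scale:
  fixes f :: "'a::euclidean_space \<Rightarrow> ennreal"
  assumes [measurable]: "f \<in> borel_measurable borel" and c: "c \<noteq> 0"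
  shows "(\<integral>\<^sup>+x. f x \<partial>lborel) = ennreal (\<bar>c\<bar> ^ DIM('a)) * (\<integral>\<^sup>+x. f (c *\<^sub>R x) \<partial>lborel)"
  by (subst lborel_affine[OF c, of 0])
     (simp add: nn_integral_density nn_integral_distr nn_integral_cmult)

lemma nn_integral_lborel_reflect:
  fixes c :: "'a::euclidean_space"
  assumes [measurable]: "f \<in> borel_measurable borel"
  shows "(\<integral>\<^sup>+x. f (c - x) \<partial>lborel) = (\<integral>\<^sup>+x. f x \<partial>lborel)"
  using nn_integral_lborel_scale[of "\<lambda>x. f (c + x)" "-1"] nn_integral_lborel_shift[of f c]
  by (simp add: one_ennreal_def[symmetric])

text \<open>
  At the origin \<open>powr\<close> yields 0 and not the infinite value of the kernel. This concerns a null
  set, but it is the reason for the condition \<open>x \<noteq> 0\<close> in \<open>riesz_convolution_bound\<close>.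
\<close>

definition riesz :: "real \<Rightarrow> complex \<Rightarrow> ennreal" where
  "riesz a z = ennreal (norm z powr - a)"

lemma ball_borel [measurable]: "ball (x::'a::metric_space) r \<in> sets borel"
  and cball_borel [measurable]: "cball (x::'a::metric_space) r \<in> sets borel"
  by simp_all

lemma riesz_measurable [measurable]: "riesz a \<in> borel_measurable borel"
  unfolding riesz_def by measurable

lemma riesz_minus_commute: "riesz a (x - y) = riesz a (y - x)"
  by (simp add: riesz_def norm_minus_commute)

lemma dyadic_bracket:
  fixes y :: real assumes "y \<ge> 1"
  obtains k :: nat where "2 powr k \<le> y" "y < 2 powr (k + 1)"
proof
  have l: "log 2 y \<ge> 0" using assms by simp
  have "real (nat \<lfloor>log 2 y\<rfloor>) \<le> log 2 y" using l by linarith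
  then have "2 powr real (nat \<lfloor>log 2 y\<rfloor>) \<le> 2 powr (log 2 y)" by simp
  then show "2 powr real (nat \<lfloor>log 2 y\<rfloor>) \<le> y" using assms by simp
  have "log 2 y < real (nat \<lfloor>log 2 y\<rfloor>) + 1" using l by linarith
  then have "2 powr (log 2 y) < 2 powr (real (nat \<lfloor>log 2 y\<rfloor>) + 1)" by simp
  then show "y < 2 powr real (nat \<lfloor>log 2 y\<rfloor> + 1)" using assms by (simp add: add_ac)
qed

text \<open>
  A majorant made of constants on discs turns the integral into a series; the area of a disc is
  all the geometry that enters.
\<close>

lemma nn_integral_dyadic_balls_finite:
  fixes c r :: "nat \<Rightarrow> real" and f :: "complex \<Rightarrow> ennreal"
  assumes le: "\<And>z. z \<noteq> 0 \<Longrightarrow> \<exists>k. norm z < r k \<and> f z \<le> ennreal (c k) \<or> f z = 0"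
    and c: "\<And>k. c k \<ge> 0" and r: "\<And>k. r k \<ge> 0"
    and sm: "summable (\<lambda>k. c k * (r k)\<^sup>2)"
    and [measurable]: "f \<in> borel_measurable borel"
  shows "(\<integral>\<^sup>+z. f z \<partial>lborel) < \<infinity>"
proof -
  have "AE z::complex in lborel. z \<noteq> 0"
    by (rule AE_lborel_singleton)
  then have "AE z in lborel. f z \<le> (\<Sum>k. ennreal (c k) * indicator (ball 0 (r k)) z)"
  proof (rule AE_mp, intro AE_I2 impI)
    fix z :: complex assume "z \<noteq> 0"
    then obtain k where "norm z < r k \<and> f z \<le> ennreal (c k) \<or> f z = 0" using le by blast
    then have "f z \<le> ennreal (c k) * indicator (ball 0 (r k)) z"
      by (auto simp: indicator_def)
    also have "\<dots> = (\<Sum>i\<in>{k}. ennreal (c i) * indicator (ball 0 (r i)) z)"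
      by (simp only: sum.insert_if finite.emptyI sum.empty) simp
    also have "\<dots> \<le> (\<Sum>k. ennreal (c k) * indicator (ball 0 (r k)) z)"
      by (rule sum_le_suminf) auto
    finally show "f z \<le> (\<Sum>k. ennreal (c k) * indicator (ball 0 (r k)) z)" .
  qed
  then have "(\<integral>\<^sup>+z. f z \<partial>lborel)
      \<le> (\<integral>\<^sup>+(z::complex). (\<Sum>k. ennreal (c k) * indicator (ball 0 (r k)) z) \<partial>lborel)"
    by (rule nn_integral_mono_AE)
  also have "\<dots> = (\<Sum>k. \<integral>\<^sup>+(z::complex). ennreal (c k) * indicator (ball 0 (r k)) z \<partial>lborel)"
    by (intro nn_integral_suminf) measurable
  also have "\<dots> = (\<Sum>k. ennreal (c k * (unit_ball_vol 2 * (r k)\<^sup>2)))"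
    using r c by (simp add: nn_integral_cmult_indicator emeasure_ball ennreal_mult)
  also have "\<dots> = (\<Sum>k. ennreal (unit_ball_vol 2 * (c k * (r k)\<^sup>2)))"
    by (simp add: mult_ac)
  also have "\<dots> < \<infinity>"
    using summable_mult[OF sm, of "unit_ball_vol 2"] c r
    by (subst suminf_ennreal2) auto
  finally show ?thesis .
qed

lemma summable_2powr: "s < 0 \<Longrightarrow> summable (\<lambda>k::nat. C * 2 powr (s * real k))"
proof -
  assume "s < 0"
  then have "norm ((2::real) powr s) < 1"
    using powr_less_mono[of s 0 2] by simp
  then have "summable (\<lambda>k::nat. C * (2 powr s) ^ k)"
    by (intro summable_mult summable_geometric)
  then show ?thesis by (simp add: powr_powr[symmetric] powr_realpow)
qed

lemma nn_integral_riesz_unit_ball_finite: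
  assumes "a < 2" "0 \<le> a"
  shows "(\<integral>\<^sup>+z. riesz a z * indicator (ball 0 1) z \<partial>lborel) < \<infinity>"
proof (rule nn_integral_dyadic_balls_finite[where c = "\<lambda>k. 2 powr (a * (real k + 1))" and r = "\<lambda>k. 2 powr (1 - real k)"])
  fix z :: complex assume z: "z \<noteq> 0"
  show "\<exists>k. norm z < 2 powr (1 - real k) \<and> riesz a z * indicator (ball 0 1) z \<le> ennreal (2 powr (a * (real k + 1)))
      \<or> riesz a z * indicator (ball 0 1) z = 0"
  proof (cases "norm z < 1")
    case True
    then have "inverse (norm z) \<ge> 1" using z by (simp add: one_le_inverse)
    then obtain k :: nat where k: "2 powr real k \<le> inverse (norm z)" "inverse (norm z) < 2 powr (k + 1)"
      by (rule dyadic_bracket)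
    have "norm z \<le> 2 powr (- real k)"
      using k(1) z by (simp add: powr_minus field_simps)
    also have "\<dots> < 2 powr (1 - real k)" by simp
    finally have "norm z < 2 powr (1 - real k)" .
    moreover have "norm z powr - a \<le> 2 powr (a * (real k + 1))"
    proof -
      have "norm z powr - a = inverse (norm z) powr a"
        using z by (simp add: powr_minus inverse_powr)
      also have "\<dots> \<le> (2 powr (k + 1)) powr a"
        using k(2) assms z by (intro powr_mono2) auto
      finally show ?thesis by (simp add: powr_powr mult.commute add.commute)
    qed
    ultimately show ?thesis
      using True by (auto simp: riesz_def intro!: exI[of _ k])
  qed (auto simp: indicator_def)
next
  have "(2 powr (a * (real k + 1))) * (2 powr (1 - real k))\<^sup>2 = (4 * 2 powr a) * 2 powr ((a - 2) * real k)" for k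
  proof -
    have four: "(4::real) = 2 powr 2" by simp
    show ?thesis
      unfolding four power2_eq_square powr_add[symmetric]
      by (rule arg_cong[where f = "(powr) 2"]) (simp add: algebra_simps)
  qed
  then show "summable (\<lambda>k. 2 powr (a * (real k + 1)) * (2 powr (1 - real k))\<^sup>2)"
    using summable_2powr[of "a - 2" "4 * 2 powr a"] assms by (simp add: add_ac)
qed auto

lemma nn_integral_riesz_exterior_finite:
  assumes "a > 2"
  shows "(\<integral>\<^sup>+z. riesz a z * indicator (- ball 0 1) z \<partial>lborel) < \<infinity>"
proof (rule nn_integral_dyadic_balls_finite[where c = "\<lambda>k. 2 powr - (a * k)" and r = "\<lambda>k. 2 powr (real k + 1)"])
  fix z :: complex assume z: "z \<noteq> 0"
  show "\<exists>k. norm z < 2 powr (real k + 1) \<and> riesz a z * indicator (- ball 0 1) z \<le> ennreal (2 powr - (a * real k))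
      \<or> riesz a z * indicator (- ball 0 1) z = 0"
  proof (cases "norm z < 1")
    case False
    then obtain k :: nat where k: "2 powr real k \<le> norm z" "norm z < 2 powr (k + 1)"
      using dyadic_bracket[of "norm z"] by auto
    have "norm z powr - a \<le> (2 powr k) powr - a"
      using k(1) assms by (intro powr_mono2') auto
    then show ?thesis
      using False k(2) by (auto simp: riesz_def powr_powr mult.commute add_ac intro!: exI[of _ k])
  qed (auto simp: indicator_def)
next
  have "(2 powr - (a * real k)) * (2 powr (real k + 1))\<^sup>2 = 4 * 2 powr ((2 - a) * real k)" for k
  proof -
    have four: "(4::real) = 2 powr 2" by simp
    show ?thesis
      unfolding four power2_eq_square powr_add[symmetric]
      by (rule arg_cong[where f = "(powr) 2"]) (simp add: algebra_simps)
  qed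
  then show "summable (\<lambda>k. 2 powr - (a * real k) * (2 powr (real k + 1))\<^sup>2)"
    using summable_2powr[of "2 - a" 4] assms by simp
qed auto

lemma riesz_scale: "c > 0 \<Longrightarrow> riesz a (c *\<^sub>R z) = ennreal (c powr - a) * riesz a z"
  by (simp add: riesz_def powr_mult ennreal_mult)

text \<open>
  The kernel is homogeneous of degree \<open>- a\<close>, and the area of degree 2.
\<close>

lemma nn_integral_riesz_dilate:
  assumes "c > 0" and [measurable]: "S \<in> sets borel"
  shows "(\<integral>\<^sup>+z. riesz a z * indicator ((*\<^sub>R) c ` S) z \<partial>lborel)
       = ennreal (c powr (2 - a)) * (\<integral>\<^sup>+z. riesz a z * indicator S z \<partial>lborel)"
proof -
  have eq: "(*\<^sub>R) c ` S = (\<lambda>z. inverse c *\<^sub>R z) -` S"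
    using assms(1) by (auto intro!: image_eqI[where x = "inverse c *\<^sub>R _"])
  have [measurable]: "(*\<^sub>R) c ` S \<in> sets borel"
    unfolding eq using measurable_sets_borel[of "\<lambda>z. inverse c *\<^sub>R z" borel S] by simp
  have "(\<integral>\<^sup>+z. riesz a z * indicator ((*\<^sub>R) c ` S) z \<partial>lborel)
      = ennreal (c\<^sup>2) * (\<integral>\<^sup>+z. riesz a (c *\<^sub>R z) * indicator ((*\<^sub>R) c ` S) (c *\<^sub>R z) \<partial>lborel)"
    using assms(1) by (subst nn_integral_lborel_scale[of _ c]) auto
  also have "(\<lambda>z. riesz a (c *\<^sub>R z) * indicator ((*\<^sub>R) c ` S) (c *\<^sub>R z))
      = (\<lambda>z. ennreal (c powr - a) * (riesz a z * indicator S z))"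
    using assms(1)
    by (auto simp: riesz_scale mult_ac indicator_def inj_image_mem_iff inj_on_def)
  also have "ennreal (c\<^sup>2) * (\<integral>\<^sup>+z. ennreal (c powr - a) * (riesz a z * indicator S z) \<partial>lborel)
      = ennreal (c powr (2 - a)) * (\<integral>\<^sup>+z. riesz a z * indicator S z \<partial>lborel)"
    using assms(1)
    by (subst nn_integral_cmult)
       (auto simp: mult.assoc[symmetric] ennreal_mult[symmetric] powr_diff powr_minus divide_inverse
         simp flip: powr_realpow powr_numeral)
  finally show ?thesis .
qed

lemma nn_integral_riesz_ball:
  assumes "a < 2" "0 \<le> a"
  obtains C where "C \<ge> 0"
    "\<And>r. r > 0 \<Longrightarrow> (\<integral>\<^sup>+z. riesz a z * indicator (ball 0 r) z \<partial>lborel) = ennreal (C * r powr (2 - a))"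
proof -
  obtain C where C: "C \<ge> 0" "(\<integral>\<^sup>+z. riesz a z * indicator (ball 0 1) z \<partial>lborel) = ennreal C"
    using nn_integral_riesz_unit_ball_finite[OF assms]
    by (metis ennreal_cases less_irrefl infinity_ennreal_def)
  show thesis
  proof (rule that[OF C(1)])
    fix r :: real assume "r > 0"
    then show "(\<integral>\<^sup>+z. riesz a z * indicator (ball 0 r) z \<partial>lborel) = ennreal (C * r powr (2 - a))"
      using nn_integral_riesz_dilate[of r "ball 0 1" a] C
      by (simp add: ball_scale mult.commute ennreal_mult[symmetric])
  qed
qed

lemma nn_integral_riesz_exterior:
  assumes "a > 2"
  obtains C where "C \<ge> 0"
    "\<And>r. r > 0 \<Longrightarrow> (\<integral>\<^sup>+z. riesz a z * indicator (- ball 0 r) z \<partial>lborel) = ennreal (C * r powr (2 - a))"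
proof -
  obtain C where C: "C \<ge> 0" "(\<integral>\<^sup>+z. riesz a z * indicator (- ball 0 1) z \<partial>lborel) = ennreal C"
    using nn_integral_riesz_exterior_finite[OF assms]
    by (metis ennreal_cases less_irrefl infinity_ennreal_def)
  show thesis
  proof (rule that[OF C(1)])
    fix r :: real assume r: "r > 0"
    have eq: "(*\<^sub>R) r ` (- ball 0 1) = - ball (0::complex) r"
      using r by (subst bij_image_Compl_eq)
        (auto simp: ball_scale intro!: bijI injI image_eqI[where x = "inverse r *\<^sub>R _"])
    then show "(\<integral>\<^sup>+z. riesz a z * indicator (- ball 0 r) z \<partial>lborel) = ennreal (C * r powr (2 - a))"
      using nn_integral_riesz_dilate[of r "- ball 0 1" a] C r
      by (simp add: mult.commute ennreal_mult[symmetric])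
  qed
qed

text \<open>
  Both sides are homogeneous of degree \<open>- 1/2\<close> in \<open>x\<close>. The integral converges because the
  singularities at \<open>0\<close> and at \<open>x\<close> have order below 2, while the joint decay at infinity has order
  \<open>5/2 > 2\<close>. The plane is cut at distance \<open>\<bar>x\<bar> / 2\<close> from the two singular points; in each piece one of the
  two factors is bounded by a power of \<open>\<bar>x\<bar>\<close> or \<open>\<bar>z\<bar>\<close>, and the other one is integrated.
\<close>

lemma riesz_convolution_bound:
  obtains C where "C \<ge> 0"
    "\<And>x. x \<noteq> 0 \<Longrightarrow>
       (\<integral>\<^sup>+z. riesz 1 (x - z) * riesz (3/2) z \<partial>lborel) \<le> ennreal C * riesz (1/2) x"
proof -
  obtain A where A: "A \<ge> 0" "\<And>r. r > 0 \<Longrightarrow>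
      (\<integral>\<^sup>+z. riesz (3/2) z * indicator (ball 0 r) z \<partial>lborel) = ennreal (A * r powr (2 - 3/2))"
    using nn_integral_riesz_ball[of "3/2"] by auto
  obtain B where B: "B \<ge> 0" "\<And>r. r > 0 \<Longrightarrow>
      (\<integral>\<^sup>+z. riesz 1 z * indicator (ball 0 r) z \<partial>lborel) = ennreal (B * r powr (2 - 1))"
    using nn_integral_riesz_ball[of 1] by auto
  obtain D where D: "D \<ge> 0" "\<And>r. r > 0 \<Longrightarrow>
      (\<integral>\<^sup>+z. riesz (5/2) z * indicator (- ball 0 r) z \<partial>lborel) = ennreal (D * r powr (2 - 5/2))"
    using nn_integral_riesz_exterior[of "5/2"] by auto
  define C where "C = (A + B + 3 * D) * 2 powr (1/2)"
  show thesis
  proof (rule that[of C])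
    show "C \<ge> 0" using A B D by (simp add: C_def)
    fix x :: complex assume x: "x \<noteq> 0"
    define d where "d = norm x / 2"
    have d: "d > 0" using x by (simp add: d_def)
    have le: "riesz 1 (x - z) * riesz (3/2) z
        \<le> ennreal (d powr -1) * (riesz (3/2) z * indicator (ball 0 d) z)
          + ennreal (d powr -(3/2)) * (riesz 1 (x - z) * indicator (ball 0 d) (x - z))
          + 3 * (riesz (5/2) z * indicator (- ball 0 d) z)" (is "_ \<le> ?a + ?b + ?c") for z
    proof -
      \<comment> \<open>Near \<open>0\<close>, near \<open>x\<close>, and away from both.\<close>
      consider "norm z < d" | "norm (x - z) < d" | "norm z \<ge> d" "norm (x - z) \<ge> d" by linarith
      then show ?thesis
      proof cases
        case 1
        have "norm (x - z) \<ge> d"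
          using 1 norm_triangle_ineq2[of x z] by (simp add: d_def)
        then have "norm (x - z) powr -1 \<le> d powr -1"
          using d by (intro powr_mono2') auto
        then have "riesz 1 (x - z) \<le> ennreal (d powr -1)"
          unfolding riesz_def by (rule ennreal_leI)
        then have "riesz 1 (x - z) * riesz (3/2) z \<le> ?a"
          using 1 by (simp add: mult_right_mono)
        then show ?thesis by (simp add: add_increasing2 add.assoc)
      next
        case 2
        have "norm z \<ge> d"
          using 2 norm_triangle_ineq2[of x "x - z"] by (simp add: d_def)
        then have "norm z powr -(3/2) \<le> d powr -(3/2)"
          using d by (intro powr_mono2') auto
        then have "riesz (3/2) z \<le> ennreal (d powr -(3/2))"
          unfolding riesz_def by (rule ennreal_leI)
        then have "riesz 1 (x - z) * riesz (3/2) z \<le> ?b"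
          using 2 by (simp add: mult.commute mult_left_mono)
        then have "riesz 1 (x - z) * riesz (3/2) z \<le> ?b + (?a + ?c)"
          by (rule add_increasing2[rotated]) simp
        then show ?thesis by (simp add: add_ac)
      next
        case 3
        have "norm z \<le> 3 * norm (x - z)"
          using 3 norm_triangle_ineq[of "z - x" x] by (simp add: d_def norm_minus_commute)
        then have "(norm (x - z)) powr -1 \<le> (norm z / 3) powr -1"
          using d 3 by (intro powr_mono2') auto
        also have "\<dots> = 3 * norm z powr -1" using 3 d by (simp add: powr_minus field_simps)
        finally have "norm (x - z) powr -1 * norm z powr -(3/2) \<le> 3 * norm z powr -1 * norm z powr -(3/2)"
          by (rule mult_right_mono) simp
        also have "\<dots> = 3 * norm z powr -(5/2)"
          by (simp only: mult.assoc powr_add[symmetric]) simp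
        finally have "riesz 1 (x - z) * riesz (3/2) z \<le> ?c"
          using 3 unfolding riesz_def
          by (simp add: ennreal_mult[symmetric] ennreal_leI flip: ennreal_numeral)
        then show ?thesis by (rule add_increasing[rotated]) simp
      qed
    qed
    have "(\<integral>\<^sup>+z. riesz 1 (x - z) * riesz (3/2) z \<partial>lborel)
      \<le> (\<integral>\<^sup>+z. ennreal (d powr -1) * (riesz (3/2) z * indicator (ball 0 d) z)
          + ennreal (d powr -(3/2)) * (riesz 1 (x - z) * indicator (ball 0 d) (x - z))
          + 3 * (riesz (5/2) z * indicator (- ball 0 d) z) \<partial>lborel)"
      by (intro nn_integral_mono le)
    also have "\<dots> = ennreal (d powr -1) * ennreal (A * d powr (2 - 3/2))
        + ennreal (d powr -(3/2)) * ennreal (B * d powr (2 - 1))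
        + 3 * ennreal (D * d powr (2 - 5/2))"
      using nn_integral_lborel_reflect[of "\<lambda>z. riesz 1 z * indicator (ball 0 d) z" x]
      by (simp add: nn_integral_add nn_integral_cmult A(2)[OF d] B(2)[OF d] D(2)[OF d])
    also have "\<dots> = ennreal ((A + B + 3 * D) * d powr -(1/2))"
    proof -
      have "d powr -1 * d powr (2 - 3/2) = d powr -(1/2)" "d powr -(3/2) * d powr (2 - 1) = d powr -(1/2)"
        by (simp_all only: powr_add[symmetric]) simp_all
      then have "(A + B + 3 * D) * d powr -(1/2) = d powr -1 * (A * d powr (2 - 3/2))
          + d powr -(3/2) * (B * d powr (2 - 1)) + 3 * (D * d powr (2 - 5/2))"
        by (simp add: algebra_simps)
      then show ?thesis
        using A(1) B(1) D(1)
        by (simp add: ennreal_mult[symmetric] ennreal_plus[symmetric] del: ennreal_plus flip: ennreal_numeral)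
    qed
    also have "d powr -(1/2) = 2 powr (1/2) * norm x powr -(1/2)"
      using x by (simp add: d_def powr_divide powr_minus field_simps)
    finally show "(\<integral>\<^sup>+z. riesz 1 (x - z) * riesz (3/2) z \<partial>lborel) \<le> ennreal C * riesz (1/2) x"
      using A(1) B(1) D(1) by (simp add: C_def riesz_def ennreal_mult[symmetric] mult.assoc)
  qed
qed

text \<open>
  The factor whose argument has the larger norm is smaller than the same power of the other
  argument. A product of singularities at two points becomes a sum of singularities at one point,
  which decouples double integrals.
\<close>

lemma riesz_mult_le:
  assumes "s > 0" "t > 0"
  shows "riesz s x * riesz t y \<le> riesz (s + t) x + riesz (s + t) y"
proof (cases "x = 0 \<or> y = 0")
  case False
  have *: "riesz s x * riesz t y \<le> riesz (s + t) x" if "norm x \<le> norm y" "x \<noteq> 0" "t > 0"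
    for x y :: complex and s t
  proof -
    have "norm y powr - t \<le> norm x powr - t" using that by (intro powr_mono2') auto
    then have "norm x powr - s * norm y powr - t \<le> norm x powr - s * norm x powr - t"
      by (rule mult_left_mono) simp
    then show ?thesis
      by (simp add: riesz_def ennreal_mult[symmetric] powr_add[symmetric] ennreal_leI)
  qed
  show ?thesis
  proof (cases "norm x \<le> norm y")
    case True
    then show ?thesis using *[of x y t s] False assms by (simp add: add_increasing2)
  next
    case f: False
    then show ?thesis using *[of y x s t] False assms
      by (simp add: add_increasing mult.commute add.commute)
  qed
qed (auto simp: riesz_def)

text \<open>
  The mass, equal to \<open>\<pi>\<close>, of the approximate identity that d-bar produces from the
  regularised Cauchy kernel. It enters the estimates only as a positive finite constant.
\<close>

definition cauchy_mass :: ennreal where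
  "cauchy_mass = (\<integral>\<^sup>+w. ennreal (1 / (1 + (cmod w)\<^sup>2)\<^sup>2) \<partial>lborel)"

lemma cauchy_mass_finite: "cauchy_mass < \<infinity>"
proof -
  have le: "ennreal (1 / (1 + (cmod w)\<^sup>2)\<^sup>2)
      \<le> indicator (ball 0 1) w + riesz 4 w * indicator (- ball 0 1) w" for w
  proof (cases "norm w < 1")
    case False
    have "((cmod w)\<^sup>2)\<^sup>2 \<le> (1 + (cmod w)\<^sup>2)\<^sup>2" by (intro power_mono) auto
    then have "1 / (1 + (cmod w)\<^sup>2)\<^sup>2 \<le> 1 / ((cmod w)\<^sup>2)\<^sup>2"
      using False by (intro divide_left_mono mult_pos_pos) (auto intro!: zero_less_power add_pos_nonneg)
    also have "\<dots> = norm w powr -4"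
      using False by (simp add: powr_minus divide_inverse powr_powr flip: powr_realpow powr_numeral)
    finally show ?thesis using False by (simp add: riesz_def ennreal_leI)
  next
    case True
    have "1 \<le> (1 + (cmod w)\<^sup>2)\<^sup>2" by (rule one_le_power) simp
    then have "1 / (1 + (cmod w)\<^sup>2)\<^sup>2 \<le> 1"
      by (subst divide_le_eq_1_pos) linarith+
    then show ?thesis using True by (simp add: add_increasing2 ennreal_le_1)
  qed
  have "cauchy_mass \<le> emeasure lborel (ball (0::complex) 1)
      + (\<integral>\<^sup>+z. riesz 4 z * indicator (- ball 0 1) z \<partial>lborel)"
    unfolding cauchy_mass_def
    by (rule order_trans[OF nn_integral_mono[OF le]]) (simp add: nn_integral_add)
  also have "\<dots> < \<infinity>"
    using nn_integral_riesz_exterior_finite[of 4] by (simp add: emeasure_ball)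
  finally show ?thesis .
qed

lemma cauchy_mass_pos: "cauchy_mass > 0"
proof (rule ccontr)
  assume "\<not> cauchy_mass > 0"
  then have "(\<integral>\<^sup>+(w::complex). ennreal (1 / (1 + (cmod w)\<^sup>2)\<^sup>2) \<partial>lborel) = 0"
    by (simp add: cauchy_mass_def)
  then have "AE w::complex in lborel. ennreal (1 / (1 + (cmod w)\<^sup>2)\<^sup>2) = 0"
    by (rule nn_integral_0_iff_AE[THEN iffD1, rotated]) auto
  moreover have "ennreal (1 / (1 + (cmod w)\<^sup>2)\<^sup>2) \<noteq> 0" for w
  proof -
    have "1 + (cmod w)\<^sup>2 > 0" by (simp add: add_pos_nonneg)
    then show ?thesis by (simp add: ennreal_eq_0_iff not_le)
  qed
  ultimately have "AE w::complex in lborel. False" by simp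
  then show False by (simp add: AE_iff_measurable[OF _ refl])
qed

section \<open>Continuity of translations in the mean\<close>

text \<open>
  Inner regularity of the finite measure that arises by restricting the Lebesgue measure to \<open>A\<close>.
\<close>

lemma lborel_inner_regular:
  fixes A :: "'a::euclidean_space set"
  assumes A [measurable]: "A \<in> sets borel" and fin: "emeasure lborel A < \<infinity>" and e: "e > (0::real)"
  obtains K where "compact K" "K \<subseteq> A" "emeasure lborel (A - K) < ennreal e"
proof -
  let ?M = "density lborel (indicator A :: 'a \<Rightarrow> ennreal)"
  have em: "emeasure ?M S = emeasure lborel (A \<inter> S)" if "S \<in> sets borel" for S
    using that by (subst emeasure_density) (auto simp: indicator_inter_arith[symmetric])
  have "emeasure ?M A = (SUP K \<in> {K. K \<subseteq> A \<and> compact K}. emeasure ?M K)"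
    by (rule inner_regular) (use em[of UNIV] fin in \<open>auto\<close>)
  then have sup: "emeasure lborel A = (SUP K \<in> {K. K \<subseteq> A \<and> compact K}. emeasure lborel K)"
    using em[OF A] em by (auto simp: Int_absorb1 borel_compact intro!: SUP_cong)
  have "\<exists>K\<in>{K. K \<subseteq> A \<and> compact K}. emeasure lborel A < emeasure lborel K + ennreal e"
    using e fin
    by (intro SUP_approx_ennreal[OF _ _ sup]) auto
  then obtain K where K: "K \<subseteq> A" "compact K" "emeasure lborel A < emeasure lborel K + ennreal e"
    by auto
  have finK: "emeasure lborel K < \<infinity>"
    using emeasure_mono[OF K(1), of lborel] fin by auto
  have "emeasure lborel (A - K) = emeasure lborel A - emeasure lborel K"
    using K finK by (intro emeasure_Diff) (auto simp: borel_compact)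
  also have "\<dots> < ennreal e"
    using K(3) finK emeasure_mono[OF K(1), of lborel]
    by (subst minus_less_iff_ennreal) (auto simp: add.commute less_top)
  finally show thesis using that K by blast
qed

text \<open>
  The modulus of continuity of \<open>f\<close> in \<open>L\<^sup>1\<close>.
\<close>

definition mean_modulus :: "('a::euclidean_space \<Rightarrow> 'b::real_normed_vector) \<Rightarrow> 'a \<Rightarrow> ennreal" where
  "mean_modulus f h = (\<integral>\<^sup>+x. ennreal (norm (f (h + x) - f x)) \<partial>lborel)"

lemma mean_modulus_add_le:
  fixes f g :: "'a::euclidean_space \<Rightarrow> 'b::{real_normed_vector, second_countable_topology}"
  assumes [measurable]: "f \<in> borel_measurable borel" "g \<in> borel_measurable borel"
  shows "mean_modulus (\<lambda>x. f x + g x) h \<le> mean_modulus f h + mean_modulus g h"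
proof -
  have "norm (f (h + x) + g (h + x) - (f x + g x)) \<le> norm (f (h + x) - f x) + norm (g (h + x) - g x)" for x
    by (rule order_trans[OF _ norm_triangle_ineq]) (simp add: algebra_simps)
  then have "mean_modulus (\<lambda>x. f x + g x) h
      \<le> (\<integral>\<^sup>+x. ennreal (norm (f (h + x) - f x)) + ennreal (norm (g (h + x) - g x)) \<partial>lborel)"
    unfolding mean_modulus_def
    by (intro nn_integral_mono) (simp add: ennreal_plus[symmetric] ennreal_leI del: ennreal_plus)
  also have "\<dots> = mean_modulus f h + mean_modulus g h"
    unfolding mean_modulus_def by (intro nn_integral_add) auto
  finally show ?thesis .
qed

lemma mean_modulus_le_norm:
  fixes f :: "'a::euclidean_space \<Rightarrow> 'b::{real_normed_vector, second_countable_topology}"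
  assumes [measurable]: "f \<in> borel_measurable borel"
  shows "mean_modulus f h \<le> 2 * (\<integral>\<^sup>+x. ennreal (norm (f x)) \<partial>lborel)"
proof -
  have "mean_modulus f h \<le> (\<integral>\<^sup>+x. ennreal (norm (f (h + x))) + ennreal (norm (f x)) \<partial>lborel)"
    unfolding mean_modulus_def
    by (intro nn_integral_mono)
       (simp add: ennreal_plus[symmetric] ennreal_leI norm_triangle_ineq4 del: ennreal_plus)
  also have "\<dots> = 2 * (\<integral>\<^sup>+x. ennreal (norm (f x)) \<partial>lborel)"
    using nn_integral_lborel_shift[of "\<lambda>x. ennreal (norm (f x))" h]
    by (simp add: nn_integral_add mult_2)
  finally show ?thesis .
qed

text \<open>
  The property is stable under sums and under limits in \<open>L\<^sup>1\<close>, so indicators of sets \<open>A\<close> suffice.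
  Choose \<open>K \<subseteq> A \<subseteq> U\<close> with \<open>K\<close> compact, \<open>U\<close> open and \<open>U - K\<close> of small measure. A translation shorter than
  the distance from \<open>K\<close> to the complement of \<open>U\<close> changes the membership of a point in \<open>A\<close> only if the
  point or its translate lies in \<open>U - K\<close>.
\<close>

lemma translation_continuous_in_mean:
  fixes f :: "'a::euclidean_space \<Rightarrow> 'b::{banach, second_countable_topology}"
  assumes "integrable lborel f" and "e > (0::real)"
  shows "\<exists>d>0. \<forall>h. norm h < d \<longrightarrow> mean_modulus f h \<le> ennreal e"
  using assms
proof (induction f arbitrary: e)
  case (base A c)
  then have [measurable]: "A \<in> sets borel" by simp
  \<comment> \<open>The final bound is \<open>norm c\<close> times twice the measure of \<open>U - K\<close>, which is at most \<open>2 e'\<close>.\<close>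
  define e' where "e' = e / (4 * (norm c + 1))"
  have e': "e' > 0" using base by (simp add: e'_def add_nonneg_pos)
  obtain K where K: "compact K" "K \<subseteq> A" "emeasure lborel (A - K) < ennreal e'"
    using lborel_inner_regular[OF \<open>A \<in> sets borel\<close> _ e'] base by auto
  obtain U where U: "open U" "A \<subseteq> U" "emeasure lborel (U - A) < ennreal e'"
    using outer_regular_lborel[OF \<open>A \<in> sets borel\<close> e'] by auto
  have [measurable]: "K \<in> sets borel" "U \<in> sets borel" using K U by (auto simp: borel_compact)
  have UK: "emeasure lborel (U - K) \<le> ennreal (2 * e')"
  proof -
    have "U - K \<subseteq> (A - K) \<union> (U - A)" by auto
    then have "emeasure lborel (U - K) \<le> emeasure lborel ((A - K) \<union> (U - A))"
      by (intro emeasure_mono) auto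
    also have "\<dots> \<le> emeasure lborel (A - K) + emeasure lborel (U - A)"
      by (intro emeasure_subadditive) auto
    also have "\<dots> \<le> ennreal e' + ennreal e'" using K(3) U(3) by (intro add_mono) auto
    also have "\<dots> = ennreal (2 * e')" using e' by (simp flip: ennreal_plus)
    finally show ?thesis .
  qed
  have "K \<inter> - U = {}" using K U by auto
  then obtain d where d: "d > 0" "\<And>x y. x \<in> K \<Longrightarrow> y \<notin> U \<Longrightarrow> d \<le> dist x y"
    using separate_compact_closed[of K "- U"] K(1) U(1) by (auto simp: closed_Compl)
  have "mean_modulus (\<lambda>x. indicator A x *\<^sub>R c) h \<le> ennreal e" if h: "norm h < d" for h
  proof -
    have KU: "h + x \<in> U" if "x \<in> K" for x
      using d(2)[OF that, of "h + x"] h by (auto simp: dist_norm)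
    have UK': "x \<in> U" if "h + x \<in> K" for x
      using d(2)[OF that, of x] h by (auto simp: dist_norm)
    have *: "ennreal (norm (indicator A (h + x) *\<^sub>R c - indicator A x *\<^sub>R c))
        \<le> ennreal (norm c) * (indicator (U - K) (h + x) + indicator (U - K) x)" for x
      using KU[of x] UK'[of x] K(2) U(2)
      by (cases "x \<in> A"; cases "h + x \<in> A"; cases "x \<in> K"; cases "h + x \<in> K")
         (auto simp: indicator_def distrib_left)
    have "mean_modulus (\<lambda>x. indicator A x *\<^sub>R c) h
        \<le> (\<integral>\<^sup>+x. ennreal (norm c) * (indicator (U - K) (h + x) + indicator (U - K) x) \<partial>lborel)"
      unfolding mean_modulus_def by (intro nn_integral_mono *)
    also have "\<dots> = ennreal (norm c) * (2 * emeasure lborel (U - K))"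
      using nn_integral_lborel_shift[of "indicator (U - K)" h]
      by (simp add: nn_integral_cmult nn_integral_add mult_2)
    also have "\<dots> \<le> ennreal (norm c) * (2 * ennreal (2 * e'))"
      by (intro mult_left_mono UK) auto
    also have "\<dots> = ennreal (norm c * (4 * e'))"
    proof -
      have "2 * ennreal (2 * e') = ennreal (2 * e' + 2 * e')"
        unfolding mult_2 using e' by (subst ennreal_plus) auto
      then show ?thesis using e' by (subst ennreal_mult) auto
    qed
    also have "\<dots> \<le> ennreal e"
    proof (rule ennreal_leI)
      have "4 * (norm c + 1) > 0" by (intro mult_pos_pos add_nonneg_pos) auto
      then show "norm c * (4 * e') \<le> e"
        using base(3) unfolding e'_def
        by (simp only: times_divide_eq_right pos_divide_le_eq) (simp add: algebra_simps)
    qed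
    finally show ?thesis .
  qed
  then show ?case using d(1) by blast
next
  case (add f g)
  then have [measurable]: "f \<in> borel_measurable borel" "g \<in> borel_measurable borel"
    by (auto dest: borel_measurable_integrable)
  obtain d1 where d1: "d1 > 0" "\<And>h. norm h < d1 \<Longrightarrow> mean_modulus f h \<le> ennreal (e/2)"
    using add.IH(1)[of "e/2"] add.prems by auto
  obtain d2 where d2: "d2 > 0" "\<And>h. norm h < d2 \<Longrightarrow> mean_modulus g h \<le> ennreal (e/2)"
    using add.IH(2)[of "e/2"] add.prems by auto
  have "mean_modulus (\<lambda>x. f x + g x) h \<le> ennreal e" if "norm h < min d1 d2" for h
  proof -
    have "mean_modulus (\<lambda>x. f x + g x) h \<le> mean_modulus f h + mean_modulus g h"
      by (rule mean_modulus_add_le) auto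
    also have "\<dots> \<le> ennreal (e/2) + ennreal (e/2)"
      using d1(2)[of h] d2(2)[of h] that by (intro add_mono) auto
    also have "\<dots> = ennreal e" using add.prems by (simp flip: ennreal_plus)
    finally show ?thesis .
  qed
  then show ?case using d1(1) d2(1) by (intro exI[of _ "min d1 d2"]) auto
next
  case (lim f s)
  have [measurable]: "f \<in> borel_measurable borel" "\<And>i. s i \<in> borel_measurable borel"
    using lim by (auto dest: borel_measurable_integrable)
  have "(\<lambda>i. \<integral>\<^sup>+x. ennreal (norm (f x - s i x)) \<partial>lborel) \<longlonglongrightarrow> 0"
  proof (rule nn_integral_dominated_convergence_norm[where w = "\<lambda>x. 2 * norm (f x)"])
    show "(\<integral>\<^sup>+x. ennreal (2 * norm (f x)) \<partial>lborel) < \<infinity>"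
      using lim(4) by (simp add: integrable_iff_bounded ennreal_mult' nn_integral_cmult ennreal_mult_less_top)
  qed (use lim in auto)
  then have "eventually (\<lambda>i. (\<integral>\<^sup>+x. ennreal (norm (f x - s i x)) \<partial>lborel) < ennreal (e/4)) sequentially"
    using lim.prems by (intro order_tendstoD) auto
  then obtain i where i: "(\<integral>\<^sup>+x. ennreal (norm (f x - s i x)) \<partial>lborel) < ennreal (e/4)"
    by (auto simp: eventually_sequentially)
  obtain d where d: "d > 0" "\<And>h. norm h < d \<Longrightarrow> mean_modulus (s i) h \<le> ennreal (e/2)"
    using lim.IH[of "e/2" i] lim.prems by auto
  have "mean_modulus f h \<le> ennreal e" if "norm h < d" for h
  proof -
    have "mean_modulus (\<lambda>x. s i x + (f x - s i x)) h \<le> mean_modulus (s i) h + mean_modulus (\<lambda>x. f x - s i x) h"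
      by (rule mean_modulus_add_le) auto
    also have "\<dots> \<le> ennreal (e/2) + 2 * ennreal (e/4)"
      using i by (intro add_mono d(2) that order_trans[OF mean_modulus_le_norm] mult_left_mono) auto
    also have "\<dots> = ennreal e"
      using lim.prems by (simp add: mult_2 flip: ennreal_plus)
    finally show ?thesis by simp
  qed
  then show ?case using d(1) by blast
qed

section \<open>Complex lines in coordinate directions\<close>

lemma bounded_linear_axis: "bounded_linear (axis j :: 'a::euclidean_space \<Rightarrow> 'a ^ 'n)"
  by (simp add: linear_conv_bounded_linear[symmetric], rule linearI)
     (auto simp: vec_eq_iff axis_def)

lemma measurable_axis [measurable]:
  "f \<in> borel_measurable M \<Longrightarrow> (\<lambda>x. axis j (f x) :: 'a::euclidean_space ^ 'n) \<in> borel_measurable M"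
  by (rule measurable_compose[OF _ borel_measurable_continuous_onI[OF linear_continuous_on[OF bounded_linear_axis]]])

lemma measurable_vec_nth [measurable]:
  "f \<in> borel_measurable M \<Longrightarrow> (\<lambda>x. (f x :: 'a::euclidean_space ^ 'n) $ j) \<in> borel_measurable M"
  by (rule measurable_compose[OF _ borel_measurable_continuous_onI[OF linear_continuous_on[OF bounded_linear_vec_nth]]])

lemma axis_add: "axis j (a + b) = axis j a + (axis j b :: 'a::real_normed_vector ^ 'n)"
  by (auto simp: vec_eq_iff axis_def)

lemma axis_nth_same [simp]: "axis j w $ j = w"
  by (simp add: axis_def)

text \<open>
  For each \<open>w\<close> the translation by \<open>w\<close> in direction \<open>j\<close> leaves the integral over \<open>y\<close> unchanged and
  moves the argument of \<open>\<theta>\<close> instead. The identity writes integrals over the whole space as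
  averages of line integrals, without a decomposition of the space into factors.
\<close>

lemma line_average:
  fixes G :: "complex ^ 'n \<Rightarrow> ennreal" and \<theta> :: "complex \<Rightarrow> ennreal"
  assumes [measurable]: "G \<in> borel_measurable borel" "\<theta> \<in> borel_measurable borel"
  shows "(\<integral>\<^sup>+y. \<theta> (y $ j) * (\<integral>\<^sup>+w. G (y + axis j w) \<partial>lborel) \<partial>lborel)
       = (\<integral>\<^sup>+w. \<theta> w \<partial>lborel) * (\<integral>\<^sup>+y. G y \<partial>lborel)"
proof -
  have "(\<integral>\<^sup>+y. \<theta> (y $ j) * (\<integral>\<^sup>+w. G (y + axis j w) \<partial>lborel) \<partial>lborel)
      = (\<integral>\<^sup>+y. (\<integral>\<^sup>+w. \<theta> (y $ j) * G (y + axis j w) \<partial>lborel) \<partial>lborel)"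
    by (simp add: nn_integral_cmult)
  also have "\<dots> = (\<integral>\<^sup>+w. (\<integral>\<^sup>+y. \<theta> (y $ j) * G (y + axis j w) \<partial>lborel) \<partial>lborel)"
    by (rule lborel_pair.Fubini') measurable
  also have "\<dots> = (\<integral>\<^sup>+w. (\<integral>\<^sup>+y. \<theta> (y $ j - w) * G y \<partial>lborel) \<partial>lborel)"
  proof (rule nn_integral_cong)
    fix w
    show "(\<integral>\<^sup>+y. \<theta> (y $ j) * G (y + axis j w) \<partial>lborel) = (\<integral>\<^sup>+y. \<theta> (y $ j - w) * G y \<partial>lborel)"
      using nn_integral_lborel_shift[of "\<lambda>y. \<theta> (y $ j - w) * G y" "axis j w"]
      by (simp add: axis_def add.commute)
  qed
  also have "\<dots> = (\<integral>\<^sup>+y. (\<integral>\<^sup>+w. \<theta> (y $ j - w) * G y \<partial>lborel) \<partial>lborel)"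
    by (rule lborel_pair.Fubini') measurable
  also have "\<dots> = (\<integral>\<^sup>+y. (\<integral>\<^sup>+w. \<theta> w \<partial>lborel) * G y \<partial>lborel)"
    by (simp add: nn_integral_multc nn_integral_lborel_reflect)
  finally show ?thesis by (simp add: nn_integral_cmult)
qed

section \<open>The d-bar operator on smooth functions\<close>

lemma dbar_mult:
  assumes "f differentiable (at x)" "g differentiable (at x)"
  shows "dbar j (\<lambda>x. f x * g x) x = f x * dbar j g x + dbar j f x * g x"
proof -
  have "frechet_derivative (\<lambda>x. f x * g x) (at x)
      = (\<lambda>h. f x * frechet_derivative g (at x) h + frechet_derivative f (at x) h * g x)"
    using has_derivative_mult[OF assms[unfolded frechet_derivative_works]]
    by (rule frechet_derivative_at[symmetric])
  then show ?thesis by (simp add: dbar_def algebra_simps add_divide_distrib)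
qed

lemma dbar_eq:
  assumes "(f has_derivative f') (at x)"
  shows "dbar j f x = (f' (axis j 1) + \<i> * f' (axis j \<i>)) / 2"
  using frechet_derivative_at[OF assms] by (simp add: dbar_def)

lemma dbar_coordinate:
  fixes x :: "complex ^ 'n"
  assumes "(G has_derivative G') (at (x $ j - c))"
  shows "dbar j (\<lambda>x. G (x $ j - c)) x = (G' 1 + \<i> * G' \<i>) / 2"
proof -
  have "((\<lambda>x::complex^'n. x $ j - c) has_derivative (\<lambda>h. h $ j)) (at x)"
    by (rule has_derivative_eq_rhs[OF has_derivative_diff[OF
          bounded_linear_imp_has_derivative[OF bounded_linear_vec_nth] has_derivative_const]]) simp
  from has_derivative_compose[OF this assms] show ?thesis
    by (subst dbar_eq) (auto simp: axis_def)
qed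

lemma dbar_cong_open:
  assumes "open S" "x \<in> S" "\<And>y. y \<in> S \<Longrightarrow> f y = g y"
  shows "dbar j f x = dbar j g x"
proof -
  have "(f has_derivative D) (at x) \<longleftrightarrow> (g has_derivative D) (at x)" for D
    using has_derivative_transform_within_open[of f D x UNIV S g]
      has_derivative_transform_within_open[of g D x UNIV S f] assms by auto
  then show ?thesis by (simp add: dbar_def frechet_derivative_def)
qed

lemma dbar_eq_0_open:
  assumes "open S" "x \<in> S" "\<And>y. y \<in> S \<Longrightarrow> f y = 0"
  shows "dbar j f x = 0"
proof -
  have "dbar j f x = dbar j (\<lambda>x. 0) x" by (rule dbar_cong_open[OF assms])
  also have "\<dots> = 0" by (subst dbar_eq[OF has_derivative_const]) simp
  finally show ?thesis .
qed

lemma continuous_on_dbar: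
  fixes f :: "complex ^ 'n \<Rightarrow> complex"
  assumes "smooth f" shows "continuous_on UNIV (dbar j f)"
proof -
  have "continuous_on UNIV (\<lambda>x. frechet_derivative f (at x) (axis j c))" if "c = 1 \<or> c = \<i>" for c
    using that assms
    by (intro smooth_continuous smooth_derivative) (auto simp: Basis_vec_def Basis_complex_def)
  then show ?thesis unfolding dbar_def[abs_def] by (auto intro!: continuous_intros)
qed

lemma smooth_coordinate: "smooth (\<lambda>x :: complex ^ 'n. x $ j - c)"
  by (intro smooth_diff smooth_bounded_linear bounded_linear_vec_nth smooth_const)

lemma smooth_cnj: "smooth f \<Longrightarrow> smooth (\<lambda>x. cnj (f x))"
  by (rule smooth_bounded_linear_comp[OF bounded_linear_cnj])

lemma smooth_differentiable: "smooth f \<Longrightarrow> f differentiable (at x)"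
  using smooth_has_derivative[of f x] by (auto simp: differentiable_def)

subsection \<open>A regularised Cauchy kernel\<close>

text \<open>
  The Cauchy kernel \<open>1 / w\<close>, made smooth at the origin.
\<close>

definition reg_cauchy :: "real \<Rightarrow> complex \<Rightarrow> complex" where
  "reg_cauchy e w = cnj w / (w * cnj w + of_real (e\<^sup>2))"

definition poisson :: "real \<Rightarrow> complex \<Rightarrow> real" where
  "poisson e w = e\<^sup>2 / ((cmod w)\<^sup>2 + e\<^sup>2)\<^sup>2"

lemma reg_cauchy_denominator: "w * cnj w + of_real (e\<^sup>2) = of_real ((cmod w)\<^sup>2 + e\<^sup>2)"
  by (simp only: complex_norm_square[symmetric] of_real_add)

lemma reg_cauchy_denominator_nz: "e > 0 \<Longrightarrow> w * cnj w + of_real (e\<^sup>2) \<noteq> 0"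
  unfolding reg_cauchy_denominator of_real_eq_0_iff
  by (simp add: add_nonneg_eq_0_iff)

lemma smooth_reg_cauchy: "e > 0 \<Longrightarrow> smooth (\<lambda>x :: complex ^ 'n. reg_cauchy e (x $ j - c))"
  unfolding reg_cauchy_def
  by (intro smooth_divide smooth_add smooth_mult smooth_cnj smooth_coordinate smooth_const
      reg_cauchy_denominator_nz)

lemma dbar_reg_cauchy:
  assumes "e > 0"
  shows "dbar j (\<lambda>x. reg_cauchy e (x $ j - c)) x = of_real (poisson e (x $ j - c))"
proof -
  define w where "w = x $ j - c"
  define N where "N = w * cnj w + of_real (e\<^sup>2)"
  have N: "N \<noteq> 0" using reg_cauchy_denominator_nz[OF assms] by (simp add: N_def)
  have "(reg_cauchy e has_derivative
      (\<lambda>h. (cnj h * N - cnj w * (w * cnj h + h * cnj w)) / (N * N))) (at w)"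
    unfolding reg_cauchy_def[abs_def] N_def
    using reg_cauchy_denominator_nz[OF assms]
    by (auto intro!: derivative_eq_intros bounded_linear.has_derivative[OF bounded_linear_cnj])
  then have "dbar j (\<lambda>x. reg_cauchy e (x $ j - c)) x = (N - w * cnj w) / (N * N)"
    by (subst dbar_coordinate) (auto simp: w_def[symmetric] field_simps N)
  also have "\<dots> = of_real (poisson e w)"
    unfolding N_def reg_cauchy_denominator
    unfolding complex_norm_square[symmetric]
    by (simp add: poisson_def power2_eq_square)
  finally show ?thesis by (simp add: w_def)
qed

lemma norm_reg_cauchy_le: "e > 0 \<Longrightarrow> ennreal (cmod (reg_cauchy e w)) \<le> riesz 1 w"
proof (cases "w = 0")
  case False
  assume e: "e > 0"
  have "cmod (reg_cauchy e w) = cmod w / ((cmod w)\<^sup>2 + e\<^sup>2)"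
    unfolding reg_cauchy_def reg_cauchy_denominator
    by (simp add: norm_divide del: of_real_add of_real_power)
  also have "\<dots> \<le> cmod w / (cmod w)\<^sup>2"
    using False by (intro divide_left_mono) (auto intro!: mult_pos_pos add_pos_nonneg)
  also have "\<dots> = cmod w powr -1"
    using False by (simp add: powr_minus power2_eq_square divide_inverse)
  finally show ?thesis by (simp add: riesz_def ennreal_leI)
qed (simp add: reg_cauchy_def riesz_def)

lemma poisson_nonneg: "poisson e w \<ge> 0"
  by (simp add: poisson_def)

text \<open>
  The functions \<open>poisson e\<close> are dilates of \<open>poisson 1\<close> with the same mass, hence an approximate
  identity as \<open>e\<close> tends to 0.
\<close>

lemma poisson_scale: "e > 0 \<Longrightarrow> poisson e (e *\<^sub>R w) = poisson 1 w / e\<^sup>2"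
proof -
  assume e: "e > 0"
  have "(cmod (e *\<^sub>R w))\<^sup>2 + e\<^sup>2 = e\<^sup>2 * ((cmod w)\<^sup>2 + 1)"
    using e by (simp add: power_mult_distrib algebra_simps)
  then show ?thesis using e
    unfolding poisson_def by (simp add: power2_eq_square)
qed

lemma poisson_measurable [measurable]: "poisson e \<in> borel_measurable borel"
  unfolding poisson_def by measurable

lemma nn_integral_poisson:
  assumes "e > 0"
  shows "(\<integral>\<^sup>+w. ennreal (poisson e w) \<partial>lborel) = cauchy_mass"
proof -
  have "(\<integral>\<^sup>+w. ennreal (poisson e w) \<partial>lborel)
      = ennreal (e\<^sup>2) * (\<integral>\<^sup>+w. ennreal (poisson 1 w / e\<^sup>2) \<partial>lborel)"
    using assms by (subst nn_integral_lborel_scale[of _ e]) (auto simp: poisson_scale)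
  also have "\<dots> = (\<integral>\<^sup>+w. ennreal (poisson 1 w) \<partial>lborel)"
    using assms
    by (subst nn_integral_cmult[symmetric]) (auto simp: ennreal_mult'[symmetric])
  finally show ?thesis by (simp add: poisson_def cauchy_mass_def add.commute)
qed

lemma poisson_le: "e > 0 \<Longrightarrow> poisson e w \<le> 1 / e\<^sup>2"
proof -
  assume e: "e > 0"
  have "(e\<^sup>2)\<^sup>2 \<le> ((cmod w)\<^sup>2 + e\<^sup>2)\<^sup>2" by (intro power_mono) auto
  then have "e\<^sup>2 / ((cmod w)\<^sup>2 + e\<^sup>2)\<^sup>2 \<le> e\<^sup>2 / (e\<^sup>2)\<^sup>2"
    using e by (intro divide_left_mono mult_pos_pos) (auto intro!: zero_less_power add_nonneg_pos)
  then show ?thesis using e by (simp add: poisson_def power2_eq_square)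
qed

subsection \<open>A transverse bump\<close>

definition transverse_sq :: "'n \<Rightarrow> complex ^ 'n \<Rightarrow> real" where
  "transverse_sq j y = (\<Sum>i\<in>UNIV - {j}. (cmod (y $ i))\<^sup>2)"

definition transverse_bump :: "'n \<Rightarrow> real \<Rightarrow> complex ^ 'n \<Rightarrow> real" where
  "transverse_bump j e y = flat 0 (1 - transverse_sq j y / e\<^sup>2)"

lemma transverse_sq_axis [simp]: "transverse_sq j (y + axis j w) = transverse_sq j y"
  by (auto simp: transverse_sq_def axis_def intro!: sum.cong)

lemma transverse_sq_scale: "transverse_sq j (e *\<^sub>R y) = e\<^sup>2 * transverse_sq j y"
  by (simp add: transverse_sq_def sum_distrib_left power_mult_distrib)

lemma transverse_bump_axis: "transverse_bump j e (y + axis j w) = transverse_bump j e y"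
  by (simp add: transverse_bump_def)

lemma transverse_bump_scale: "e > 0 \<Longrightarrow> transverse_bump j e (e *\<^sub>R y) = transverse_bump j 1 y"
  by (simp add: transverse_bump_def transverse_sq_scale)

lemma transverse_bump_nonneg: "transverse_bump j e y \<ge> 0"
  by (simp add: transverse_bump_def flat_nonneg)

lemma transverse_bump_le_1: "transverse_bump j e y \<le> 1"
  by (auto simp: transverse_bump_def flat_def)

lemma transverse_bump_eq_0:
  assumes "e > 0" "i \<noteq> j" "cmod (y $ i) \<ge> e" shows "transverse_bump j e y = 0"
proof -
  have "e\<^sup>2 \<le> (cmod (y $ i))\<^sup>2" using assms by (intro power_mono) auto
  also have "\<dots> \<le> transverse_sq j y"
    unfolding transverse_sq_def using assms by (intro member_le_sum) auto
  finally show ?thesis using assms by (simp add: transverse_bump_def flat_eq_0)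
qed

lemma transverse_sq_measurable [measurable]: "transverse_sq j \<in> borel_measurable borel"
  unfolding transverse_sq_def by measurable

lemma flat_measurable [measurable]: "flat n \<in> borel_measurable borel"
  by (rule borel_measurable_continuous_onI[OF smooth_continuous[OF smooth_flat]])

lemma transverse_bump_measurable [measurable]: "transverse_bump j e \<in> borel_measurable borel"
  unfolding transverse_bump_def by measurable

lemma smooth_cmod_sq: 
  assumes "smooth (f :: 'a::euclidean_space \<Rightarrow> complex)" shows "smooth (\<lambda>x. (cmod (f x))\<^sup>2)"
  unfolding cmod_power2
  by (intro smooth_add smooth_power smooth_bounded_linear_comp[OF bounded_linear_Re]
      smooth_bounded_linear_comp[OF bounded_linear_Im] assms)

lemma smooth_transverse_bump: "smooth (\<lambda>x. transverse_bump j e (x - z))"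
  unfolding transverse_bump_def transverse_sq_def vector_minus_component divide_inverse
  by (intro smooth_compose_real[OF smooth_flat] smooth_diff smooth_const smooth_mult smooth_sum
      smooth_cmod_sq smooth_coordinate[unfolded])

text \<open>
  The bump is constant along the lines in direction \<open>j\<close>.
\<close>

lemma dbar_transverse_bump:
  "dbar j (\<lambda>x. of_real (transverse_bump j e (x - z))) x = 0"
proof -
  let ?b = "\<lambda>x. complex_of_real (transverse_bump j e (x - z))"
  have d: "(?b has_derivative frechet_derivative ?b (at x)) (at x)"
    by (intro smooth_has_derivative smooth_of_real smooth_transverse_bump)
  have "frechet_derivative ?b (at x) (axis j v) = 0" for v
  proof -
    have l: "((\<lambda>t::real. x + t *\<^sub>R axis j v) has_derivative (\<lambda>t. t *\<^sub>R axis j v)) (at 0)"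
      by (auto intro!: derivative_eq_intros)
    have "((\<lambda>t::real. ?b (x + t *\<^sub>R axis j v)) has_derivative
        (\<lambda>t. frechet_derivative ?b (at x) (t *\<^sub>R axis j v))) (at 0)"
      using has_derivative_compose[OF l, of ?b "frechet_derivative ?b (at x)"] d by simp
    moreover have "?b (x + t *\<^sub>R axis j v) = ?b x" for t
    proof -
      have "x + t *\<^sub>R axis j v - z = (x - z) + axis j (t *\<^sub>R v)"
        by (simp add: vec_eq_iff axis_def)
      then show ?thesis by (simp only: transverse_bump_axis)
    qed
    ultimately have "((\<lambda>t::real. ?b x) has_derivative
        (\<lambda>t. frechet_derivative ?b (at x) (t *\<^sub>R axis j v))) (at 0)"
      by simp
    from has_derivative_unique[OF this has_derivative_const]
    show ?thesis by (metis scaleR_one)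
  qed
  then show ?thesis by (simp add: dbar_def)
qed

section \<open>A Cauchy inequality along complex lines\<close>

definition polydisc :: "complex ^ 'n \<Rightarrow> real \<Rightarrow> (complex ^ 'n) set" where
  "polydisc c R = {x. \<forall>i. cmod (x $ i - c $ i) \<le> R}"

lemma closed_polydisc: "closed (polydisc c R)"
proof -
  have eq: "polydisc c R = (\<Inter>i. {x. cmod (x $ i - c $ i) \<le> R})" by (auto simp: polydisc_def)
  show ?thesis unfolding eq by (intro closed_INT ballI closed_Collect_le continuous_intros)
qed

lemma polydisc_borel [measurable]: "polydisc c R \<in> sets borel"
  by (rule borel_closed[OF closed_polydisc])

lemma compact_polydisc: "compact (polydisc c R)"
proof -
  have "norm (x - c) \<le> real CARD('a) * R" if "x \<in> polydisc c R" for x :: "complex ^ 'a"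
  proof -
    have "norm (x - c) \<le> (\<Sum>i\<in>UNIV. norm ((x - c) $ i))"
      unfolding norm_vec_def by (rule L2_set_le_sum) auto
    also have "\<dots> \<le> (\<Sum>i\<in>(UNIV :: 'a set). R)"
      using that by (intro sum_mono) (auto simp: polydisc_def)
    finally show ?thesis by simp
  qed
  then have "polydisc c R \<subseteq> cball c (real CARD('a) * R)"
    by (auto simp: dist_norm norm_minus_commute)
  then show ?thesis
    using closed_polydisc bounded_subset[OF bounded_cball] compact_eq_bounded_closed by blast
qed

definition transverse :: "'n \<Rightarrow> complex ^ 'n \<Rightarrow> complex ^ 'n" where
  "transverse j y = y - axis j (y $ j)"

lemma transverse_measurable [measurable]: "transverse j \<in> borel_measurable borel"
  unfolding transverse_def by measurable

lemma norm_transverse_le: "norm (transverse j y) \<le> norm y"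
  unfolding norm_vec_def by (rule L2_set_mono) (auto simp: transverse_def axis_def)

text \<open>
  The factor of \<open>f H\<close> that appears when the weak derivative is tested with the regularised
  Cauchy kernel in the coordinate \<open>j\<close> times a bump in the other coordinates. It has bounded support
  only in the transverse directions.
\<close>

definition mollifier :: "'n \<Rightarrow> real \<Rightarrow> complex ^ 'n \<Rightarrow> real" where
  "mollifier j e y = poisson e (y $ j) * transverse_bump j e y"

lemma mollifier_nonneg: "mollifier j e y \<ge> 0"
  by (simp add: mollifier_def poisson_nonneg transverse_bump_nonneg)

lemma mollifier_measurable [measurable]: "mollifier j e \<in> borel_measurable borel"
  unfolding mollifier_def by measurable

lemma mollifier_scale: "e > 0 \<Longrightarrow> mollifier j e (e *\<^sub>R y) = mollifier j 1 y / e\<^sup>2"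
  by (simp add: mollifier_def poisson_scale transverse_bump_scale)

text \<open>
  Averaging along lines with the indicator of a disc replaces the factor with unbounded support by
  its mass.
\<close>

lemma nn_integral_mollifier_finite:
  assumes e: "e > 0"
  shows "(\<integral>\<^sup>+y. ennreal (mollifier j e y) \<partial>lborel) < \<infinity>"
proof -
  let ?\<theta> = "indicator (ball 0 1) :: complex \<Rightarrow> ennreal"
  let ?S = "polydisc (0 :: complex ^ 'a) (max 1 e)"
  have "(\<integral>\<^sup>+w. ?\<theta> w \<partial>lborel) * (\<integral>\<^sup>+y. ennreal (mollifier j e y) \<partial>lborel)
      = (\<integral>\<^sup>+y. ?\<theta> (y $ j) * (\<integral>\<^sup>+w. ennreal (mollifier j e (y + axis j w)) \<partial>lborel) \<partial>lborel)"
    by (rule line_average[symmetric]) measurable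
  also have "\<dots> = (\<integral>\<^sup>+y. ?\<theta> (y $ j) * (ennreal (transverse_bump j e y) * cauchy_mass) \<partial>lborel)"
  proof (intro nn_integral_cong arg_cong[where f = "(*) _"])
    fix y :: "complex ^ 'a"
    have "(\<integral>\<^sup>+w. ennreal (mollifier j e (y + axis j w)) \<partial>lborel)
        = (\<integral>\<^sup>+w. ennreal (transverse_bump j e y) * ennreal (poisson e (y $ j + w)) \<partial>lborel)"
      by (intro nn_integral_cong)
         (simp add: mollifier_def transverse_bump_axis ennreal_mult[symmetric]
            poisson_nonneg transverse_bump_nonneg mult.commute)
    also have "\<dots> = ennreal (transverse_bump j e y) * cauchy_mass"
      using nn_integral_lborel_shift[of "\<lambda>w. ennreal (poisson e w)" "y $ j"] nn_integral_poisson[OF e]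
      by (simp add: nn_integral_cmult)
    finally show "(\<integral>\<^sup>+w. ennreal (mollifier j e (y + axis j w)) \<partial>lborel)
        = ennreal (transverse_bump j e y) * cauchy_mass" .
  qed
  also have "\<dots> \<le> (\<integral>\<^sup>+y. cauchy_mass * indicator ?S y \<partial>lborel)"
  proof (rule nn_integral_mono)
    fix y :: "complex ^ 'a"
    show "?\<theta> (y $ j) * (ennreal (transverse_bump j e y) * cauchy_mass) \<le> cauchy_mass * indicator ?S y"
    proof (cases "y \<in> ?S")
      case True
      have "ennreal (transverse_bump j e y) \<le> 1"
        using transverse_bump_le_1 by (simp add: ennreal_le_1)
      then have "?\<theta> (y $ j) * (ennreal (transverse_bump j e y) * cauchy_mass) \<le> 1 * (1 * cauchy_mass)"
        by (intro mult_mono) (auto simp: indicator_def)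
      then show ?thesis using True by simp
    next
      case False
      then obtain i where i: "cmod (y $ i) > max 1 e" by (auto simp: polydisc_def not_le)
      show ?thesis
      proof (cases "i = j")
        case True
        then show ?thesis using i by (auto simp: indicator_def)
      next
        case ne: False
        then show ?thesis using i transverse_bump_eq_0[OF e ne, of y] by auto
      qed
    qed
  qed
  also have "\<dots> = cauchy_mass * emeasure lborel ?S"
    by (rule nn_integral_cmult_indicator) auto
  also have "\<dots> < \<infinity>"
    using cauchy_mass_finite emeasure_compact_finite[OF compact_polydisc, of "0 :: complex^'a" "max 1 e"]
    by (simp add: ennreal_mult_less_top)
  finally show ?thesis
    using content_ball_gt_0_iff[of "0::complex" 1]
    by (auto simp: ennreal_mult_less_top emeasure_ball unit_ball_vol_2)
qed

lemma nn_integral_mollifier_pos: "(\<integral>\<^sup>+y. ennreal (mollifier j 1 y) \<partial>lborel) > 0"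
proof (rule ccontr)
  assume "\<not> ?thesis"
  then have "(\<integral>\<^sup>+y. ennreal (mollifier j 1 y) \<partial>lborel) = 0" by simp
  then have ae: "AE y in lborel. ennreal (mollifier j 1 y) = 0"
    by (rule nn_integral_0_iff_AE[THEN iffD1, rotated]) measurable
  have pos: "mollifier j 1 y > 0" if "y \<in> ball 0 1" for y
  proof -
    have "transverse_sq j y \<le> (\<Sum>i\<in>UNIV. (cmod (y $ i))\<^sup>2)"
      unfolding transverse_sq_def by (intro sum_mono2) auto
    also have "\<dots> = (norm y)\<^sup>2"
      by (simp add: norm_vec_def L2_set_def sum_nonneg)
    also have "\<dots> < 1" using that by (simp add: power_less_one_iff abs_square_less_1)
    finally have "transverse_bump j 1 y > 0" by (simp add: transverse_bump_def flat_pos)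
    moreover have "poisson 1 (y $ j) > 0"
    proof -
      have "(cmod (y $ j))\<^sup>2 + 1 > 0" by (intro add_nonneg_pos) auto
      then show ?thesis by (simp add: poisson_def)
    qed
    ultimately show ?thesis by (simp add: mollifier_def)
  qed
  have "AE y in lborel. y \<notin> ball (0 :: complex ^ 'a) 1"
    using ae by eventually_elim (use pos in \<open>force simp: ennreal_eq_0_iff\<close>)
  then have "emeasure lborel (ball (0 :: complex ^ 'a) 1) = 0"
    by (subst (asm) AE_iff_measurable[where N = "ball 0 1"]) auto
  then show False
    using content_ball_gt_0_iff[of "0 :: complex ^ 'a" 1] by (simp add: measure_def)
qed

definition line_potential :: "'n \<Rightarrow> (complex ^ 'n \<Rightarrow> ennreal) \<Rightarrow> complex ^ 'n \<Rightarrow> ennreal" where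
  "line_potential j F z = (\<integral>\<^sup>+w. F (z + axis j w) * riesz 1 w \<partial>lborel)"

lemma line_potential_measurable [measurable]:
  assumes [measurable]: "F \<in> borel_measurable borel"
  shows "line_potential j F \<in> borel_measurable borel"
  unfolding line_potential_def by measurable

text \<open>
  Averaging along lines with weight \<open>poisson e\<close> frees the line variable for a shift, which turns
  the kernel \<open>1 / \<bar>y\<^sub>j\<bar>\<close> into a line potential at a point that is displaced only transversally. As a
  result, the upper bound in \<open>mollified_weak_dbar\<close> is an average against the same mollifier as the
  quantity that it bounds.
\<close>

lemma line_potential_average:
  assumes [measurable]: "F \<in> borel_measurable borel" and e: "e > 0"
  shows "cauchy_mass * (\<integral>\<^sup>+y. F (z + y) * riesz 1 (y $ j) * ennreal (transverse_bump j e y) \<partial>lborel)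
       = (\<integral>\<^sup>+y. line_potential j F (z + transverse j y) * ennreal (mollifier j e y) \<partial>lborel)"
proof -
  let ?G = "\<lambda>y. F (z + y) * riesz 1 (y $ j) * ennreal (transverse_bump j e y)"
  have inner: "(\<integral>\<^sup>+w. ?G (y + axis j w) \<partial>lborel)
      = line_potential j F (z + transverse j y) * ennreal (transverse_bump j e y)" for y
  proof -
    let ?\<phi> = "\<lambda>v. F (z + transverse j y + axis j v) * riesz 1 v * ennreal (transverse_bump j e y)"
    have "?G (y + axis j w) = ?\<phi> (y $ j + w)" for w
      by (simp add: transverse_bump_axis transverse_def axis_add algebra_simps)
    then have "(\<integral>\<^sup>+w. ?G (y + axis j w) \<partial>lborel) = (\<integral>\<^sup>+w. ?\<phi> w \<partial>lborel)"
      using nn_integral_lborel_shift[of ?\<phi> "y $ j"] by simp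
    also have "\<dots> = line_potential j F (z + transverse j y) * ennreal (transverse_bump j e y)"
      unfolding line_potential_def by (rule nn_integral_multc) measurable
    finally show ?thesis .
  qed
  have "cauchy_mass * (\<integral>\<^sup>+y. ?G y \<partial>lborel)
      = (\<integral>\<^sup>+y. ennreal (poisson e (y $ j)) * (\<integral>\<^sup>+w. ?G (y + axis j w) \<partial>lborel) \<partial>lborel)"
    unfolding nn_integral_poisson[OF e, symmetric] by (rule line_average[symmetric]) measurable
  then show ?thesis
    unfolding inner
    by (simp add: mollifier_def ennreal_mult poisson_nonneg transverse_bump_nonneg mult_ac)
qed

lemma integrable_compact_mult_continuous:
  fixes f h :: "'a::euclidean_space \<Rightarrow> complex"
  assumes K: "compact K" and f: "integrable lborel (\<lambda>x. indicator K x *\<^sub>R f x)"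
    and h: "continuous_on UNIV h"
  shows "integrable lborel (\<lambda>x. indicator K x *\<^sub>R (f x * h x))"
proof -
  have "bounded (h ` K)"
    using K h by (intro compact_imp_bounded compact_continuous_image continuous_on_subset[OF h]) auto
  then obtain B where B: "\<And>x. x \<in> K \<Longrightarrow> cmod (h x) \<le> B" by (auto simp: bounded_iff)
  have [measurable]: "h \<in> borel_measurable borel" by (rule borel_measurable_continuous_onI[OF h])
  have [measurable]: "(\<lambda>x. indicator K x *\<^sub>R f x) \<in> borel_measurable borel"
    using borel_measurable_integrable[OF f] by simp
  have eq: "(\<lambda>x. indicator K x *\<^sub>R (f x * h x)) = (\<lambda>x. (indicator K x *\<^sub>R f x) * h x)" by auto
  show ?thesis
  proof (rule Bochner_Integration.integrable_bound[OF integrable_mult_right[OF f, of "of_real B"]])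
    show "AE x in lborel. norm (indicator K x *\<^sub>R (f x * h x)) \<le> norm (of_real B * (indicator K x *\<^sub>R f x))"
    proof (rule AE_I2)
      fix x
      have "cmod (f x) * cmod (h x) \<le> cmod (f x) * \<bar>B\<bar>" if "x \<in> K"
        using B[OF that] by (intro mult_left_mono) auto
      then show "norm (indicator K x *\<^sub>R (f x * h x)) \<le> norm (of_real B * (indicator K x *\<^sub>R f x))"
        by (auto simp: indicator_def norm_mult mult.commute)
    qed
  qed (unfold eq, measurable)
qed

lemma approximate_identity_tendsto_0:
  fixes \<omega> :: "'a::euclidean_space \<Rightarrow> ennreal" and \<kappa> :: "'a \<Rightarrow> real"
  assumes [measurable]: "\<omega> \<in> borel_measurable borel" "\<kappa> \<in> borel_measurable borel"
    and fin: "(\<integral>\<^sup>+t. ennreal (\<kappa> t) \<partial>lborel) < \<infinity>"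
    and bd: "\<And>h. \<omega> h \<le> B" "B < \<infinity>"
    and small: "\<And>e. e > 0 \<Longrightarrow> \<exists>d>0. \<forall>h. norm h < d \<longrightarrow> \<omega> h \<le> ennreal e"
  shows "(\<lambda>n. \<integral>\<^sup>+t. \<omega> ((1 / real (Suc n)) *\<^sub>R t) * ennreal (\<kappa> t) \<partial>lborel) \<longlonglongrightarrow> 0"
proof -
  \<comment> \<open>Dominated convergence: for fixed \<open>t\<close> the argument of \<open>\<omega>\<close> tends to 0.\<close>
  have lim: "(\<lambda>n. \<omega> ((1 / real (Suc n)) *\<^sub>R t)) \<longlonglongrightarrow> 0" for t
  proof (rule order_tendstoI)
    fix a :: ennreal assume a: "0 < a"
    obtain b where b: "0 < b" "b < a" using dense[OF a] by blast
    then obtain e where "b = ennreal e" "e \<ge> 0" by (cases b) (auto simp: top_unique)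
    then have e: "e > 0" "ennreal e < a" using b by (auto simp: le_less)
    obtain d where d: "d > 0" "\<And>h. norm h < d \<Longrightarrow> \<omega> h \<le> ennreal e" using small[OF e(1)] by auto
    have "(\<lambda>n. (1 / real (Suc n)) *\<^sub>R t) \<longlonglongrightarrow> 0 *\<^sub>R t"
      by (intro tendsto_intros) (use LIMSEQ_inverse_real_of_nat in \<open>simp add: inverse_eq_divide\<close>)
    then have "eventually (\<lambda>n. norm ((1 / real (Suc n)) *\<^sub>R t) < d) sequentially"
      using d(1) by (auto simp: tendsto_iff dist_norm)
    then show "eventually (\<lambda>n. \<omega> ((1 / real (Suc n)) *\<^sub>R t) < a) sequentially"
      by eventually_elim (use d e in \<open>blast intro: le_less_trans\<close>)
  qed simp
  have "(\<lambda>n. \<integral>\<^sup>+t. \<omega> ((1 / real (Suc n)) *\<^sub>R t) * ennreal (\<kappa> t) \<partial>lborel)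
      \<longlonglongrightarrow> (\<integral>\<^sup>+t. 0 \<partial>(lborel :: 'a measure))"
  proof (rule nn_integral_dominated_convergence[where w = "\<lambda>t. B * ennreal (\<kappa> t)"])
    show "(\<integral>\<^sup>+t. B * ennreal (\<kappa> t) \<partial>lborel) < \<infinity>"
      using fin bd(2) by (simp add: nn_integral_cmult ennreal_mult_less_top)
    show "AE t in lborel. (\<lambda>n. \<omega> ((1 / real (Suc n)) *\<^sub>R t) * ennreal (\<kappa> t)) \<longlonglongrightarrow> 0"
      using tendsto_mult_ennreal[OF lim tendsto_const] by auto
  qed (auto intro!: mult_right_mono bd)
  then show ?thesis by simp
qed

text \<open>
  The test function is the product of \<open>H\<close>, the regularised Cauchy kernel centred at \<open>z\<close> in the
  coordinate \<open>j\<close>, and a bump around \<open>z\<close> in the other coordinates. D-bar of the kernel gives the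
  mollifier on the left; d-bar of \<open>H\<close> is moved to the right, where the kernel is bounded by
  \<open>1 / \<bar>w\<bar>\<close>. The width \<open>e\<close> of the bump is less than the distance of \<open>z\<close> from the sides of the polydisc,
  which keeps the support inside.
\<close>

lemma mollified_weak_dbar:
  fixes f g H :: "complex ^ 'n \<Rightarrow> complex"
  assumes W: "\<And>\<phi>. test_function \<Omega> \<phi> \<Longrightarrow>
      (\<integral>x. f x * dbar j \<phi> x \<partial>lborel) = - (\<integral>x. g x * \<phi> x \<partial>lborel)"
    and K: "polydisc c R \<subseteq> \<Omega>"
    and f: "integrable lborel (\<lambda>x. indicator (polydisc c R) x *\<^sub>R f x)"
    and g: "integrable lborel (\<lambda>x. indicator (polydisc c R) x *\<^sub>R g x)"
    and H: "smooth H" "\<And>x. cmod (x $ j - c $ j) > r \<Longrightarrow> H x = 0"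
    and r: "r < R"
    and z: "\<And>i. i \<noteq> j \<Longrightarrow> cmod (z $ i - c $ i) < r"
    and e: "0 < e" "e < R - r"
  defines "F1 \<equiv> \<lambda>x. indicator (polydisc c R) x *\<^sub>R (f x * H x)"
    and "F2 \<equiv> \<lambda>x. indicator (polydisc c R) x *\<^sub>R (g x * H x + f x * dbar j H x)"
  shows "ennreal (cmod (\<integral>x. F1 x * of_real (mollifier j e (x - z)) \<partial>lborel))
    \<le> (\<integral>\<^sup>+x. ennreal (cmod (F2 x)) * riesz 1 ((x - z) $ j) * ennreal (transverse_bump j e (x - z)) \<partial>lborel)"
proof -
  let ?K = "polydisc c R"
  let ?T = "\<lambda>x. ennreal (cmod (F2 x)) * riesz 1 ((x - z) $ j) * ennreal (transverse_bump j e (x - z))"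
  let ?M = "\<integral>x. F1 x * of_real (mollifier j e (x - z)) \<partial>lborel"
  define k where "k = (\<lambda>x::complex^'n. reg_cauchy e (x $ j - z $ j))"
  define b where "b = (\<lambda>x. complex_of_real (transverse_bump j e (x - z)))"
  define \<phi> where "\<phi> = (\<lambda>x. H x * (k x * b x))"
  have sk: "smooth k" unfolding k_def by (rule smooth_reg_cauchy[OF e(1)])
  have sb: "smooth b" unfolding b_def by (intro smooth_of_real smooth_transverse_bump)
  have dk: "dbar j k x = of_real (poisson e (x $ j - z $ j))" for x
    unfolding k_def by (rule dbar_reg_cauchy[OF e(1)])
  have db: "dbar j b x = 0" for x
    unfolding b_def by (rule dbar_transverse_bump)
  have d\<phi>: "dbar j \<phi> x = H x * (dbar j k x * b x) + dbar j H x * (k x * b x)" for x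
    unfolding \<phi>_def
    by (simp add: dbar_mult smooth_differentiable smooth_mult sk sb H(1) db)
  have b0: "b x = 0" if "i \<noteq> j" "cmod (x $ i - z $ i) \<ge> e" for x i
    using transverse_bump_eq_0[OF e(1) that(1), of "x - z"] that(2) by (simp add: b_def)
  \<comment> \<open>The support of the test function lies in \<open>S\<close>.\<close>
  define S where "S = {x. cmod (x $ j - c $ j) \<le> r} \<inter> (\<Inter>i\<in>UNIV - {j}. {x. cmod (x $ i - z $ i) \<le> e})"
  have "closed S"
    unfolding S_def by (intro closed_Int closed_INT ballI closed_Collect_le continuous_intros)
  have "S \<subseteq> ?K"
  proof
    fix x assume x: "x \<in> S"
    have "cmod (x $ i - c $ i) \<le> R" for i
    proof (cases "i = j")
      case True then show ?thesis using x r by (simp add: S_def)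
    next
      case False
      then have "cmod (x $ i - z $ i) \<le> e" using x by (simp add: S_def)
      then show ?thesis
        using z[OF False] e norm_triangle_ineq[of "x $ i - z $ i" "z $ i - c $ i"] by simp
    qed
    then show "x \<in> ?K" by (simp add: polydisc_def)
  qed
  have out: "H x = 0 \<and> dbar j H x = 0 \<or> b x = 0" if nK: "x \<notin> ?K" for x
  proof -
    obtain i where i: "cmod (x $ i - c $ i) > R" using nK unfolding polydisc_def mem_Collect_eq not_all not_le by blast
    show ?thesis
    proof (cases "i = j")
      case True
      have "dbar j H x = 0"
        by (rule dbar_eq_0_open[of "{x. r < cmod (x $ j - c $ j)}"])
           (use i True r H(2) in \<open>auto intro!: open_Collect_less continuous_intros\<close>)
      then show ?thesis using i True r H(2)[of x] by auto
    next
      case False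
      have "cmod (x $ i - z $ i) \<ge> e"
        using i z[OF False] e norm_triangle_ineq[of "x $ i - z $ i" "z $ i - c $ i"] by simp
      then show ?thesis using b0[OF False] by blast
    qed
  qed
  have "{x. \<phi> x \<noteq> 0} \<subseteq> S"
  proof
    fix x assume x: "x \<in> {x. \<phi> x \<noteq> 0}"
    then have "cmod (x $ j - c $ j) \<le> r" using H(2)[of x] by (auto simp: \<phi>_def not_less[symmetric])
    moreover have "cmod (x $ i - z $ i) \<le> e" if "i \<noteq> j" for i
      using b0[OF that, of x] x by (auto simp: \<phi>_def intro: ccontr)
    ultimately show "x \<in> S" by (simp add: S_def)
  qed
  then have cl: "closure {x. \<phi> x \<noteq> 0} \<subseteq> ?K"
    using \<open>closed S\<close> \<open>S \<subseteq> ?K\<close> closure_minimal by blast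
  have "test_function \<Omega> \<phi>"
    unfolding test_function_def
  proof (intro conjI allI)
    show "C_k n \<phi>" for n
      using smooth_mult[OF H(1) smooth_mult[OF sk sb]] by (simp add: smooth_def \<phi>_def)
    show "compact (closure {x. \<phi> x \<noteq> 0})"
      using compact_Int_closed[OF compact_polydisc closed_closure, of c R "{x. \<phi> x \<noteq> 0}"] cl
      by (simp add: Int_absorb1)
    show "closure {x. \<phi> x \<noteq> 0} \<subseteq> \<Omega>" using cl K by blast
  qed
  note W = W[OF this]
  have ct: "continuous_on UNIV H" "continuous_on UNIV k" "continuous_on UNIV b"
    "continuous_on UNIV (dbar j H)" "continuous_on UNIV (dbar j k)"
    by (intro smooth_continuous continuous_on_dbar H sk sb)+
  have mol: "of_real (mollifier j e (x - z)) = dbar j k x * b x" for x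
    by (simp add: dk b_def mollifier_def)
  have i1: "integrable lborel (\<lambda>x. F1 x * of_real (mollifier j e (x - z)))"
  proof -
    have "integrable lborel (\<lambda>x. indicator ?K x *\<^sub>R (f x * (H x * (dbar j k x * b x))))"
      by (intro integrable_compact_mult_continuous[OF compact_polydisc f] continuous_on_mult ct)
    then show ?thesis by (simp add: mol F1_def mult.assoc)
  qed
  have i2: "integrable lborel (\<lambda>x. indicator ?K x *\<^sub>R (f x * (dbar j H x * (k x * b x))))"
    by (intro integrable_compact_mult_continuous[OF compact_polydisc f] continuous_on_mult ct)
  have i3: "integrable lborel (\<lambda>x. indicator ?K x *\<^sub>R (g x * (H x * (k x * b x))))"
    by (intro integrable_compact_mult_continuous[OF compact_polydisc g] continuous_on_mult ct)
  \<comment> \<open>Outside of the polydisc the test function and its derivative vanish, so the indicator may be inserted.\<close>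
  have e1: "f x * dbar j \<phi> x
      = F1 x * of_real (mollifier j e (x - z)) + indicator ?K x *\<^sub>R (f x * (dbar j H x * (k x * b x)))" for x
    using out[of x] unfolding d\<phi> mol F1_def by (auto simp: indicator_def algebra_simps)
  have e2: "g x * \<phi> x = indicator ?K x *\<^sub>R (g x * (H x * (k x * b x)))" for x
    using out[of x] unfolding \<phi>_def by (auto simp: indicator_def)
  have e3: "F2 x * (k x * b x) = indicator ?K x *\<^sub>R (g x * (H x * (k x * b x)))
      + indicator ?K x *\<^sub>R (f x * (dbar j H x * (k x * b x)))" for x
    unfolding F2_def by (auto simp: indicator_def algebra_simps)
  have "?M = - (\<integral>x. F2 x * (k x * b x) \<partial>lborel)"
  proof -
    have arith: "p = - (t + q)" if "p + q = - t" for p q t :: complex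
    proof -
      have "p = (p + q) - q" by simp
      then show ?thesis unfolding that by simp
    qed
    show ?thesis
      using W unfolding e1 e2 e3 Bochner_Integration.integral_add[OF i1 i2] Bochner_Integration.integral_add[OF i3 i2]
      by (rule arith)
  qed
  then have "ennreal (cmod ?M)
      \<le> (\<integral>\<^sup>+x. ennreal (cmod (F2 x * (k x * b x))) \<partial>lborel)"
  proof -
    have "integrable lborel (\<lambda>x. F2 x * (k x * b x))"
      unfolding e3 by (rule Bochner_Integration.integrable_add[OF i3 i2])
    from integral_norm_bound_ennreal[OF this] show ?thesis
      if "?M = - (\<integral>x. F2 x * (k x * b x) \<partial>lborel)"
      by (simp only: that norm_minus_cancel)
  qed
  also have "\<dots> \<le> (\<integral>\<^sup>+x. ?T x \<partial>lborel)"
  proof (rule nn_integral_mono)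
    fix x
    have "ennreal (cmod (F2 x * (k x * b x)))
        = ennreal (cmod (F2 x)) * ennreal (cmod (k x)) * ennreal (transverse_bump j e (x - z))"
      by (simp add: norm_mult b_def transverse_bump_nonneg ennreal_mult mult.assoc)
    also have "\<dots> \<le> ?T x"
      using norm_reg_cauchy_le[OF e(1)] unfolding k_def by (intro mult_mono order_refl) auto
    finally show "ennreal (cmod (F2 x * (k x * b x)))
        \<le> ?T x" .
  qed
  finally show ?thesis .
qed

definition line_variation :: "'n \<Rightarrow> (complex ^ 'n \<Rightarrow> complex) \<Rightarrow> complex ^ 'n \<Rightarrow> complex ^ 'n \<Rightarrow> ennreal" where
  "line_variation j F h z = (\<integral>\<^sup>+w. ennreal (cmod (F (h + (z + axis j w)) - F (z + axis j w))) * riesz 1 w \<partial>lborel)"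

lemma line_potential_shift_le:
  assumes [measurable]: "F \<in> borel_measurable borel"
  shows "line_potential j (\<lambda>x. ennreal (cmod (F x))) (z + h)
    \<le> line_potential j (\<lambda>x. ennreal (cmod (F x))) z + line_variation j F h z"
proof -
  have "ennreal (cmod (F (z + h + axis j w))) * riesz 1 w \<le> ennreal (cmod (F (z + axis j w))) * riesz 1 w
      + ennreal (cmod (F (h + (z + axis j w)) - F (z + axis j w))) * riesz 1 w" for w
  proof -
    have "cmod (F (h + (z + axis j w))) \<le> cmod (F (z + axis j w)) + cmod (F (h + (z + axis j w)) - F (z + axis j w))"
      using norm_triangle_ineq[of "F (z + axis j w)" "F (h + (z + axis j w)) - F (z + axis j w)"] by simp
    then show ?thesis
      unfolding distrib_right[symmetric]
      by (intro mult_right_mono) (auto simp: add_ac ennreal_leI simp flip: ennreal_plus)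
  qed
  then have "line_potential j (\<lambda>x. ennreal (cmod (F x))) (z + h)
    \<le> (\<integral>\<^sup>+w. ennreal (cmod (F (z + axis j w))) * riesz 1 w
      + ennreal (cmod (F (h + (z + axis j w)) - F (z + axis j w))) * riesz 1 w \<partial>lborel)"
    unfolding line_potential_def by (intro nn_integral_mono)
  also have "\<dots> = line_potential j (\<lambda>x. ennreal (cmod (F x))) z + line_variation j F h z"
    unfolding line_potential_def line_variation_def by (rule nn_integral_add) measurable
  finally show ?thesis .
qed

text \<open>
  As \<open>F\<close> vanishes far away from \<open>c\<close> in the coordinate \<open>j\<close>, only \<open>\<bar>w\<bar> < 3 R\<close> contributes, and there the
  kernel is integrable.
\<close>

lemma nn_integral_line_variation_le:
  assumes [measurable]: "F \<in> borel_measurable borel"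
    and supp: "\<And>x. cmod (x $ j - c) > R \<Longrightarrow> F x = 0" and h: "h $ j = 0" and R: "R > 0"
  shows "(\<integral>\<^sup>+z. line_variation j F h z * indicator {z. cmod (z $ j - c) \<le> R} z \<partial>lborel)
    \<le> (\<integral>\<^sup>+w. riesz 1 w * indicator (ball 0 (3 * R)) w \<partial>lborel) * mean_modulus F h"
proof -
  let ?d = "\<lambda>x. ennreal (cmod (F (h + x) - F x))"
  have "(\<integral>\<^sup>+z. line_variation j F h z * indicator {z. cmod (z $ j - c) \<le> R} z \<partial>lborel)
    \<le> (\<integral>\<^sup>+z. (\<integral>\<^sup>+w. ?d (z + axis j w) * (riesz 1 w * indicator (ball 0 (3 * R)) w) \<partial>lborel) \<partial>lborel)"
  proof (rule nn_integral_mono)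
    fix z :: "complex ^ 'a"
    show "line_variation j F h z * indicator {z. cmod (z $ j - c) \<le> R} z
      \<le> (\<integral>\<^sup>+w. ?d (z + axis j w) * (riesz 1 w * indicator (ball 0 (3 * R)) w) \<partial>lborel)"
    proof (cases "cmod (z $ j - c) \<le> R")
      case True
      have "?d (z + axis j w) * riesz 1 w \<le> ?d (z + axis j w) * (riesz 1 w * indicator (ball 0 (3 * R)) w)" for w
      proof (cases "norm w < 3 * R")
        case False
        have "cmod ((z $ j + w) - c) > R"
          using True False R norm_triangle_ineq2[of w "- (z $ j - c)"] by (simp add: algebra_simps norm_minus_commute)
        then have "F (z + axis j w) = 0" "F (h + (z + axis j w)) = 0"
          using h by (auto intro!: supp)
        then show ?thesis by simp
      qed auto
      then show ?thesis using True
        by (simp add: line_variation_def nn_integral_mono)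
    qed simp
  qed
  also have "\<dots> = (\<integral>\<^sup>+w. (\<integral>\<^sup>+z. ?d (z + axis j w) * (riesz 1 w * indicator (ball 0 (3 * R)) w) \<partial>lborel) \<partial>lborel)"
    by (rule lborel_pair.Fubini') measurable
  also have "\<dots> = (\<integral>\<^sup>+w. mean_modulus F h * (riesz 1 w * indicator (ball 0 (3 * R)) w) \<partial>lborel)"
  proof (rule nn_integral_cong)
    fix w
    have "(\<integral>\<^sup>+z. ?d (z + axis j w) \<partial>lborel) = mean_modulus F h"
      using nn_integral_lborel_shift[of ?d "axis j w"] by (simp add: mean_modulus_def add.commute)
    then show "(\<integral>\<^sup>+z. ?d (z + axis j w) * (riesz 1 w * indicator (ball 0 (3 * R)) w) \<partial>lborel)
        = mean_modulus F h * (riesz 1 w * indicator (ball 0 (3 * R)) w)"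
      by (subst nn_integral_multc) auto
  qed
  also have "\<dots> = (\<integral>\<^sup>+w. riesz 1 w * indicator (ball 0 (3 * R)) w \<partial>lborel) * mean_modulus F h"
    by (subst nn_integral_cmult) (auto simp: mult.commute)
  finally show ?thesis .
qed

lemma mean_modulus_measurable [measurable]:
  fixes F :: "'a::euclidean_space \<Rightarrow> 'b::{real_normed_vector, second_countable_topology}"
  assumes [measurable]: "F \<in> borel_measurable borel"
  shows "mean_modulus F \<in> borel_measurable borel"
  unfolding mean_modulus_def by measurable

text \<open>
  A Cauchy inequality for weak solutions, from \<open>mollified_weak_dbar\<close> as \<open>e\<close> tends to 0. Let \<open>S\<close> be
  the excess of the left side over the right side. For each \<open>e\<close>, the mass of the mollifier times \<open>S\<close> is
  bounded by oscillations of \<open>F1\<close> and \<open>F2\<close> near \<open>z\<close>, whose integrals over \<open>z\<close> are moduli of continuity in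
  \<open>L\<^sup>1\<close>. After the dilation \<open>y = e t\<close> these tend to 0, while the integral of \<open>S\<close> does not depend on \<open>e\<close>.
\<close>

theorem weak_dbar_cauchy_inequality:
  fixes f g H :: "complex ^ 'n \<Rightarrow> complex"
  assumes W: "\<And>\<phi>. test_function \<Omega> \<phi> \<Longrightarrow>
      (\<integral>x. f x * dbar j \<phi> x \<partial>lborel) = - (\<integral>x. g x * \<phi> x \<partial>lborel)"
    and K: "polydisc c R \<subseteq> \<Omega>"
    and f: "integrable lborel (\<lambda>x. indicator (polydisc c R) x *\<^sub>R f x)"
    and g: "integrable lborel (\<lambda>x. indicator (polydisc c R) x *\<^sub>R g x)"
    and H: "smooth H" "\<And>x. cmod (x $ j - c $ j) > r \<Longrightarrow> H x = 0"
    and r: "0 < r" "r < R"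
  shows "AE z in lborel. (\<forall>i. i \<noteq> j \<longrightarrow> cmod (z $ i - c $ i) < r) \<longrightarrow>
     cauchy_mass * ennreal (cmod (f z * H z))
     \<le> line_potential j (\<lambda>x. ennreal (cmod (g x * H x + f x * dbar j H x)) * indicator (polydisc c R) x) z"
proof -
  let ?K = "polydisc c R"
  define F1 where "F1 = (\<lambda>x. indicator ?K x *\<^sub>R (f x * H x))"
  define F2 where "F2 = (\<lambda>x. indicator ?K x *\<^sub>R (g x * H x + f x * dbar j H x))"
  have iF1: "integrable lborel F1"
    unfolding F1_def
    by (rule integrable_compact_mult_continuous[OF compact_polydisc f smooth_continuous[OF H(1)]])
  have iF2: "integrable lborel F2"
    using Bochner_Integration.integrable_add[OF
        integrable_compact_mult_continuous[OF compact_polydisc g smooth_continuous[OF H(1)]]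
        integrable_compact_mult_continuous[OF compact_polydisc f continuous_on_dbar[OF H(1)]], of j]
    by (simp add: F2_def scaleR_add_right)
  have [measurable]: "F1 \<in> borel_measurable borel" "F2 \<in> borel_measurable borel"
    using borel_measurable_integrable[OF iF1] borel_measurable_integrable[OF iF2] by simp_all
  define J where "J = line_potential j (\<lambda>x. ennreal (cmod (F2 x)))"
  have [measurable]: "J \<in> borel_measurable borel" unfolding J_def by measurable
  define A where "A = (\<integral>\<^sup>+w. riesz 1 w * indicator (ball 0 (3 * R)) w \<partial>lborel)"
  have A: "A < \<infinity>"
  proof -
    obtain C where "\<And>r. r > 0 \<Longrightarrow>
        (\<integral>\<^sup>+z. riesz 1 z * indicator (ball 0 r) z \<partial>lborel) = ennreal (C * r powr (2 - 1))"
      using nn_integral_riesz_ball[of 1] by auto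
    from this[of "3 * R"] show ?thesis using r by (simp add: A_def)
  qed
  \<comment> \<open>The oscillations of \<open>F1\<close> and \<open>F2\<close>, integrated over \<open>z\<close>.\<close>
  define \<omega> where "\<omega> = (\<lambda>y. cauchy_mass * mean_modulus F1 y + A * mean_modulus F2 (transverse j y))"
  have [measurable]: "\<omega> \<in> borel_measurable borel" unfolding \<omega>_def by measurable
  define Z where "Z = {z. cmod (z $ j - c $ j) \<le> R \<and> (\<forall>i. i \<noteq> j \<longrightarrow> cmod (z $ i - c $ i) < r)}"
  have [measurable]: "Z \<in> sets borel" unfolding Z_def by measurable
  define M where "M = (\<lambda>e. \<integral>\<^sup>+y. ennreal (mollifier j e y) \<partial>lborel)"
  \<comment> \<open>Truncated subtraction: \<open>S\<close> is the positive part of the excess, and 0 where \<open>J\<close> is infinite.\<close>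
  define S where "S = (\<lambda>z. (cauchy_mass * ennreal (cmod (F1 z)) - J z) * indicator Z z)"
  have [measurable]: "S \<in> borel_measurable borel" unfolding S_def by measurable

  have pointwise: "M e * S z \<le> cauchy_mass * (\<integral>\<^sup>+y. ennreal (cmod (F1 (y + z) - F1 z)) * ennreal (mollifier j e y) \<partial>lborel)
      + (\<integral>\<^sup>+y. (line_variation j F2 (transverse j y) z * indicator {z. cmod (z $ j - c $ j) \<le> R} z) * ennreal (mollifier j e y) \<partial>lborel)"
    (is "_ \<le> cauchy_mass * ?E1 + ?E2")
    if e: "0 < e" "e < R - r" for e z
  proof (cases "z \<in> Z")
    case True
    then have zj: "cmod (z $ j - c $ j) \<le> R" and zi: "\<And>i. i \<noteq> j \<Longrightarrow> cmod (z $ i - c $ i) < r"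
      by (auto simp: Z_def)
    let ?m = "\<lambda>x. complex_of_real (mollifier j e (x - z))"
    let ?a = "cauchy_mass * ennreal (cmod (F1 z))"
    let ?P = "\<integral>x. (F1 z - F1 x) * ?m x \<partial>lborel" and ?Q = "\<integral>x. F1 x * ?m x \<partial>lborel"
    have Mfin: "M e < \<infinity>" unfolding M_def by (rule nn_integral_mollifier_finite[OF e(1)])
    have Me: "(\<integral>\<^sup>+x. ennreal (mollifier j e (x - z)) \<partial>lborel) = M e"
      unfolding M_def using nn_integral_lborel_shift[of "\<lambda>x. ennreal (mollifier j e x)" "- z"] by simp
    have im: "integrable lborel (\<lambda>x. mollifier j e (x - z))"
      by (rule integrableI_nonneg) (use Mfin Me in \<open>auto simp: mollifier_nonneg\<close>)
    then have im': "integrable lborel ?m" by (rule integrable_of_real)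
    have intm: "ennreal (cmod (\<integral>x. ?m x \<partial>lborel)) = M e"
    proof -
      have "(\<integral>x. ?m x \<partial>lborel) = of_real (\<integral>x. mollifier j e (x - z) \<partial>lborel)"
        by (rule integral_of_real[OF im])
      moreover have "ennreal (\<integral>x. mollifier j e (x - z) \<partial>lborel) = M e"
        using nn_integral_eq_integral[OF im] by (simp add: mollifier_nonneg Me)
      moreover have "(\<integral>x. mollifier j e (x - z) \<partial>lborel) \<ge> 0"
        by (intro integral_nonneg_AE) (simp add: mollifier_nonneg)
      ultimately show ?thesis by simp
    qed
    have iF1m: "integrable lborel (\<lambda>x. F1 x * ?m x)"
    proof (rule Bochner_Integration.integrable_bound[OF integrable_mult_right[OF iF1, of "of_real (1 / e\<^sup>2)"]])
      have "mollifier j e y \<le> 1 / e\<^sup>2 * 1" for y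
        unfolding mollifier_def
        by (intro mult_mono poisson_le[OF e(1)] transverse_bump_le_1 transverse_bump_nonneg) auto
      then have "mollifier j e y \<le> 1 / e\<^sup>2" for y by simp
      then have "cmod (F1 x) * mollifier j e (x - z) \<le> cmod (F1 x) * (1 / e\<^sup>2)" for x
        by (intro mult_left_mono) auto
      then show "AE x in lborel. norm (F1 x * ?m x) \<le> norm (of_real (1 / e\<^sup>2) * F1 x)"
        using e(1) by (intro AE_I2) (simp add: norm_mult norm_divide mollifier_nonneg norm_power field_simps)
    qed measurable
    have icm: "integrable lborel (\<lambda>x. F1 z * ?m x)" by (intro integrable_mult_right im')
    have "F1 z * (\<integral>x. ?m x \<partial>lborel) = ?P + ?Q"
      using icm iF1m im' by (simp add: left_diff_distrib)
    then have "ennreal (cmod (F1 z)) * M e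
        \<le> ennreal (cmod ?P) + ennreal (cmod ?Q)"
    proof -
      have gen: "ennreal (cmod p) * ennreal (cmod q) \<le> ennreal (cmod s) + ennreal (cmod t)"
        if "p * q = s + t" for p q s t :: complex
      proof -
        have "ennreal (cmod p) * ennreal (cmod q) = ennreal (cmod (s + t))"
          unfolding that[symmetric] by (simp add: norm_mult ennreal_mult)
        also have "\<dots> \<le> ennreal (cmod s + cmod t)" by (intro ennreal_leI norm_triangle_ineq)
        finally show ?thesis by simp
      qed
      show ?thesis if "F1 z * (\<integral>x. ?m x \<partial>lborel)
          = ?P + ?Q"
        using gen[OF that] unfolding intm .
    qed
    also have "ennreal (cmod ?P) \<le> ?E1"
    proof -
      have "ennreal (cmod ?P)
          \<le> (\<integral>\<^sup>+x. ennreal (cmod ((F1 z - F1 x) * ?m x)) \<partial>lborel)"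
        by (rule integral_norm_bound_ennreal) (use icm iF1m in \<open>simp add: left_diff_distrib\<close>)
      also have "\<dots> = (\<integral>\<^sup>+x. ennreal (cmod (F1 x - F1 z)) * ennreal (mollifier j e (x - z)) \<partial>lborel)"
        by (intro nn_integral_cong) (simp add: norm_mult mollifier_nonneg ennreal_mult norm_minus_commute)
      also have "\<dots> = ?E1"
        using nn_integral_lborel_shift[of "\<lambda>x. ennreal (cmod (F1 x - F1 z)) * ennreal (mollifier j e (x - z))" z]
        by (simp add: add.commute)
      finally show ?thesis .
    qed
    finally have 1: "ennreal (cmod (F1 z)) * M e \<le> ?E1 + ennreal (cmod ?Q)"
      by simp
    have "cauchy_mass * ennreal (cmod ?Q)
        \<le> cauchy_mass * (\<integral>\<^sup>+x. ennreal (cmod (F2 x)) * riesz 1 ((x - z) $ j) * ennreal (transverse_bump j e (x - z)) \<partial>lborel)"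
      unfolding F1_def F2_def
      by (intro mult_left_mono mollified_weak_dbar[OF W K f g H r(2) zi e]) auto
    also have "\<dots> = cauchy_mass * (\<integral>\<^sup>+y. ennreal (cmod (F2 (z + y))) * riesz 1 (y $ j) * ennreal (transverse_bump j e y) \<partial>lborel)"
      using nn_integral_lborel_shift[of "\<lambda>x. ennreal (cmod (F2 x)) * riesz 1 ((x - z) $ j) * ennreal (transverse_bump j e (x - z))" z]
      by simp
    also have "\<dots> = (\<integral>\<^sup>+y. J (z + transverse j y) * ennreal (mollifier j e y) \<partial>lborel)"
      unfolding J_def by (rule line_potential_average) (use e in auto)
    also have "\<dots> \<le> (\<integral>\<^sup>+y. J z * ennreal (mollifier j e y)
        + line_variation j F2 (transverse j y) z * ennreal (mollifier j e y) \<partial>lborel)"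
      unfolding J_def distrib_right[symmetric]
      by (intro nn_integral_mono mult_right_mono line_potential_shift_le) auto
    also have "\<dots> = J z * M e + ?E2"
      using zj unfolding M_def line_variation_def
      by (subst nn_integral_add) (auto simp: nn_integral_cmult)
    finally have 2: "cauchy_mass * ennreal (cmod ?Q) \<le> J z * M e + ?E2" .
    have "?a * M e
        \<le> cauchy_mass * (?E1 + ennreal (cmod ?Q))"
      using mult_left_mono[OF 1, of cauchy_mass] by (simp add: mult.assoc)
    also have "\<dots> \<le> cauchy_mass * ?E1 + (J z * M e + ?E2)"
      unfolding distrib_left by (intro add_left_mono 2)
    finally have 3: "?a * M e \<le> J z * M e + (cauchy_mass * ?E1 + ?E2)"
      by (simp add: add_ac)
    show ?thesis
    proof (cases "J z = top")
      case True
      then have "S z = 0"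
      proof -
        have "?a < top"
          using cauchy_mass_finite by (simp add: ennreal_mult_less_top)
        then have "?a - J z = 0"
          by (rule diff_eq_0_ennreal) (simp add: \<open>J z = top\<close>)
        then show "S z = 0" by (simp only: S_def mult_zero_left)
      qed
      then show ?thesis by simp
    next
      case False
      have "S z = ?a - J z"
        using \<open>z \<in> Z\<close> by (simp add: S_def)
      then have "M e * S z = M e * (?a) - M e * J z"
        using ennreal_right_diff_distrib[of "M e" "?a" "J z"] Mfin
        by simp
      also have "\<dots> \<le> cauchy_mass * ?E1 + ?E2"
        unfolding ennreal_minus_le_iff
      proof (intro conjI impI)
        show "M e * (?a) \<le> M e * J z + (cauchy_mass * ?E1 + ?E2)"
          using 3 by (simp only: mult.commute)
        assume "M e * (?a) = top \<and> M e * J z = top"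
        then show "cauchy_mass * ?E1 + ?E2 = top"
          using False Mfin ennreal_mult_eq_top_iff[of "M e" "J z"] by simp
      qed
      finally show ?thesis .
    qed
  qed (simp add: S_def)

  have integrated: "M e * (\<integral>\<^sup>+z. S z \<partial>lborel) \<le> (\<integral>\<^sup>+y. \<omega> y * ennreal (mollifier j e y) \<partial>lborel)"
    if e: "0 < e" "e < R - r" for e
  proof -
    let ?L = "\<lambda>y z. (line_variation j F2 (transverse j y) z * indicator {z. cmod (z $ j - c $ j) \<le> R} z) * ennreal (mollifier j e y)"
    let ?D = "\<lambda>y z. ennreal (cmod (F1 (y + z) - F1 z)) * ennreal (mollifier j e y)"
    let ?A = "\<lambda>y. A * mean_modulus F2 (transverse j y) * ennreal (mollifier j e y)" and ?B = "\<lambda>y. cauchy_mass * mean_modulus F1 y * ennreal (mollifier j e y)"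
    have [measurable]: "(\<lambda>(y, z). line_variation j F2 (transverse j y) z) \<in> borel_measurable (borel \<Otimes>\<^sub>M borel)"
      unfolding line_variation_def by measurable
    have key: "(\<integral>\<^sup>+y. (\<integral>\<^sup>+z. ?L y z \<partial>lborel) \<partial>lborel)
      \<le> (\<integral>\<^sup>+y. ?A y \<partial>lborel)"
    proof (rule nn_integral_mono)
      fix y
      have "(\<integral>\<^sup>+z. ?L y z \<partial>lborel)
        = (\<integral>\<^sup>+z. line_variation j F2 (transverse j y) z * indicator {z. cmod (z $ j - c $ j) \<le> R} z \<partial>lborel) * ennreal (mollifier j e y)"
        by (rule nn_integral_multc) measurable
      also have "\<dots> \<le> ?A y"
        unfolding A_def
      proof (rule mult_right_mono[OF nn_integral_line_variation_le])
        show "F2 x = 0" if "cmod (x $ j - c $ j) > R" for x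
        proof -
          have "x \<notin> ?K" using that by (auto simp: polydisc_def not_le)
          then show ?thesis by (simp add: F2_def)
        qed
      qed (use r in \<open>auto simp: transverse_def\<close>)
      finally show "(\<integral>\<^sup>+z. ?L y z \<partial>lborel)
        \<le> ?A y" .
    qed
    have "M e * (\<integral>\<^sup>+z. S z \<partial>lborel) = (\<integral>\<^sup>+z. M e * S z \<partial>lborel)"
      by (rule nn_integral_cmult[symmetric]) measurable
    also have "\<dots> \<le> (\<integral>\<^sup>+z. cauchy_mass * (\<integral>\<^sup>+y. ?D y z \<partial>lborel)
      + (\<integral>\<^sup>+y. ?L y z \<partial>lborel) \<partial>lborel)"
      by (intro nn_integral_mono pointwise e)
    also have "\<dots> = cauchy_mass * (\<integral>\<^sup>+z. (\<integral>\<^sup>+y. ?D y z \<partial>lborel) \<partial>lborel)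
      + (\<integral>\<^sup>+z. (\<integral>\<^sup>+y. ?L y z \<partial>lborel) \<partial>lborel)"
      by (subst nn_integral_add) (auto simp: nn_integral_cmult)
    also have "(\<integral>\<^sup>+z. (\<integral>\<^sup>+y. ?D y z \<partial>lborel) \<partial>lborel)
      = (\<integral>\<^sup>+y. (\<integral>\<^sup>+z. ?D y z \<partial>lborel) \<partial>lborel)"
      by (rule lborel_pair.Fubini') measurable
    also have "(\<integral>\<^sup>+z. (\<integral>\<^sup>+y. ?L y z \<partial>lborel) \<partial>lborel)
      = (\<integral>\<^sup>+y. (\<integral>\<^sup>+z. ?L y z \<partial>lborel) \<partial>lborel)"
      by (rule lborel_pair.Fubini') measurable
    also have "cauchy_mass * (\<integral>\<^sup>+y. (\<integral>\<^sup>+z. ?D y z \<partial>lborel) \<partial>lborel)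
      = (\<integral>\<^sup>+y. ?B y \<partial>lborel)"
    proof -
      have eq: "(\<integral>\<^sup>+z. ?D y z \<partial>lborel)
          = mean_modulus F1 y * ennreal (mollifier j e y)" for y
        unfolding mean_modulus_def by (rule nn_integral_multc) measurable
      show ?thesis
        unfolding eq mult.assoc by (rule nn_integral_cmult[symmetric]) measurable
    qed
    also note add_left_mono[OF key]
    also have "(\<integral>\<^sup>+y. ?B y \<partial>lborel)
       + (\<integral>\<^sup>+y. ?A y \<partial>lborel)
       = (\<integral>\<^sup>+y. \<omega> y * ennreal (mollifier j e y) \<partial>lborel)"
      unfolding \<omega>_def distrib_right by (rule nn_integral_add[symmetric]) measurable
    finally show ?thesis .
  qed

  have scaled: "M 1 * (\<integral>\<^sup>+z. S z \<partial>lborel) \<le> (\<integral>\<^sup>+t. \<omega> (e *\<^sub>R t) * ennreal (mollifier j 1 t) \<partial>lborel)"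
    if e: "0 < e" "e < R - r" for e
  proof -
    \<comment> \<open>The Jacobian of the dilation times the scaling factor of the mollifier; it is the same on both sides and cancels.\<close>
    define q where "q = e ^ DIM(complex ^ 'n) / e\<^sup>2"
    have q: "q > 0" using e by (simp add: q_def)
    let ?I = "\<lambda>h. \<integral>\<^sup>+t. h (e *\<^sub>R t) * ennreal (mollifier j 1 t) \<partial>lborel"
    have sc: "(\<integral>\<^sup>+y. h y * ennreal (mollifier j e y) \<partial>lborel)
        = ennreal q * ?I h"
      if [measurable]: "h \<in> borel_measurable borel" for h
    proof -
      have "(\<integral>\<^sup>+y. h y * ennreal (mollifier j e y) \<partial>lborel)
          = ennreal (e ^ DIM(complex ^ 'n)) * (\<integral>\<^sup>+t. h (e *\<^sub>R t) * ennreal (mollifier j e (e *\<^sub>R t)) \<partial>lborel)"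
        using e by (subst nn_integral_lborel_scale[of _ e]) auto
      also have "(\<integral>\<^sup>+t. h (e *\<^sub>R t) * ennreal (mollifier j e (e *\<^sub>R t)) \<partial>lborel)
          = (\<integral>\<^sup>+t. ennreal (1 / e\<^sup>2) * (h (e *\<^sub>R t) * ennreal (mollifier j 1 t)) \<partial>lborel)"
      proof (rule nn_integral_cong)
        fix t
        have "ennreal (mollifier j e (e *\<^sub>R t)) = ennreal (1 / e\<^sup>2) * ennreal (mollifier j 1 t)"
          using e by (simp add: mollifier_scale ennreal_mult[symmetric] mollifier_nonneg)
        then show "h (e *\<^sub>R t) * ennreal (mollifier j e (e *\<^sub>R t)) = ennreal (1 / e\<^sup>2) * (h (e *\<^sub>R t) * ennreal (mollifier j 1 t))"
          by (simp add: mult_ac)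
      qed
      also have "\<dots> = ennreal (1 / e\<^sup>2) * ?I h"
        by (rule nn_integral_cmult) measurable
      also have "ennreal (e ^ DIM(complex ^ 'n)) * \<dots> = ennreal q * ?I h"
        using e by (simp add: q_def mult.assoc[symmetric] ennreal_mult[symmetric])
      finally show ?thesis .
    qed
    have "ennreal q * (M 1 * (\<integral>\<^sup>+z. S z \<partial>lborel)) = M e * (\<integral>\<^sup>+z. S z \<partial>lborel)"
      using sc[of "\<lambda>_. 1"] by (simp add: M_def mult.assoc)
    also have "\<dots> \<le> ennreal q * (\<integral>\<^sup>+t. \<omega> (e *\<^sub>R t) * ennreal (mollifier j 1 t) \<partial>lborel)"
      using integrated[OF e] sc[of \<omega>] by simp
    finally show ?thesis
      using q by (subst (asm) ennreal_mult_le_mult_iff) auto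
  qed

  have "(\<lambda>n. \<integral>\<^sup>+t. \<omega> ((1 / real (Suc n)) *\<^sub>R t) * ennreal (mollifier j 1 t) \<partial>lborel) \<longlonglongrightarrow> 0"
  proof (rule approximate_identity_tendsto_0)
    show "(\<integral>\<^sup>+t. ennreal (mollifier j 1 t) \<partial>lborel) < \<infinity>"
      by (rule nn_integral_mollifier_finite) simp
    let ?B = "cauchy_mass * (2 * (\<integral>\<^sup>+x. ennreal (norm (F1 x)) \<partial>lborel)) + A * (2 * (\<integral>\<^sup>+x. ennreal (norm (F2 x)) \<partial>lborel))"
    show "\<omega> h \<le> ?B" for h
      unfolding \<omega>_def by (intro add_mono mult_left_mono mean_modulus_le_norm) auto
    show "?B < \<infinity>"
      using iF1 iF2 A cauchy_mass_finite by (simp add: integrable_iff_bounded ennreal_mult_less_top)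
    fix e :: real assume e: "e > 0"
    obtain a where a: "A = ennreal a" "a \<ge> 0" using A by (cases A) auto
    obtain b where b: "cauchy_mass = ennreal b" "b \<ge> 0" using cauchy_mass_finite by (cases cauchy_mass) auto
    define e' where "e' = e / (a + b + 1)"
    have e': "e' > 0" using e a b by (simp add: e'_def)
    obtain d1 where d1: "d1 > 0" "\<And>h. norm h < d1 \<Longrightarrow> mean_modulus F1 h \<le> ennreal e'"
      using translation_continuous_in_mean[OF iF1 e'] by auto
    obtain d2 where d2: "d2 > 0" "\<And>h. norm h < d2 \<Longrightarrow> mean_modulus F2 h \<le> ennreal e'"
      using translation_continuous_in_mean[OF iF2 e'] by auto
    have "\<omega> h \<le> ennreal e" if h: "norm h < min d1 d2" for h
    proof -
      have "norm (transverse j h) < d2" using h norm_transverse_le[of j h] by simp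
      then have "\<omega> h \<le> ennreal b * ennreal e' + ennreal a * ennreal e'"
        unfolding \<omega>_def a b using h by (intro add_mono mult_left_mono d1 d2) auto
      also have "\<dots> = ennreal ((a + b) * e')"
        using a(2) b(2) e' by (simp add: ennreal_mult[symmetric] algebra_simps flip: ennreal_plus)
      also have "\<dots> \<le> ennreal e"
        using a b e by (intro ennreal_leI) (simp add: e'_def field_simps)
      finally show ?thesis .
    qed
    then show "\<exists>d>0. \<forall>h. norm h < d \<longrightarrow> \<omega> h \<le> ennreal e"
      using d1(1) d2(1) by (intro exI[of _ "min d1 d2"]) auto
  qed measurable
  moreover have "eventually (\<lambda>n. M 1 * (\<integral>\<^sup>+z. S z \<partial>lborel)
      \<le> (\<integral>\<^sup>+t. \<omega> ((1 / real (Suc n)) *\<^sub>R t) * ennreal (mollifier j 1 t) \<partial>lborel)) sequentially"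
  proof -
    have "eventually (\<lambda>n. inverse (real (Suc n)) < R - r) sequentially"
      using order_tendstoD(2)[OF LIMSEQ_inverse_real_of_nat, of "R - r"] r by simp
    then show ?thesis
      by eventually_elim (rule scaled, auto simp: inverse_eq_divide)
  qed
  ultimately have "M 1 * (\<integral>\<^sup>+z. S z \<partial>lborel) \<le> 0"
    by (intro tendsto_lowerbound[where F = sequentially]) auto
  then have "(\<integral>\<^sup>+z. S z \<partial>lborel) = 0"
    using nn_integral_mollifier_pos[of j] by (auto simp: M_def)
  then have "AE z in lborel. S z = 0"
    by (rule nn_integral_0_iff_AE[THEN iffD1, rotated]) measurable
  then show ?thesis
  proof eventually_elim
    case (elim z)
    show ?case
    proof
      assume zi: "\<forall>i. i \<noteq> j \<longrightarrow> cmod (z $ i - c $ i) < r"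
      have J: "J = line_potential j (\<lambda>x. ennreal (cmod (g x * H x + f x * dbar j H x)) * indicator ?K x)"
        unfolding J_def F2_def by (intro arg_cong[where f = "line_potential j"]) (auto simp: indicator_def)
      show "cauchy_mass * ennreal (cmod (f z * H z))
        \<le> line_potential j (\<lambda>x. ennreal (cmod (g x * H x + f x * dbar j H x)) * indicator ?K x) z"
      proof (cases "cmod (z $ j - c $ j) \<le> R")
        case True
        then have "z \<in> Z" using zi by (simp add: Z_def)
        moreover have "z \<in> ?K"
        proof -
          have "cmod (z $ i - c $ i) \<le> R" for i
          proof (cases "i = j")
            case False
            then have "cmod (z $ i - c $ i) < r" using zi by simp
            then show ?thesis using r by simp
          qed (use True in simp)
          then show ?thesis by (simp add: polydisc_def)
        qed
        ultimately show ?thesis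
          using ennreal_minus_eq_0[of "cauchy_mass * ennreal (cmod (F1 z))" "J z"] elim
          unfolding S_def J[symmetric] by (simp add: F1_def)
      next
        case False
        then have "H z = 0" using H(2) r by simp
        then show ?thesis by simp
      qed
    qed
  qed
qed

section \<open>Weighted estimates for the Cauchy transform\<close>

lemma ennreal_two_mult_le: "2 * (a * b) \<le> a\<^sup>2 + (b::ennreal)\<^sup>2"
proof (cases a; cases b)
  fix x y assume *: "a = ennreal x" "0 \<le> x" "b = ennreal y" "0 \<le> y"
  have "2 * (x * y) \<le> x\<^sup>2 + y\<^sup>2" using sum_squares_bound[of x y] by simp
  then have "ennreal (2 * (x * y)) \<le> ennreal (x\<^sup>2 + y\<^sup>2)" by (rule ennreal_leI)
  then show ?thesis using * by (simp add: ennreal_mult ennreal_power)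
qed (auto simp: power2_eq_square)

text \<open>
  Integrate \<open>2 (f x g y) (f y g x) \<le> (f x g y)\<^sup>2 + (f y g x)\<^sup>2\<close> over \<open>x\<close> and \<open>y\<close>.
\<close>

lemma nn_integral_Cauchy_Schwarz:
  assumes [measurable]: "f \<in> borel_measurable M" "g \<in> borel_measurable M"
  shows "(\<integral>\<^sup>+x. f x * g x \<partial>M)\<^sup>2 \<le> (\<integral>\<^sup>+x. (f x)\<^sup>2 \<partial>M) * (\<integral>\<^sup>+x. (g x)\<^sup>2 \<partial>M)"
proof -
  have "2 * (\<integral>\<^sup>+x. f x * g x \<partial>M)\<^sup>2 = (\<integral>\<^sup>+x. (\<integral>\<^sup>+y. 2 * ((f x * g y) * (f y * g x)) \<partial>M) \<partial>M)"
  proof -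
    have eq: "(\<integral>\<^sup>+y. 2 * ((f x * g y) * (f y * g x)) \<partial>M) = (f x * g x) * (2 * (\<integral>\<^sup>+y. f y * g y \<partial>M))" for x
    proof -
      have "(\<integral>\<^sup>+y. 2 * ((f x * g y) * (f y * g x)) \<partial>M) = (\<integral>\<^sup>+y. (2 * (f x * g x)) * (f y * g y) \<partial>M)"
        by (intro nn_integral_cong) (simp add: mult_ac)
      also have "\<dots> = (2 * (f x * g x)) * (\<integral>\<^sup>+y. f y * g y \<partial>M)"
        by (rule nn_integral_cmult) measurable
      finally show ?thesis by (simp add: mult_ac)
    qed
    have "(\<integral>\<^sup>+x. (f x * g x) * (2 * (\<integral>\<^sup>+y. f y * g y \<partial>M)) \<partial>M)
        = (\<integral>\<^sup>+y. f y * g y \<partial>M) * (2 * (\<integral>\<^sup>+y. f y * g y \<partial>M))"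
      by (rule nn_integral_multc) measurable
    then show ?thesis unfolding eq by (simp add: power2_eq_square mult_ac)
  qed
  also have "\<dots> \<le> (\<integral>\<^sup>+x. (\<integral>\<^sup>+y. (f x)\<^sup>2 * (g y)\<^sup>2 + (g x)\<^sup>2 * (f y)\<^sup>2 \<partial>M) \<partial>M)"
  proof (intro nn_integral_mono)
    fix x y
    show "2 * ((f x * g y) * (f y * g x)) \<le> (f x)\<^sup>2 * (g y)\<^sup>2 + (g x)\<^sup>2 * (f y)\<^sup>2"
      using ennreal_two_mult_le[of "f x * g y" "f y * g x"]
      by (simp add: power_mult_distrib mult.commute[of "(f y)\<^sup>2"])
  qed
  also have "\<dots> = 2 * ((\<integral>\<^sup>+x. (f x)\<^sup>2 \<partial>M) * (\<integral>\<^sup>+x. (g x)\<^sup>2 \<partial>M))"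
    by (simp add: nn_integral_add nn_integral_cmult nn_integral_multc mult_2 mult.commute)
  finally show ?thesis by (subst (asm) ennreal_mult_le_mult_iff) auto
qed

text \<open>
  A majorant of the Cauchy transform.
\<close>

definition cauchy_potential :: "(complex \<Rightarrow> ennreal) \<Rightarrow> complex \<Rightarrow> ennreal" where
  "cauchy_potential f z = (\<integral>\<^sup>+w. f w * riesz 1 (z - w) \<partial>lborel)"

lemma cauchy_potential_measurable [measurable]:
  assumes [measurable]: "f \<in> borel_measurable borel"
  shows "cauchy_potential f \<in> borel_measurable borel"
  unfolding cauchy_potential_def by measurable

lemma cauchy_potential_mono_AE:
  "AE w in lborel. f w \<le> g w \<Longrightarrow> cauchy_potential f z \<le> cauchy_potential g z"
  unfolding cauchy_potential_def
  by (intro nn_integral_mono_AE) (auto elim!: eventually_mono intro: mult_right_mono)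

lemma cauchy_potential_add:
  assumes [measurable]: "f \<in> borel_measurable borel" "g \<in> borel_measurable borel"
  shows "cauchy_potential (\<lambda>w. f w + g w) z = cauchy_potential f z + cauchy_potential g z"
  unfolding cauchy_potential_def distrib_right by (rule nn_integral_add) measurable

lemma cauchy_potential_cmult:
  assumes [measurable]: "f \<in> borel_measurable borel"
  shows "cauchy_potential (\<lambda>w. c * f w) z = c * cauchy_potential f z"
  unfolding cauchy_potential_def mult.assoc by (rule nn_integral_cmult) measurable

lemma cauchy_potential_mult_sq_le:
  assumes [measurable]: "f \<in> borel_measurable borel" "g \<in> borel_measurable borel"
  shows "(cauchy_potential (\<lambda>w. f w * g w) z)\<^sup>2
    \<le> cauchy_potential (\<lambda>w. (f w)\<^sup>2) z * cauchy_potential (\<lambda>w. (g w)\<^sup>2) z"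
proof -
  let ?M = "density lborel (\<lambda>w. riesz 1 (z - w))"
  show ?thesis
    using nn_integral_Cauchy_Schwarz[of f ?M g]
    unfolding cauchy_potential_def by (simp add: nn_integral_density mult_ac)
qed

text \<open>
  The Riesz potential of \<open>W\<^sup>2\<close>. If \<open>W\<^sup>2\<close> were a unit mass at the origin, this weight would be
  \<open>\<bar>x\<bar>\<^sup>-\<^sup>1\<^sup>/\<^sup>2\<close>, and then \<open>riesz_convolution_bound\<close> says that multiplication by the potential \<open>1 / \<bar>x\<bar>\<close> of
  \<open>W\<^sup>2\<close>, followed by the Cauchy potential, maps the weight to a multiple of itself.
\<close>

definition potential_weight :: "(complex \<Rightarrow> ennreal) \<Rightarrow> complex \<Rightarrow> ennreal" where
  "potential_weight W x = (\<integral>\<^sup>+a. (W a)\<^sup>2 * riesz (1/2) (x - a) \<partial>lborel)"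

lemma potential_weight_measurable [measurable]:
  assumes [measurable]: "W \<in> borel_measurable borel"
  shows "potential_weight W \<in> borel_measurable borel"
  unfolding potential_weight_def by measurable

lemma potential_weight_mono:
  assumes "\<And>z. W z \<le> W' z" shows "potential_weight W z \<le> potential_weight W' z"
  unfolding potential_weight_def
  by (intro nn_integral_mono mult_right_mono power_mono assms) auto

lemma nn_integral_swap:
  fixes F :: "complex \<Rightarrow> complex \<Rightarrow> ennreal"
  assumes [measurable]: "(\<lambda>(x, y). F x y) \<in> borel_measurable (borel \<Otimes>\<^sub>M borel)"
  shows "(\<integral>\<^sup>+x. (\<integral>\<^sup>+y. F x y \<partial>lborel) \<partial>lborel) = (\<integral>\<^sup>+y. (\<integral>\<^sup>+x. F x y \<partial>lborel) \<partial>lborel)"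
  by (rule lborel_pair.Fubini') measurable

text \<open>
  The left side is a double integral over the sources of the two potentials, which \<open>riesz_mult_le\<close>
  decouples.
\<close>

lemma cauchy_potential_mult_weight_le:
  assumes [measurable]: "G \<in> borel_measurable borel" "W \<in> borel_measurable borel"
  shows "cauchy_potential (\<lambda>w. (G w)\<^sup>2) z * potential_weight W z
    \<le> (\<integral>\<^sup>+w. (W w)\<^sup>2 \<partial>lborel) * (\<integral>\<^sup>+w. (G w)\<^sup>2 * riesz (3/2) (z - w) \<partial>lborel)
      + (\<integral>\<^sup>+w. (G w)\<^sup>2 \<partial>lborel) * (\<integral>\<^sup>+a. (W a)\<^sup>2 * riesz (3/2) (z - a) \<partial>lborel)"
    (is "_ \<le> ?MW * ?hG + ?MG * ?hW")
proof -
  have "cauchy_potential (\<lambda>w. (G w)\<^sup>2) z * potential_weight W z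
     = (\<integral>\<^sup>+b. (\<integral>\<^sup>+a. ((G b)\<^sup>2 * riesz 1 (z - b)) * ((W a)\<^sup>2 * riesz (1/2) (z - a)) \<partial>lborel) \<partial>lborel)"
    unfolding cauchy_potential_def potential_weight_def
    by (simp add: nn_integral_cmult nn_integral_multc)
  also have "\<dots> \<le> (\<integral>\<^sup>+b. (\<integral>\<^sup>+a. ((W a)\<^sup>2 * ((G b)\<^sup>2 * riesz (3/2) (z - b)) + (G b)\<^sup>2 * ((W a)\<^sup>2 * riesz (3/2) (z - a))) \<partial>lborel) \<partial>lborel)"
  proof (intro nn_integral_mono)
    fix a b
    have "((G b)\<^sup>2 * (W a)\<^sup>2) * (riesz 1 (z - b) * riesz (1/2) (z - a))
      \<le> ((G b)\<^sup>2 * (W a)\<^sup>2) * (riesz (3/2) (z - b) + riesz (3/2) (z - a))"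
      using riesz_mult_le[of 1 "1/2" "z - b" "z - a"] by (intro mult_left_mono) auto
    then show "((G b)\<^sup>2 * riesz 1 (z - b)) * ((W a)\<^sup>2 * riesz (1/2) (z - a))
      \<le> (W a)\<^sup>2 * ((G b)\<^sup>2 * riesz (3/2) (z - b)) + (G b)\<^sup>2 * ((W a)\<^sup>2 * riesz (3/2) (z - a))"
      by (simp add: distrib_left mult_ac)
  qed
  also have "\<dots> = (\<integral>\<^sup>+b. ?MW * ((G b)\<^sup>2 * riesz (3/2) (z - b)) + (G b)\<^sup>2 * ?hW \<partial>lborel)"
    by (intro nn_integral_cong, subst nn_integral_add) (auto simp: nn_integral_cmult nn_integral_multc)
  also have "\<dots> = ?MW * ?hG + ?MG * ?hW"
    by (subst nn_integral_add) (auto simp: nn_integral_cmult nn_integral_multc)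
  finally show ?thesis .
qed

text \<open>
  The Cauchy-Schwarz inequality bounds the square of the potential of \<open>W f\<close> by the potential of \<open>W\<^sup>2\<close>
  times the potential of \<open>f\<^sup>2\<close>. The first one times the weight is at most \<open>2 M h\<close>, where \<open>M\<close> is the
  integral of \<open>W\<^sup>2\<close> and \<open>h\<close> is its potential with the kernel \<open>riesz (3/2)\<close>. Moving the Cauchy kernel from \<open>f\<^sup>2\<close>
  to \<open>h\<close> and applying \<open>riesz_convolution_bound\<close> recovers the weight.
\<close>

theorem cauchy_transform_weighted_bound:
  obtains C where "C > 0"
    "\<And>W f. W \<in> borel_measurable borel \<Longrightarrow> f \<in> borel_measurable borel \<Longrightarrow>
      (\<integral>\<^sup>+z. (cauchy_potential (\<lambda>w. W w * f w) z)\<^sup>2 * potential_weight W z \<partial>lborel)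
      \<le> ennreal C * (\<integral>\<^sup>+w. (W w)\<^sup>2 \<partial>lborel) * (\<integral>\<^sup>+z. (f z)\<^sup>2 * potential_weight W z \<partial>lborel)"
proof -
  obtain C where C: "C \<ge> 0" "\<And>x. x \<noteq> 0 \<Longrightarrow>
       (\<integral>\<^sup>+z. riesz 1 (x - z) * riesz (3/2) z \<partial>lborel) \<le> ennreal C * riesz (1/2) x"
    by (rule riesz_convolution_bound) blast
  show thesis
  proof (rule that[of "2 * C + 1"])
    show "2 * C + 1 > 0" using C(1) by simp
    fix W f :: "complex \<Rightarrow> ennreal"
    assume [measurable]: "W \<in> borel_measurable borel" "f \<in> borel_measurable borel"
    define M where "M = (\<integral>\<^sup>+w. (W w)\<^sup>2 \<partial>lborel)"
    define h where "h = (\<lambda>z. \<integral>\<^sup>+a. (W a)\<^sup>2 * riesz (3/2) (z - a) \<partial>lborel)"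
    have [measurable]: "h \<in> borel_measurable borel" unfolding h_def by measurable
    have 1: "cauchy_potential (\<lambda>w. (W w)\<^sup>2) z * potential_weight W z \<le> 2 * M * h z" for z
      using cauchy_potential_mult_weight_le[of W W z] by (simp add: M_def h_def mult_2 distrib_right)
    have 2: "(\<integral>\<^sup>+z. h z * riesz 1 (z - w) \<partial>lborel) \<le> ennreal C * potential_weight W w" for w
    proof -
      have "(\<integral>\<^sup>+z. h z * riesz 1 (z - w) \<partial>lborel)
          = (\<integral>\<^sup>+z. (\<integral>\<^sup>+a. (W a)\<^sup>2 * riesz (3/2) (z - a) * riesz 1 (z - w) \<partial>lborel) \<partial>lborel)"
        unfolding h_def by (simp add: nn_integral_multc)
      also have "\<dots> = (\<integral>\<^sup>+a. (\<integral>\<^sup>+z. (W a)\<^sup>2 * riesz (3/2) (z - a) * riesz 1 (z - w) \<partial>lborel) \<partial>lborel)"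
        by (rule nn_integral_swap) measurable
      also have "\<dots> \<le> (\<integral>\<^sup>+a. ennreal C * ((W a)\<^sup>2 * riesz (1/2) (w - a)) \<partial>lborel)"
      proof (rule nn_integral_mono_AE)
        have "AE a in lborel. a \<noteq> w" by (rule AE_lborel_singleton)
        then show "AE a in lborel. (\<integral>\<^sup>+z. (W a)\<^sup>2 * riesz (3/2) (z - a) * riesz 1 (z - w) \<partial>lborel)
            \<le> ennreal C * ((W a)\<^sup>2 * riesz (1/2) (w - a))"
        proof eventually_elim
          case (elim a)
          have "(\<integral>\<^sup>+z. riesz (3/2) (z - a) * riesz 1 (z - w) \<partial>lborel)
              = (\<integral>\<^sup>+z. riesz 1 ((w - a) - z) * riesz (3/2) z \<partial>lborel)"
            using nn_integral_lborel_shift[of "\<lambda>z. riesz (3/2) (z - a) * riesz 1 (z - w)" a]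
            by (simp add: riesz_minus_commute[of 1 _ "w"] mult.commute algebra_simps)
          also have "\<dots> \<le> ennreal C * riesz (1/2) (w - a)" using elim by (intro C(2)) auto
          finally have "(W a)\<^sup>2 * (\<integral>\<^sup>+z. riesz (3/2) (z - a) * riesz 1 (z - w) \<partial>lborel)
            \<le> (W a)\<^sup>2 * (ennreal C * riesz (1/2) (w - a))" by (rule mult_left_mono) simp
          then show ?case
            by (simp add: nn_integral_cmult mult.assoc mult.left_commute)
        qed
      qed
      also have "\<dots> = ennreal C * potential_weight W w"
        unfolding potential_weight_def by (rule nn_integral_cmult) measurable
      finally show ?thesis .
    qed
    have "(\<integral>\<^sup>+z. (cauchy_potential (\<lambda>w. W w * f w) z)\<^sup>2 * potential_weight W z \<partial>lborel)
      \<le> (\<integral>\<^sup>+z. (\<integral>\<^sup>+w. 2 * M * ((f w)\<^sup>2 * (h z * riesz 1 (z - w))) \<partial>lborel) \<partial>lborel)"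
    proof (rule nn_integral_mono)
      fix z
      have "(cauchy_potential (\<lambda>w. W w * f w) z)\<^sup>2 * potential_weight W z
        \<le> (cauchy_potential (\<lambda>w. (W w)\<^sup>2) z * cauchy_potential (\<lambda>w. (f w)\<^sup>2) z) * potential_weight W z"
        by (intro mult_right_mono cauchy_potential_mult_sq_le) auto
      also have "\<dots> = (cauchy_potential (\<lambda>w. (W w)\<^sup>2) z * potential_weight W z) * cauchy_potential (\<lambda>w. (f w)\<^sup>2) z"
        by (simp add: mult_ac)
      also have "\<dots> \<le> (2 * M * h z) * cauchy_potential (\<lambda>w. (f w)\<^sup>2) z"
        by (intro mult_right_mono 1) auto
      also have "\<dots> = (\<integral>\<^sup>+w. 2 * M * h z * ((f w)\<^sup>2 * riesz 1 (z - w)) \<partial>lborel)"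
        unfolding cauchy_potential_def by (rule nn_integral_cmult[symmetric]) measurable
      finally show "(cauchy_potential (\<lambda>w. W w * f w) z)\<^sup>2 * potential_weight W z
        \<le> (\<integral>\<^sup>+w. 2 * M * ((f w)\<^sup>2 * (h z * riesz 1 (z - w))) \<partial>lborel)"
        by (simp add: mult_ac)
    qed
    also have "\<dots> = (\<integral>\<^sup>+w. (\<integral>\<^sup>+z. 2 * M * ((f w)\<^sup>2 * (h z * riesz 1 (z - w))) \<partial>lborel) \<partial>lborel)"
      by (rule nn_integral_swap) measurable
    also have "\<dots> \<le> (\<integral>\<^sup>+w. 2 * M * ((f w)\<^sup>2 * (ennreal C * potential_weight W w)) \<partial>lborel)"
    proof (rule nn_integral_mono)
      fix w
      have "(\<integral>\<^sup>+z. 2 * M * ((f w)\<^sup>2 * (h z * riesz 1 (z - w))) \<partial>lborel)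
          = 2 * M * ((f w)\<^sup>2 * (\<integral>\<^sup>+z. h z * riesz 1 (z - w) \<partial>lborel))"
        by (simp add: nn_integral_cmult)
      also have "\<dots> \<le> 2 * M * ((f w)\<^sup>2 * (ennreal C * potential_weight W w))"
        by (intro mult_left_mono 2) auto
      finally show "(\<integral>\<^sup>+z. 2 * M * ((f w)\<^sup>2 * (h z * riesz 1 (z - w))) \<partial>lborel)
        \<le> 2 * M * ((f w)\<^sup>2 * (ennreal C * potential_weight W w))" .
    qed
    also have "\<dots> = ennreal (2 * C) * M * (\<integral>\<^sup>+z. (f z)\<^sup>2 * potential_weight W z \<partial>lborel)"
    proof -
      have "2 * M * ((f w)\<^sup>2 * (ennreal C * potential_weight W w))
          = (ennreal (2 * C) * M) * ((f w)\<^sup>2 * potential_weight W w)" for w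
        using C(1) by (simp add: ennreal_mult mult_ac)
      then show ?thesis by (simp only:) (rule nn_integral_cmult, measurable)
    qed
    also have "\<dots> \<le> ennreal (2 * C + 1) * M * (\<integral>\<^sup>+z. (f z)\<^sup>2 * potential_weight W z \<partial>lborel)"
      by (intro mult_right_mono ennreal_leI) auto
    finally show "(\<integral>\<^sup>+z. (cauchy_potential (\<lambda>w. W w * f w) z)\<^sup>2 * potential_weight W z \<partial>lborel)
      \<le> ennreal (2 * C + 1) * (\<integral>\<^sup>+w. (W w)\<^sup>2 \<partial>lborel) * (\<integral>\<^sup>+z. (f z)\<^sup>2 * potential_weight W z \<partial>lborel)"
      by (simp add: M_def)
  qed
qed

text \<open>
  The a priori bound that makes absorption legitimate. On a disc the potential of \<open>G\<close> is squared by
  the Cauchy-Schwarz inequality, \<open>riesz_mult_le\<close> decouples the sources, and the remaining kernel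
  \<open>riesz (3/2)\<close> is integrable over discs.
\<close>

lemma potential_sq_weight_finite:
  assumes [measurable]: "G \<in> borel_measurable borel" "W \<in> borel_measurable borel"
    and G: "(\<integral>\<^sup>+z. (G z)\<^sup>2 \<partial>lborel) < \<infinity>" "\<And>z. z \<notin> ball 0 R \<Longrightarrow> G z = 0"
    and W: "(\<integral>\<^sup>+z. (W z)\<^sup>2 \<partial>lborel) < \<infinity>" "\<And>z. z \<notin> ball 0 R \<Longrightarrow> W z = 0"
    and R: "R > 0"
  shows "(\<integral>\<^sup>+z. (cauchy_potential G z)\<^sup>2 * potential_weight W z * indicator (ball 0 R) z \<partial>lborel) < \<infinity>"
proof -
  let ?B = "indicator (ball 0 R) :: complex \<Rightarrow> ennreal"
  define A where "A = (\<lambda>b. \<integral>\<^sup>+w. riesz b w * indicator (ball 0 (2 * R)) w \<partial>lborel)"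
  have Afin: "A b < \<infinity>" if "0 \<le> b" "b < 2" for b
  proof -
    obtain C where "\<And>r. r > 0 \<Longrightarrow>
        (\<integral>\<^sup>+z. riesz b z * indicator (ball 0 r) z \<partial>lborel) = ennreal (C * r powr (2 - b))"
      using nn_integral_riesz_ball[of b] \<open>0 \<le> b\<close> \<open>b < 2\<close> by auto
    from this[of "2 * R"] show ?thesis using R by (simp add: A_def)
  qed
  have A: "(\<integral>\<^sup>+z. ?B z * riesz b (z - w) \<partial>lborel) \<le> A b" if w: "w \<in> ball 0 R" for w b
  proof -
    have "(\<integral>\<^sup>+z. ?B z * riesz b (z - w) \<partial>lborel) = (\<integral>\<^sup>+z. ?B (w + z) * riesz b z \<partial>lborel)"
      using nn_integral_lborel_shift[of "\<lambda>z. ?B z * riesz b (z - w)" w] by simp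
    also have "\<dots> \<le> A b"
      unfolding A_def
    proof (rule nn_integral_mono)
      fix z
      have "w + z \<in> ball 0 R \<Longrightarrow> z \<in> ball 0 (2 * R)"
        using w norm_triangle_ineq4[of "w + z" w] by simp
      then show "?B (w + z) * riesz b z \<le> riesz b z * indicator (ball 0 (2 * R)) z"
        by (auto simp: indicator_def)
    qed
    finally show ?thesis .
  qed
  define MG where "MG = (\<integral>\<^sup>+z. (G z)\<^sup>2 \<partial>lborel)"
  define MW where "MW = (\<integral>\<^sup>+z. (W z)\<^sup>2 \<partial>lborel)"
  have sq: "(cauchy_potential G z)\<^sup>2 * ?B z \<le> A 1 * (cauchy_potential (\<lambda>w. (G w)\<^sup>2) z * ?B z)" for z
  proof (cases "z \<in> ball 0 R")
    case True
    have "G w * ?B w = G w" for w using G(2)[of w] by (auto simp: indicator_def)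
    then have "(cauchy_potential G z)\<^sup>2 \<le> cauchy_potential (\<lambda>w. (G w)\<^sup>2) z * cauchy_potential (\<lambda>w. (?B w)\<^sup>2) z"
      using cauchy_potential_mult_sq_le[of G ?B z] by simp
    also have "cauchy_potential (\<lambda>w. (?B w)\<^sup>2) z = (\<integral>\<^sup>+w. ?B w * riesz 1 (w - z) \<partial>lborel)"
      unfolding cauchy_potential_def riesz_minus_commute[of 1 z]
      by (intro nn_integral_cong) (simp add: indicator_def)
    also have "cauchy_potential (\<lambda>w. (G w)\<^sup>2) z * \<dots> \<le> cauchy_potential (\<lambda>w. (G w)\<^sup>2) z * A 1"
      by (intro mult_left_mono A True) auto
    finally show ?thesis using True by (simp add: mult.commute)
  qed simp
  have swap: "(\<integral>\<^sup>+z. ?B z * (\<integral>\<^sup>+w. (F w)\<^sup>2 * riesz b (z - w) \<partial>lborel) \<partial>lborel) \<le> A b * (\<integral>\<^sup>+z. (F z)\<^sup>2 \<partial>lborel)"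
    if [measurable]: "F \<in> borel_measurable borel" and F: "\<And>z. z \<notin> ball 0 R \<Longrightarrow> F z = 0" for F b
  proof -
    have "(\<integral>\<^sup>+z. ?B z * (\<integral>\<^sup>+w. (F w)\<^sup>2 * riesz b (z - w) \<partial>lborel) \<partial>lborel)
        = (\<integral>\<^sup>+z. (\<integral>\<^sup>+w. (F w)\<^sup>2 * (?B z * riesz b (z - w)) \<partial>lborel) \<partial>lborel)"
      by (intro nn_integral_cong) (subst nn_integral_cmult[symmetric], auto simp: mult_ac)
    also have "\<dots> = (\<integral>\<^sup>+w. (\<integral>\<^sup>+z. (F w)\<^sup>2 * (?B z * riesz b (z - w)) \<partial>lborel) \<partial>lborel)"
      by (rule nn_integral_swap) measurable
    also have "\<dots> \<le> (\<integral>\<^sup>+w. A b * (F w)\<^sup>2 \<partial>lborel)"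
    proof (rule nn_integral_mono)
      fix w
      have "(\<integral>\<^sup>+z. (F w)\<^sup>2 * (?B z * riesz b (z - w)) \<partial>lborel) = (F w)\<^sup>2 * (\<integral>\<^sup>+z. ?B z * riesz b (z - w) \<partial>lborel)"
        by (rule nn_integral_cmult) measurable
      also have "\<dots> \<le> (F w)\<^sup>2 * A b"
        using F[of w] by (cases "w \<in> ball 0 R") (auto intro!: mult_left_mono A)
      finally show "(\<integral>\<^sup>+z. (F w)\<^sup>2 * (?B z * riesz b (z - w)) \<partial>lborel) \<le> A b * (F w)\<^sup>2"
        by (simp add: mult.commute)
    qed
    also have "\<dots> = A b * (\<integral>\<^sup>+z. (F z)\<^sup>2 \<partial>lborel)" by (rule nn_integral_cmult) measurable
    finally show ?thesis .
  qed
  have prod: "cauchy_potential (\<lambda>w. (G w)\<^sup>2) z * potential_weight W z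
      \<le> MW * (\<integral>\<^sup>+w. (G w)\<^sup>2 * riesz (3/2) (z - w) \<partial>lborel) + MG * (\<integral>\<^sup>+a. (W a)\<^sup>2 * riesz (3/2) (z - a) \<partial>lborel)" for z
    unfolding MW_def MG_def by (rule cauchy_potential_mult_weight_le) measurable
  have "(\<integral>\<^sup>+z. (cauchy_potential G z)\<^sup>2 * potential_weight W z * ?B z \<partial>lborel)
     \<le> (\<integral>\<^sup>+z. A 1 * MW * (?B z * (\<integral>\<^sup>+w. (G w)\<^sup>2 * riesz (3/2) (z - w) \<partial>lborel))
       + A 1 * MG * (?B z * (\<integral>\<^sup>+a. (W a)\<^sup>2 * riesz (3/2) (z - a) \<partial>lborel)) \<partial>lborel)"
  proof (rule nn_integral_mono)
    fix z
    have "(cauchy_potential G z)\<^sup>2 * potential_weight W z * ?B z = ((cauchy_potential G z)\<^sup>2 * ?B z) * potential_weight W z"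
      by (simp add: mult_ac)
    also have "\<dots> \<le> (A 1 * (cauchy_potential (\<lambda>w. (G w)\<^sup>2) z * ?B z)) * potential_weight W z"
      by (intro mult_right_mono sq) auto
    also have "\<dots> = A 1 * ?B z * (cauchy_potential (\<lambda>w. (G w)\<^sup>2) z * potential_weight W z)"
      by (simp add: mult_ac)
    also have "\<dots> \<le> A 1 * ?B z * (MW * (\<integral>\<^sup>+w. (G w)\<^sup>2 * riesz (3/2) (z - w) \<partial>lborel) + MG * (\<integral>\<^sup>+a. (W a)\<^sup>2 * riesz (3/2) (z - a) \<partial>lborel))"
      by (intro mult_left_mono prod) auto
    finally show "(cauchy_potential G z)\<^sup>2 * potential_weight W z * ?B z
     \<le> A 1 * MW * (?B z * (\<integral>\<^sup>+w. (G w)\<^sup>2 * riesz (3/2) (z - w) \<partial>lborel))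
       + A 1 * MG * (?B z * (\<integral>\<^sup>+a. (W a)\<^sup>2 * riesz (3/2) (z - a) \<partial>lborel))"
      by (simp add: distrib_left mult_ac)
  qed
  also have "\<dots> = A 1 * MW * (\<integral>\<^sup>+z. ?B z * (\<integral>\<^sup>+w. (G w)\<^sup>2 * riesz (3/2) (z - w) \<partial>lborel) \<partial>lborel)
      + A 1 * MG * (\<integral>\<^sup>+z. ?B z * (\<integral>\<^sup>+a. (W a)\<^sup>2 * riesz (3/2) (z - a) \<partial>lborel) \<partial>lborel)"
    by (subst nn_integral_add) (auto simp: nn_integral_cmult)
  also have "\<dots> \<le> A 1 * MW * (A (3/2) * MG) + A 1 * MG * (A (3/2) * MW)"
    unfolding MG_def MW_def by (intro add_mono mult_left_mono swap G W) auto
  also have "\<dots> < \<infinity>"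
    using G(1) W(1) Afin[of 1] Afin[of "3/2"] by (simp add: MG_def MW_def ennreal_mult_less_top)
  finally show ?thesis .
qed

section \<open>Unique continuation in the plane\<close>

lemma ennreal_add_sq_le: "(a + b)\<^sup>2 \<le> 2 * a\<^sup>2 + 2 * (b::ennreal)\<^sup>2"
proof -
  have "(a + b)\<^sup>2 = (a\<^sup>2 + b\<^sup>2) + 2 * (a * b)"
    unfolding power2_eq_square mult_2 distrib_left distrib_right by (simp add: ac_simps)
  also have "\<dots> \<le> (a\<^sup>2 + b\<^sup>2) + (a\<^sup>2 + b\<^sup>2)"
    by (intro add_left_mono ennreal_two_mult_le)
  also have "\<dots> = 2 * a\<^sup>2 + 2 * b\<^sup>2"
    unfolding mult_2 by (simp add: ac_simps)
  finally show ?thesis .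
qed

lemma ennreal_absorb_half:
  assumes le: "X \<le> 2 * (ennreal (1/4) * X) + y" and fin: "X < \<infinity>"
  shows "X \<le> 2 * (y :: ennreal)"
proof (cases y)
  case (real b)
  obtain x where x: "X = ennreal x" "x \<ge> 0" using fin by (cases X) auto
  have two: "2 * ennreal c = ennreal (2 * c)" if "c \<ge> 0" for c
    using that by (subst ennreal_mult) auto
  have "ennreal (1/4) * X = ennreal (1/4 * x)"
    unfolding x(1) using x(2) by (subst ennreal_mult) auto
  then have "ennreal x \<le> ennreal (2 * (1/4 * x)) + ennreal b"
    using le two[of "1/4 * x"] x real(2) by simp
  also have "\<dots> = ennreal (2 * (1/4 * x) + b)"
    using x(2) real(1) by (subst ennreal_plus) auto
  finally have "x \<le> 2 * (1/4 * x) + b"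
    using x(2) real(1) by (subst (asm) ennreal_le_iff) auto
  then have "ennreal x \<le> ennreal (2 * b)" by (intro ennreal_leI) simp
  then show ?thesis unfolding x(1) real(2) two[OF real(1)] .
qed (simp add: ennreal_mult_top)

lemma potential_weight_pos:
  assumes [measurable]: "W \<in> borel_measurable borel" and "a < r" "0 \<le> a"
    and W: "\<And>z. z \<in> ball 0 r - ball 0 a \<Longrightarrow> W z \<noteq> 0"
  shows "potential_weight W z > 0"
proof (rule ccontr)
  assume "\<not> ?thesis"
  then have "(\<integral>\<^sup>+b. (W b)\<^sup>2 * riesz (1/2) (z - b) \<partial>lborel) = 0"
    by (simp add: potential_weight_def)
  then have "AE b in lborel. (W b)\<^sup>2 * riesz (1/2) (z - b) = 0"
    by (rule nn_integral_0_iff_AE[THEN iffD1, rotated]) measurable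
  moreover have "AE b in lborel. b \<noteq> z" by (rule AE_lborel_singleton)
  ultimately have "AE b::complex in lborel. b \<notin> ball (of_real ((a + r) / 2)) ((r - a) / 2)"
  proof eventually_elim
    case (elim b)
    then have "W b = 0" by (auto simp: riesz_def)
    then have "b \<notin> ball 0 r - ball 0 a" using W by blast
    moreover have "ball (of_real ((a + r) / 2)) ((r - a) / 2) \<subseteq> ball 0 r - ball (0::complex) a"
    proof
      fix x :: complex assume "x \<in> ball (of_real ((a + r) / 2)) ((r - a) / 2)"
      then have d: "norm (of_real ((a + r) / 2) - x) < (r - a) / 2" by (simp add: dist_norm)
      have n: "norm (of_real ((a + r) / 2) :: complex) = (a + r) / 2" using assms by (simp only: norm_of_real) simp
      show "x \<in> ball 0 r - ball 0 a"
        using d n norm_triangle_ineq2[of "of_real ((a + r) / 2)" x] norm_triangle_ineq2[of x "of_real ((a + r) / 2)"]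
        by (simp add: norm_minus_commute field_simps)
    qed
    ultimately show ?case by blast
  qed
  then have "emeasure lborel (ball (of_real ((a + r) / 2) :: complex) ((r - a) / 2)) = 0"
    by (subst (asm) AE_iff_measurable[where N = "ball (of_real ((a + r) / 2)) ((r - a) / 2)"]) auto
  then show False
    using content_ball_gt_0_iff[of "of_real ((a + r) / 2) :: complex" "(r - a) / 2"] assms(2)
    by (simp add: measure_def)
qed

text \<open>
  A majorant of d-bar of the product of \<open>w\<^sup>-\<^sup>m\<close>, \<open>u\<close> and a cutoff that equals 1 for \<open>\<bar>w\<bar> < r\<close> and 0 for
  \<open>\<bar>w\<bar> \<ge> s\<close>, where \<open>U = \<bar>u\<bar>\<close>, d-bar of \<open>u\<close> is at most \<open>V U\<close>, and \<open>C\<close> bounds d-bar of the cutoff.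
\<close>

definition carleman_source ::
    "(complex \<Rightarrow> ennreal) \<Rightarrow> (complex \<Rightarrow> ennreal) \<Rightarrow> ennreal \<Rightarrow> real \<Rightarrow> real \<Rightarrow> nat \<Rightarrow> complex \<Rightarrow> ennreal" where
  "carleman_source U V C r s m w = ennreal ((1 / cmod w) ^ m) * (V w * U w * indicator (ball 0 r) w)
     + ennreal ((1 / r) ^ m) * ((V w + C) * U w * indicator (ball 0 s - ball 0 r) w)"

text \<open>
  Let \<open>f\<close> be \<open>\<bar>z\<bar>\<^sup>-\<^sup>m U\<close> on the disc of radius \<open>r\<close>. The hypothesis \<open>D\<close> bounds \<open>f\<close> by the potential of \<open>W f\<close>,
  where \<open>W\<close> is \<open>V\<close> on the annulus, plus \<open>r\<^sup>-\<^sup>m\<close> times a fixed potential. In the norm of \<open>L\<^sup>2(\<omega>)\<close>, with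
  the weight of \<open>W\<close>, the first term is at most half of \<open>f\<close> and is absorbed, as everything is finite
  by \<open>UG\<close>. What remains is \<open>\<integral> (r / \<bar>z\<bar>)\<^sup>2\<^sup>m U\<^sup>2 \<omega> \<le> 4 Y\<close> for all \<open>m\<close>, where \<open>Y\<close> is the squared norm of the
  fixed potential. This is impossible on \<open>\<bar>z\<bar> < t < r\<close> unless
  \<open>U\<close> vanishes there. The condition \<open>1 \<le> V\<close> makes \<open>\<omega>\<close> positive.
\<close>

lemma annulus_step:
  fixes U V G :: "complex \<Rightarrow> ennreal"
  assumes bound: "\<And>W f. W \<in> borel_measurable borel \<Longrightarrow> f \<in> borel_measurable borel \<Longrightarrow>
      (\<integral>\<^sup>+z. (cauchy_potential (\<lambda>w. W w * f w) z)\<^sup>2 * potential_weight W z \<partial>lborel)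
      \<le> ennreal C0 * (\<integral>\<^sup>+w. (W w)\<^sup>2 \<partial>lborel) * (\<integral>\<^sup>+z. (f z)\<^sup>2 * potential_weight W z \<partial>lborel)"
    and [measurable]: "U \<in> borel_measurable borel" "V \<in> borel_measurable borel" "G \<in> borel_measurable borel"
    and V1: "\<And>z. 1 \<le> V z" and r: "0 < a" "a < r" "r < s" "s < R"
    and VR: "(\<integral>\<^sup>+z. (V z)\<^sup>2 * indicator (ball 0 R) z \<partial>lborel) < \<infinity>"
    and G: "(\<integral>\<^sup>+z. (G z)\<^sup>2 \<partial>lborel) < \<infinity>" "\<And>z. z \<notin> ball 0 R \<Longrightarrow> G z = 0"
    and UG: "AE z in lborel. z \<in> ball 0 s \<longrightarrow> U z \<le> cauchy_potential G z"
    and U0: "AE z in lborel. z \<in> ball 0 a \<longrightarrow> U z = 0"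
    and small: "ennreal C0 * (\<integral>\<^sup>+z. (V z)\<^sup>2 * indicator (ball 0 r - ball 0 a) z \<partial>lborel) \<le> ennreal (1/4)"
    and C: "C < \<infinity>"
    and D: "\<And>m. AE z in lborel. z \<in> ball 0 r \<longrightarrow> ennreal ((1 / cmod z) ^ m) * U z
       \<le> cauchy_potential (carleman_source U V C r s m) z"
    and t: "0 < t" "t < r"
  shows "AE z in lborel. z \<in> ball 0 t \<longrightarrow> U z = 0"
proof -
  define W where "W = (\<lambda>z. V z * indicator (ball 0 r - ball 0 a) z)"
  \<comment> \<open>\<open>V'\<close> dominates both \<open>W\<close> and the factor of \<open>U\<close> in \<open>B\<close>, so its weight serves for the finiteness of all the terms.\<close>
  define V' where "V' = (\<lambda>z. (V z + C) * indicator (ball 0 s) z)"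
  define Us where "Us = (\<lambda>z. U z * indicator (ball 0 s) z)"
  define B where "B = (\<lambda>z. (V z + C) * U z * indicator (ball 0 s - ball 0 r) z)"
  define \<omega> where "\<omega> = potential_weight W"
  have [measurable]: "W \<in> borel_measurable borel" "V' \<in> borel_measurable borel"
    "Us \<in> borel_measurable borel" "B \<in> borel_measurable borel"
    unfolding W_def V'_def Us_def B_def by measurable
  have [measurable]: "\<omega> \<in> borel_measurable borel" unfolding \<omega>_def by measurable
  have \<omega>_le: "\<omega> z \<le> potential_weight V' z" for z
    unfolding \<omega>_def
    by (rule potential_weight_mono) (use r in \<open>auto simp: W_def V'_def indicator_def\<close>)
  have \<omega>_pos: "\<omega> z > 0" for z
    unfolding \<omega>_def
  proof (rule potential_weight_pos[where a = a and r = r])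
    show "W z \<noteq> 0" if "z \<in> ball 0 r - ball 0 a" for z
      using V1[of z] that by (auto simp: W_def)
  qed (use r in auto)
  have V'fin: "(\<integral>\<^sup>+z. (V' z)\<^sup>2 \<partial>lborel) < \<infinity>"
  proof -
    have "(V' z)\<^sup>2 \<le> (1 + C)\<^sup>2 * ((V z)\<^sup>2 * indicator (ball 0 R) z)" for z
    proof -
      have "V z + C \<le> (1 + C) * V z"
        using add_left_mono[OF mult_left_mono[OF V1[of z], of C], of "V z"] by (simp add: distrib_right)
      then have "V' z \<le> (1 + C) * V z * indicator (ball 0 R) z"
        using r by (auto simp: V'_def indicator_def)
      then have "(V' z)\<^sup>2 \<le> ((1 + C) * V z * indicator (ball 0 R) z)\<^sup>2" by (intro power_mono) auto
      also have "\<dots> = (1 + C)\<^sup>2 * ((V z)\<^sup>2 * indicator (ball 0 R) z)"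
        by (auto simp: power_mult_distrib indicator_def)
      finally show ?thesis .
    qed
    then have "(\<integral>\<^sup>+z. (V' z)\<^sup>2 \<partial>lborel) \<le> (\<integral>\<^sup>+z. (1 + C)\<^sup>2 * ((V z)\<^sup>2 * indicator (ball 0 R) z) \<partial>lborel)"
      by (intro nn_integral_mono)
    also have "\<dots> = (1 + C)\<^sup>2 * (\<integral>\<^sup>+z. (V z)\<^sup>2 * indicator (ball 0 R) z \<partial>lborel)"
      by (rule nn_integral_cmult) measurable
    also have "\<dots> < \<infinity>" using VR C by (simp add: ennreal_mult_less_top power2_eq_square)
    finally show ?thesis .
  qed
  have Usfin: "(\<integral>\<^sup>+z. (Us z)\<^sup>2 * potential_weight V' z \<partial>lborel) < \<infinity>"
  proof -
    have "(\<integral>\<^sup>+z. (Us z)\<^sup>2 * potential_weight V' z \<partial>lborel)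
      \<le> (\<integral>\<^sup>+z. (cauchy_potential G z)\<^sup>2 * potential_weight V' z * indicator (ball 0 R) z \<partial>lborel)"
    proof (rule nn_integral_mono_AE)
      show "AE z in lborel. (Us z)\<^sup>2 * potential_weight V' z
          \<le> (cauchy_potential G z)\<^sup>2 * potential_weight V' z * indicator (ball 0 R) z"
        using UG
      proof eventually_elim
        case (elim z)
        show ?case
        proof (cases "z \<in> ball 0 s")
          case True
          then have "z \<in> ball 0 R" using r by simp
          then show ?thesis using True elim
            by (auto simp: Us_def intro!: mult_right_mono power_mono)
        qed (simp add: Us_def)
      qed
    qed
    also have "\<dots> < \<infinity>"
    proof (rule potential_sq_weight_finite[OF _ _ G V'fin])
      show "V' z = 0" if "z \<notin> ball 0 R" for z
        using that r by (auto simp: V'_def)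
    qed (use r in auto)
    finally show ?thesis .
  qed
  define Y where "Y = (\<integral>\<^sup>+z. (cauchy_potential B z)\<^sup>2 * \<omega> z \<partial>lborel)"
  \<comment> \<open>The fixed potential is controlled by the weighted bound itself, now with \<open>V'\<close> in place of \<open>W\<close>.\<close>
  have Yfin: "Y < \<infinity>"
  proof -
    have "cauchy_potential B z \<le> cauchy_potential (\<lambda>w. V' w * Us w) z" for z
      by (rule cauchy_potential_mono_AE) (auto simp: B_def V'_def Us_def indicator_def)
    then have "Y \<le> (\<integral>\<^sup>+z. (cauchy_potential (\<lambda>w. V' w * Us w) z)\<^sup>2 * potential_weight V' z \<partial>lborel)"
      unfolding Y_def by (intro nn_integral_mono mult_mono power_mono \<omega>_le) auto
    also have "\<dots> \<le> ennreal C0 * (\<integral>\<^sup>+w. (V' w)\<^sup>2 \<partial>lborel) * (\<integral>\<^sup>+z. (Us z)\<^sup>2 * potential_weight V' z \<partial>lborel)"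
      by (rule bound) measurable
    also have "\<dots> < \<infinity>" using V'fin Usfin by (simp add: ennreal_mult_less_top)
    finally show ?thesis .
  qed
  have iterate: "(\<integral>\<^sup>+z. (ennreal ((1 / cmod z) ^ m) * U z * indicator (ball 0 r) z)\<^sup>2 * \<omega> z \<partial>lborel)
      \<le> 4 * (ennreal ((1 / r) ^ m))\<^sup>2 * Y" (is "?X \<le> _") for m
  proof -
    define f where "f = (\<lambda>z. ennreal ((1 / cmod z) ^ m) * U z * indicator (ball 0 r) z)"
    let ?I = "cauchy_potential (\<lambda>w. W w * f w)" and ?q = "ennreal ((1 / r) ^ m)"
    have [measurable]: "f \<in> borel_measurable borel" unfolding f_def by measurable
    have Xf: "?X = (\<integral>\<^sup>+z. (f z)\<^sup>2 * \<omega> z \<partial>lborel)" by (simp add: f_def)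
    have fa: "AE z in lborel. f z \<le> ennreal ((1 / a) ^ m) * Us z \<and> (cmod z < a \<longrightarrow> f z = 0)"
      using U0
    proof eventually_elim
      case (elim z)
      show ?case
      proof (cases "cmod z < a")
        case True then show ?thesis using elim by (simp add: f_def)
      next
        case False
        then have "(1 / cmod z) ^ m \<le> (1 / a) ^ m" using r by (intro power_mono divide_left_mono) (auto intro!: mult_pos_pos)
        then show ?thesis using False r
          by (auto simp: f_def Us_def indicator_def intro!: mult_right_mono ennreal_leI)
      qed
    qed
    \<comment> \<open>Only \<open>\<bar>z\<bar> \<ge> a\<close> matters, and there the weight is at most \<open>a\<^sup>-\<^sup>m\<close>.\<close>
    have Xfin: "?X < \<infinity>"
    proof -
      have "?X \<le> (\<integral>\<^sup>+z. (ennreal ((1 / a) ^ m))\<^sup>2 * ((Us z)\<^sup>2 * potential_weight V' z) \<partial>lborel)"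
        unfolding Xf
      proof (rule nn_integral_mono_AE)
        show "AE z in lborel. (f z)\<^sup>2 * \<omega> z \<le> (ennreal ((1 / a) ^ m))\<^sup>2 * ((Us z)\<^sup>2 * potential_weight V' z)"
          using fa
        proof eventually_elim
          case (elim z)
          then have "(f z)\<^sup>2 * \<omega> z \<le> (ennreal ((1 / a) ^ m) * Us z)\<^sup>2 * potential_weight V' z"
            by (intro mult_mono power_mono \<omega>_le) auto
          then show ?case by (simp add: power_mult_distrib mult.assoc)
        qed
      qed
      also have "\<dots> = (ennreal ((1 / a) ^ m))\<^sup>2 * (\<integral>\<^sup>+z. (Us z)\<^sup>2 * potential_weight V' z \<partial>lborel)"
        by (rule nn_integral_cmult) measurable
      also have "\<dots> < \<infinity>" using Usfin by (simp add: ennreal_mult_less_top power2_eq_square)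
      finally show ?thesis .
    qed
    have "AE z in lborel. f z \<le> ?I z + ?q * cauchy_potential B z"
      using D[of m]
    proof eventually_elim
      case (elim z)
      show ?case
      proof (cases "z \<in> ball 0 r")
        case True
        have "AE w in lborel. carleman_source U V C r s m w
           \<le> W w * f w + ?q * B w"
          using U0
        proof eventually_elim
          case (elim w)
          then show ?case
            by (auto simp: carleman_source_def W_def f_def B_def indicator_def mult_ac)
        qed
        then have "cauchy_potential (carleman_source U V C r s m) z
           \<le> cauchy_potential (\<lambda>w. W w * f w + ?q * B w) z"
          by (rule cauchy_potential_mono_AE)
        also have "\<dots> = ?I z + ?q * cauchy_potential B z"
          by (subst cauchy_potential_add) (auto simp: cauchy_potential_cmult)
        finally show ?thesis using elim True by (simp add: f_def)
      qed (simp add: f_def)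
    qed
    then have "(\<integral>\<^sup>+z. (f z)\<^sup>2 * \<omega> z \<partial>lborel)
        \<le> (\<integral>\<^sup>+z. 2 * ((?I z)\<^sup>2 * \<omega> z)
            + 2 * (?q)\<^sup>2 * ((cauchy_potential B z)\<^sup>2 * \<omega> z) \<partial>lborel)"
    proof (rule nn_integral_mono_AE[OF eventually_mono])
      fix z assume le: "f z \<le> ?I z + ?q * cauchy_potential B z"
      have "(f z)\<^sup>2 \<le> (?I z + ?q * cauchy_potential B z)\<^sup>2"
        by (intro power_mono le) auto
      also have "\<dots> \<le> 2 * (?I z)\<^sup>2 + 2 * (?q * cauchy_potential B z)\<^sup>2"
        by (rule ennreal_add_sq_le)
      finally have "(f z)\<^sup>2 * \<omega> z \<le> (2 * (?I z)\<^sup>2 + 2 * (?q * cauchy_potential B z)\<^sup>2) * \<omega> z"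
        by (rule mult_right_mono) simp
      then show "(f z)\<^sup>2 * \<omega> z \<le> 2 * ((?I z)\<^sup>2 * \<omega> z)
            + 2 * (?q)\<^sup>2 * ((cauchy_potential B z)\<^sup>2 * \<omega> z)"
        by (simp only: power_mult_distrib distrib_right mult.assoc)
    qed
    also have "\<dots> = 2 * (\<integral>\<^sup>+z. (?I z)\<^sup>2 * \<omega> z \<partial>lborel) + 2 * (?q)\<^sup>2 * Y"
      unfolding Y_def by (subst nn_integral_add) (auto simp: nn_integral_cmult)
    also have "\<dots> \<le> 2 * (ennreal (1/4) * ?X) + 2 * (?q)\<^sup>2 * Y"
    proof (intro add_right_mono mult_left_mono)
      have "(\<integral>\<^sup>+z. (?I z)\<^sup>2 * \<omega> z \<partial>lborel)
          \<le> ennreal C0 * (\<integral>\<^sup>+w. (W w)\<^sup>2 \<partial>lborel) * ?X"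
        unfolding Xf using bound[of W f] by (simp add: \<omega>_def)
      also have "(\<integral>\<^sup>+w. (W w)\<^sup>2 \<partial>lborel) = (\<integral>\<^sup>+z. (V z)\<^sup>2 * indicator (ball 0 r - ball 0 a) z \<partial>lborel)"
        by (intro nn_integral_cong) (auto simp: W_def indicator_def)
      also have "ennreal C0 * \<dots> * ?X \<le> ennreal (1/4) * ?X"
        by (intro mult_right_mono small) auto
      finally show "(\<integral>\<^sup>+z. (?I z)\<^sup>2 * \<omega> z \<partial>lborel) \<le> ennreal (1/4) * ?X" .
    qed auto
    finally have main: "?X \<le> 2 * (ennreal (1/4) * ?X) + 2 * (?q)\<^sup>2 * Y"
      unfolding Xf .
    have "?X \<le> 2 * (2 * ((?q)\<^sup>2 * Y))"
      using main Xfin unfolding mult.assoc[of 2] by (rule ennreal_absorb_half)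
    then show ?thesis
      by (simp only: mult.assoc[symmetric]) simp
  qed
  define Zt where "Zt = (\<integral>\<^sup>+z. (U z * indicator (ball 0 t) z)\<^sup>2 * \<omega> z \<partial>lborel)"
  obtain y where y: "Y = ennreal y" "y \<ge> 0" using Yfin by (cases Y) auto
  have Zt_le: "Zt \<le> ennreal (4 * y * ((t / r)\<^sup>2) ^ m)" for m
  proof -
    let ?Ut = "\<lambda>z. U z * indicator (ball 0 t) z"
    let ?q = "ennreal ((1 / r) ^ m)" and ?p = "ennreal ((1 / t) ^ m)" and ?t = "ennreal (t ^ m)"
    have "(?p)\<^sup>2 * Zt = (\<integral>\<^sup>+z. (?p)\<^sup>2 * ((?Ut z)\<^sup>2 * \<omega> z) \<partial>lborel)"
      unfolding Zt_def by (rule nn_integral_cmult[symmetric]) measurable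
    also have "\<dots> \<le> (\<integral>\<^sup>+z. (ennreal ((1 / cmod z) ^ m) * U z * indicator (ball 0 r) z)\<^sup>2 * \<omega> z \<partial>lborel)"
    proof (rule nn_integral_mono_AE)
      show "AE z in lborel. (?p)\<^sup>2 * ((?Ut z)\<^sup>2 * \<omega> z)
          \<le> (ennreal ((1 / cmod z) ^ m) * U z * indicator (ball 0 r) z)\<^sup>2 * \<omega> z"
        using U0
      proof eventually_elim
        case (elim z)
        show ?case
        proof (cases "z \<in> ball 0 t \<and> z \<notin> ball 0 a")
          case True
          then have "(1 / t) ^ m \<le> (1 / cmod z) ^ m"
            using r t by (intro power_mono divide_left_mono) (auto intro!: mult_pos_pos)
          then have "?p * (?Ut z) \<le> ennreal ((1 / cmod z) ^ m) * U z * indicator (ball 0 r) z"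
            using True t by (simp add: mult_right_mono ennreal_leI)
          then have "(?p * (?Ut z))\<^sup>2 * \<omega> z
              \<le> (ennreal ((1 / cmod z) ^ m) * U z * indicator (ball 0 r) z)\<^sup>2 * \<omega> z"
            by (intro mult_right_mono power_mono) auto
          then show ?thesis by (simp only: power_mult_distrib mult.assoc)
        next
          case False
          then have z0: "?Ut z = 0" using elim by (auto simp: indicator_def)
          show ?thesis unfolding z0 by simp
        qed
      qed
    qed
    also have "\<dots> \<le> 4 * (?q)\<^sup>2 * Y" by (rule iterate)
    finally have "(?t)\<^sup>2 * ((?p)\<^sup>2 * Zt) \<le> (?t)\<^sup>2 * (4 * (?q)\<^sup>2 * Y)"
      by (rule mult_left_mono) simp
    moreover have "(?t)\<^sup>2 * ((?p)\<^sup>2 * Zt) = Zt"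
    proof -
      have "?t * ?p = 1"
        using t by (simp add: ennreal_mult[symmetric] power_mult_distrib[symmetric])
      then show ?thesis
        by (simp add: mult.assoc[symmetric] power_mult_distrib[symmetric])
    qed
    moreover have "(?t)\<^sup>2 * (4 * (?q)\<^sup>2 * Y) = ennreal (4 * y * ((t / r)\<^sup>2) ^ m)"
    proof -
      have "(?t)\<^sup>2 * (4 * (?q)\<^sup>2 * Y) = ennreal ((t ^ m)\<^sup>2 * (4 * ((1 / r) ^ m)\<^sup>2 * y))"
        using t r y by (simp add: ennreal_mult ennreal_power)
      also have "(t ^ m)\<^sup>2 * (4 * ((1 / r) ^ m)\<^sup>2 * y) = 4 * y * ((t / r)\<^sup>2) ^ m"
        by (simp add: power_divide power_mult[symmetric] mult.commute)
      finally show ?thesis .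
    qed
    ultimately show ?thesis by simp
  qed
  have "Zt \<le> 0"
  proof (rule tendsto_lowerbound)
    have "(t / r)\<^sup>2 < 1" using t r by (simp add: power_less_one_iff)
    then have "(\<lambda>m. 4 * y * ((t / r)\<^sup>2) ^ m) \<longlonglongrightarrow> 4 * y * 0"
      by (intro tendsto_mult tendsto_const LIMSEQ_realpow_zero) auto
    then show "(\<lambda>m. ennreal (4 * y * ((t / r)\<^sup>2) ^ m)) \<longlonglongrightarrow> 0"
      by (metis mult_zero_right tendsto_ennrealI ennreal_0)
    show "eventually (\<lambda>m. Zt \<le> ennreal (4 * y * ((t / r)\<^sup>2) ^ m)) sequentially"
      by (rule always_eventually) (rule allI, rule Zt_le)
  qed (rule trivial_limit_sequentially)
  then have "(\<integral>\<^sup>+z. (U z * indicator (ball 0 t) z)\<^sup>2 * \<omega> z \<partial>lborel) = 0" by (simp add: Zt_def)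
  then have "AE z in lborel. (U z * indicator (ball 0 t) z)\<^sup>2 * \<omega> z = 0"
    by (rule nn_integral_0_iff_AE[THEN iffD1, rotated]) measurable
  then show ?thesis
  proof eventually_elim
    case (elim z)
    then show ?case using \<omega>_pos[of z] by (auto simp: indicator_def)
  qed
qed

lemma AE_ball_increasing:
  fixes P :: "complex \<Rightarrow> bool"
  assumes "\<And>t. 0 < t \<Longrightarrow> t < \<tau> \<Longrightarrow> AE z in lborel. z \<in> ball 0 t \<longrightarrow> P z"
  shows "AE z in lborel. z \<in> ball 0 \<tau> \<longrightarrow> P z"
proof -
  have "AE z in lborel. \<forall>n::nat. 0 < \<tau> - 1 / Suc n \<longrightarrow> z \<in> ball 0 (\<tau> - 1 / Suc n) \<longrightarrow> P z"
    unfolding AE_all_countable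
  proof
    fix n :: nat
    show "AE z in lborel. 0 < \<tau> - 1 / Suc n \<longrightarrow> z \<in> ball 0 (\<tau> - 1 / Suc n) \<longrightarrow> P z"
      using assms[of "\<tau> - 1 / Suc n"] by (cases "0 < \<tau> - 1 / Suc n") auto
  qed
  then show ?thesis
  proof eventually_elim
    case (elim z)
    show ?case
    proof
      assume z: "z \<in> ball 0 \<tau>"
      then obtain n where n: "inverse (real (Suc n)) < \<tau> - norm z"
        using reals_Archimedean[of "\<tau> - norm z"] by auto
      then have "norm z < \<tau> - 1 / Suc n" by (simp add: inverse_eq_divide)
      moreover from this have "0 < \<tau> - 1 / Suc n" using norm_ge_zero[of z] by linarith
      ultimately show "P z" using elim by simp
    qed
  qed
qed

lemma thin_annulus_integral_small:
  fixes h :: "complex \<Rightarrow> ennreal"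
  assumes [measurable]: "h \<in> borel_measurable borel"
    and fin: "(\<integral>\<^sup>+z. h z * indicator (ball 0 R) z \<partial>lborel) < \<infinity>"
    and \<tau>: "0 < \<tau>" "\<tau> < R" and e: "0 < (e :: ennreal)"
  obtains \<delta> where "\<delta> > 0" "\<tau> + \<delta> < R"
    "(\<integral>\<^sup>+z. h z * indicator (ball 0 (\<tau> + \<delta>) - ball 0 \<tau>) z \<partial>lborel) < e"
proof -
  \<comment> \<open>The factor 2 in the denominator keeps \<open>\<tau> + d n\<close> strictly below \<open>R\<close>.\<close>
  define d where "d = (\<lambda>n::nat. (R - \<tau>) / (2 + real n))"
  have d: "d n > 0" "\<tau> + d n < R" for n
  proof -
    show "d n > 0" using \<tau> by (simp add: d_def)
    have "d n \<le> (R - \<tau>) / 2" using \<tau> unfolding d_def by (intro divide_left_mono) auto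
    then show "\<tau> + d n < R" using \<tau> by (simp add: field_simps)
  qed
  have d0: "d \<longlonglongrightarrow> 0"
    unfolding d_def
    by (intro real_tendsto_divide_at_top[OF tendsto_const]
        filterlim_tendsto_add_at_top[OF tendsto_const filterlim_real_sequentially])
  have "(\<lambda>n. \<integral>\<^sup>+z. h z * indicator (ball 0 (\<tau> + d n) - ball 0 \<tau>) z \<partial>lborel)
      \<longlonglongrightarrow> (\<integral>\<^sup>+z. 0 \<partial>(lborel :: complex measure))"
  proof (rule nn_integral_dominated_convergence[where w = "\<lambda>z. h z * indicator (ball 0 R) z"])
    show "AE z in lborel. h z * indicator (ball 0 (\<tau> + d n) - ball 0 \<tau>) z \<le> h z * indicator (ball 0 R) z" for n
      using d[of n] by (intro AE_I2) (auto simp: indicator_def)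
    have "AE z in lborel. z \<notin> sphere (0::complex) \<tau>"
      using negligible_sphere[of "0::complex" \<tau>]
      by (intro AE_not_in) (auto simp: negligible_iff_null_sets null_sets_completion_iff)
    then show "AE z in lborel. (\<lambda>n. h z * indicator (ball 0 (\<tau> + d n) - ball 0 \<tau>) z) \<longlonglongrightarrow> 0"
    proof eventually_elim
      case (elim z)
      have "eventually (\<lambda>n. h z * indicator (ball 0 (\<tau> + d n) - ball 0 \<tau>) z = 0) sequentially"
      proof (cases "norm z < \<tau>")
        case False
        then have "norm z - \<tau> > 0" using elim by auto
        then have "eventually (\<lambda>n. d n < norm z - \<tau>) sequentially" using d0 by (rule order_tendstoD(2)[rotated])
        then show ?thesis by eventually_elim (auto simp: indicator_def)
      qed auto
      then show ?case by (rule tendsto_eventually)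
    qed
  qed (use fin in auto)
  then have "eventually (\<lambda>n. (\<integral>\<^sup>+z. h z * indicator (ball 0 (\<tau> + d n) - ball 0 \<tau>) z \<partial>lborel) < e) sequentially"
    using e by (intro order_tendstoD(2)) auto
  then obtain n where "(\<integral>\<^sup>+z. h z * indicator (ball 0 (\<tau> + d n) - ball 0 \<tau>) z \<partial>lborel) < e"
    by (auto simp: eventually_sequentially)
  then show thesis using that d by blast
qed

text \<open>
  Let \<open>\<tau>\<close> be the supremum of the radii of discs on which \<open>U\<close> vanishes. If \<open>\<tau> < r0\<close>, then a thin annulus
  around the disc of radius \<open>\<tau>\<close> carries little of the integral of \<open>V\<^sup>2\<close>, and \<open>annulus_step\<close> extends the
  zeros beyond \<open>\<tau>\<close>. The radii \<open>r\<close> and \<open>s\<close> in \<open>D\<close> are rational, so that \<open>D\<close> collects countably many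
  statements, and one null set of lines accounts for all of them.
\<close>

theorem plane_unique_continuation:
  fixes U V G :: "complex \<Rightarrow> ennreal" and C :: "real \<Rightarrow> real \<Rightarrow> ennreal"
  assumes [measurable]: "U \<in> borel_measurable borel" "V \<in> borel_measurable borel" "G \<in> borel_measurable borel"
    and V1: "\<And>z. 1 \<le> V z"
    and VR: "(\<integral>\<^sup>+z. (V z)\<^sup>2 * indicator (ball 0 R) z \<partial>lborel) < \<infinity>"
    and G: "(\<integral>\<^sup>+z. (G z)\<^sup>2 \<partial>lborel) < \<infinity>" "\<And>z. z \<notin> ball 0 R \<Longrightarrow> G z = 0"
    and \<rho>: "0 < \<rho>" "\<rho> < r0" "r0 < R"
    and UG: "AE z in lborel. z \<in> ball 0 r0 \<longrightarrow> U z \<le> cauchy_potential G z"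
    and U0: "AE z in lborel. z \<in> ball 0 \<rho> \<longrightarrow> U z = 0"
    and C: "\<And>r s. C r s < \<infinity>"
    and D: "\<And>m r s. r \<in> \<rat> \<Longrightarrow> s \<in> \<rat> \<Longrightarrow> \<rho> < r \<Longrightarrow> r < s \<Longrightarrow> s < r0 \<Longrightarrow>
       AE z in lborel. z \<in> ball 0 r \<longrightarrow> ennreal ((1 / cmod z) ^ m) * U z
       \<le> cauchy_potential (carleman_source U V (C r s) r s m) z"
  shows "AE z in lborel. z \<in> ball 0 r0 \<longrightarrow> U z = 0"
proof -
  obtain C0 where C0: "C0 > 0" and bound: "\<And>W f. W \<in> borel_measurable borel \<Longrightarrow> f \<in> borel_measurable borel \<Longrightarrow>
      (\<integral>\<^sup>+z. (cauchy_potential (\<lambda>w. W w * f w) z)\<^sup>2 * potential_weight W z \<partial>lborel)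
      \<le> ennreal C0 * (\<integral>\<^sup>+w. (W w)\<^sup>2 \<partial>lborel) * (\<integral>\<^sup>+z. (f z)\<^sup>2 * potential_weight W z \<partial>lborel)"
    by (rule cauchy_transform_weighted_bound) blast
  define T where "T = {t. 0 < t \<and> t \<le> r0 \<and> (AE z in lborel. z \<in> ball 0 t \<longrightarrow> U z = 0)}"
  have \<rho>T: "\<rho> \<in> T" using \<rho> U0 by (simp add: T_def)
  have bdd: "bdd_above T" by (rule bdd_aboveI[of _ r0]) (simp add: T_def)
  define \<tau> where "\<tau> = Sup T"
  have \<tau>: "\<rho> \<le> \<tau>" "\<tau> \<le> r0"
    using \<rho>T bdd by (auto simp: \<tau>_def T_def intro: cSup_upper cSup_least)
  have U\<tau>: "AE z in lborel. z \<in> ball 0 \<tau> \<longrightarrow> U z = 0"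
  proof (rule AE_ball_increasing)
    fix t assume t: "0 < t" "t < \<tau>"
    then obtain t' where t': "t' \<in> T" "t < t'"
      using less_cSup_iff[of T t] bdd \<rho>T by (auto simp: \<tau>_def)
    have "AE z in lborel. z \<in> ball 0 t' \<longrightarrow> U z = 0" using t' by (simp add: T_def)
    then show "AE z in lborel. z \<in> ball 0 t \<longrightarrow> U z = 0"
      by eventually_elim (use t' in auto)
  qed
  have "\<tau> = r0"
  proof (rule ccontr)
    assume "\<tau> \<noteq> r0"
    then have lt: "\<tau> < r0" using \<tau> by simp
    have "ennreal (1 / (4 * C0)) > 0" using C0 by (simp add: ennreal_zero_less_divide)
    then obtain \<delta> where \<delta>: "\<delta> > 0" "\<tau> + \<delta> < R"
      "(\<integral>\<^sup>+z. (V z)\<^sup>2 * indicator (ball 0 (\<tau> + \<delta>) - ball 0 \<tau>) z \<partial>lborel) < ennreal (1 / (4 * C0))"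
      using thin_annulus_integral_small[of "\<lambda>z. (V z)\<^sup>2" R \<tau> "ennreal (1 / (4 * C0))"] VR \<tau> \<rho> by auto
    obtain r where r: "r \<in> \<rat>" "\<tau> < r" "r < min (\<tau> + \<delta>) r0"
      using Rats_dense_in_real[of \<tau> "min (\<tau> + \<delta>) r0"] lt \<delta>(1) by auto
    obtain s where s: "s \<in> \<rat>" "r < s" "s < r0"
      using Rats_dense_in_real[of r r0] r by auto
    have "AE z in lborel. z \<in> ball 0 ((\<tau> + r) / 2) \<longrightarrow> U z = 0"
    proof (rule annulus_step[where U = U and V = V and G = G and a = \<tau> and r = r and s = s and R = R and C = "C r s" and C0 = C0, OF bound])
      show "AE z in lborel. z \<in> ball 0 s \<longrightarrow> U z \<le> cauchy_potential G z"
        using UG by eventually_elim (use s in auto)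
      have "(\<integral>\<^sup>+z. (V z)\<^sup>2 * indicator (ball 0 r - ball 0 \<tau>) z \<partial>lborel) \<le> ennreal (1 / (4 * C0))"
        by (rule order_trans[OF nn_integral_mono less_imp_le[OF \<delta>(3)]]) (use r in \<open>auto simp: indicator_def\<close>)
      then have "ennreal C0 * (\<integral>\<^sup>+z. (V z)\<^sup>2 * indicator (ball 0 r - ball 0 \<tau>) z \<partial>lborel) \<le> ennreal C0 * ennreal (1 / (4 * C0))"
        by (rule mult_left_mono) simp
      also have "\<dots> = ennreal (1/4)" using C0 by (simp add: ennreal_mult[symmetric])
      finally show "ennreal C0 * (\<integral>\<^sup>+z. (V z)\<^sup>2 * indicator (ball 0 r - ball 0 \<tau>) z \<partial>lborel) \<le> ennreal (1/4)" .
      show "AE z in lborel. z \<in> ball 0 r \<longrightarrow> ennreal ((1 / cmod z) ^ m) * U z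
       \<le> cauchy_potential (carleman_source U V (C r s) r s m) z" for m
        by (rule D) (use r s \<tau> in auto)
    qed (use V1 VR G U\<tau> C r s \<tau> \<rho> in auto)
    then have "(\<tau> + r) / 2 \<in> T" using r \<tau> \<rho> by (auto simp: T_def)
    then have "(\<tau> + r) / 2 \<le> \<tau>" unfolding \<tau>_def by (rule cSup_upper[OF _ bdd])
    then show False using r by simp
  qed
  then show ?thesis using U\<tau> by simp
qed

section \<open>Cutoffs of the weights\<close>

lemma smooth_real_cutoff:
  fixes a b :: real assumes "a < b"
  obtains \<psi> \<psi>' :: "real \<Rightarrow> real" and C where
    "smooth \<psi>" "\<And>t. (\<psi> has_real_derivative \<psi>' t) (at t)" "\<And>t. \<bar>\<psi>' t\<bar> \<le> C"
    "\<And>t. 0 \<le> \<psi> t" "\<And>t. \<psi> t \<le> 1" "\<And>t. t \<le> a \<Longrightarrow> \<psi> t = 1" "\<And>t. b \<le> t \<Longrightarrow> \<psi> t = 0"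
    "\<And>t. t < a \<Longrightarrow> \<psi>' t = 0" "\<And>t. b < t \<Longrightarrow> \<psi>' t = 0"
proof -
  define \<psi> where "\<psi> = (\<lambda>t. flat 0 (b - t) / (flat 0 (b - t) + flat 0 (t - a)))"
  have pos: "flat 0 (b - t) + flat 0 (t - a) > 0" for t
    using flat_pos[of "b - t" 0] flat_pos[of "t - a" 0] flat_nonneg[of 0 "b - t"] flat_nonneg[of 0 "t - a"] assms
    by (cases "t < b") (auto intro: add_pos_nonneg add_nonneg_pos)
  have lin: "smooth (\<lambda>t::real. t)" by (rule smooth_bounded_linear[OF bounded_linear_ident])
  have sm: "smooth \<psi>"
    unfolding \<psi>_def
  proof (rule smooth_divide)
    show "flat 0 (b - t) + flat 0 (t - a) \<noteq> 0" for t using pos[of t] by simp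
  qed (intro smooth_add smooth_compose_real[OF smooth_flat] smooth_diff smooth_const lin)+
  define \<psi>' where "\<psi>' = (\<lambda>t. frechet_derivative \<psi> (at t) 1)"
  have d: "(\<psi> has_real_derivative \<psi>' t) (at t)" for t
  proof -
    have "frechet_derivative \<psi> (at t) h = \<psi>' t * h" for h
      using linear_scale[OF has_derivative_linear[OF smooth_has_derivative[OF sm, of t]], of h 1]
      by (simp add: \<psi>'_def)
    then have "frechet_derivative \<psi> (at t) = (*) (\<psi>' t)" by (rule ext)
    then show ?thesis
      using smooth_has_derivative[OF sm, of t] by (simp only: has_field_derivative_def)
  qed
  have one: "\<psi> t = 1" if "t \<le> a" for t
    using that pos[of t] by (simp add: \<psi>_def flat_eq_0)
  have zero: "\<psi> t = 0" if "b \<le> t" for t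
    using that by (simp add: \<psi>_def flat_eq_0)
  have d1: "\<psi>' t = 0" if "t < a" for t
  proof (rule DERIV_unique[OF d])
    have "((\<lambda>t. 1) has_real_derivative 0) (at t)" by simp
    then show "(\<psi> has_real_derivative 0) (at t)"
      by (rule has_field_derivative_transform_within_open[where S = "{..<a}"]) (use that one in auto)
  qed
  have d0: "\<psi>' t = 0" if "b < t" for t
  proof (rule DERIV_unique[OF d])
    have "((\<lambda>t. 0) has_real_derivative 0) (at t)" by simp
    then show "(\<psi> has_real_derivative 0) (at t)"
      by (rule has_field_derivative_transform_within_open[where S = "{b<..}"]) (use that zero in auto)
  qed
  have "continuous_on {a..b} \<psi>'"
    unfolding \<psi>'_def
    by (rule continuous_on_subset[OF smooth_continuous[OF smooth_derivative[OF sm]]]) auto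
  then have "bounded (\<psi>' ` {a..b})"
    by (intro compact_imp_bounded compact_continuous_image) auto
  then obtain C where "\<forall>y\<in>\<psi>' ` {a..b}. norm y \<le> C" unfolding bounded_iff by blast
  then have C: "\<bar>\<psi>' t\<bar> \<le> C" if "t \<in> {a..b}" for t using that by auto
  have "C \<ge> 0" using C[of a] assms by auto
  then have bd: "\<bar>\<psi>' t\<bar> \<le> C" for t
    using C[of t] d0[of t] d1[of t] by (cases "t < a"; cases "b < t") auto
  have nonneg: "0 \<le> \<psi> t" for t
    unfolding \<psi>_def by (intro divide_nonneg_pos flat_nonneg pos)
  have le1: "\<psi> t \<le> 1" for t
    unfolding \<psi>_def using pos[of t] flat_nonneg[of 0 "t - a"] by (subst pos_divide_le_eq) auto
  show thesis by (rule that[OF sm d bd nonneg le1 one zero d1 d0])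
qed

lemma dbar_radial:
  fixes x :: "complex ^ 'n"
  assumes "(\<psi> has_real_derivative d) (at ((cmod (x $ j - c))\<^sup>2))"
  shows "dbar j (\<lambda>x. complex_of_real (\<psi> ((cmod (x $ j - c))\<^sup>2))) x = of_real d * (x $ j - c)"
proof -
  define w where "w = x $ j - c"
  have "((\<lambda>w. (Re w)\<^sup>2 + (Im w)\<^sup>2) has_derivative (\<lambda>h. 2 * Re w * Re h + 2 * Im w * Im h)) (at w)"
    by (auto intro!: derivative_eq_intros)
  moreover have "(\<psi> has_derivative (*) d) (at ((Re w)\<^sup>2 + (Im w)\<^sup>2))"
    using assms unfolding has_field_derivative_def w_def cmod_power2 .
  ultimately have "((\<lambda>w. \<psi> ((Re w)\<^sup>2 + (Im w)\<^sup>2)) has_derivative (\<lambda>h. d * (2 * Re w * Re h + 2 * Im w * Im h))) (at w)"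
    by (rule has_derivative_compose)
  then have "((\<lambda>w. complex_of_real (\<psi> ((cmod w)\<^sup>2))) has_derivative
      (\<lambda>h. of_real (d * (2 * Re w * Re h + 2 * Im w * Im h)))) (at w)"
    unfolding cmod_power2 by (rule has_derivative_of_real)
  from dbar_coordinate[OF this[unfolded w_def]] show ?thesis
    by (auto simp: complex_eq_iff algebra_simps)
qed

lemma dbar_holomorphic_coordinate:
  fixes x :: "complex ^ 'n"
  assumes "(h has_field_derivative h') (at (x $ j - c))"
  shows "dbar j (\<lambda>x. h (x $ j - c)) x = 0"
  using dbar_coordinate[OF assms[unfolded has_field_derivative_def]]
  by (simp add: algebra_simps)

lemma differentiable_coordinate:
  fixes x :: "complex ^ 'n"
  assumes "(h has_field_derivative h') (at (x $ j - c))"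
  shows "(\<lambda>x. h (x $ j - c)) differentiable (at x)"
  using has_derivative_compose[OF smooth_has_derivative[OF smooth_coordinate[of j c]]
      assms[unfolded has_field_derivative_def]]
  by (auto simp: differentiable_def)

text \<open>
  The function \<open>H m\<close> is \<open>w\<^sup>-\<^sup>m\<close>, for \<open>w = x\<^sub>j - c\<close>, cut off between \<open>r\<close> and \<open>s\<close> and smoothed for \<open>\<bar>w\<bar> < \<rho>\<close>,
  where the function to which it is applied vanishes. The constant \<open>C\<close> is the same for all \<open>m\<close>,
  because d-bar does not act on the holomorphic factor.
\<close>

definition weight_cutoff :: "'n \<Rightarrow> complex \<Rightarrow> real \<Rightarrow> real \<Rightarrow> real \<Rightarrow> real \<Rightarrow> (nat \<Rightarrow> complex ^ 'n \<Rightarrow> complex) \<Rightarrow> bool" where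
  "weight_cutoff j c \<rho> r s C H \<longleftrightarrow> 0 \<le> C \<and>
    (\<forall>m. smooth (H m)) \<and>
    (\<forall>m x. s \<le> cmod (x $ j - c) \<longrightarrow> H m x = 0 \<and> dbar j (H m) x = 0) \<and>
    (\<forall>m x. \<rho> \<le> cmod (x $ j - c) \<longrightarrow> cmod (x $ j - c) \<le> r \<longrightarrow> cmod (H m x) = (1 / cmod (x $ j - c)) ^ m) \<and>
    (\<forall>m x. \<rho> \<le> cmod (x $ j - c) \<longrightarrow> cmod (H m x) \<le> (1 / cmod (x $ j - c)) ^ m) \<and>
    (\<forall>m x. \<rho> \<le> cmod (x $ j - c) \<longrightarrow> cmod (dbar j (H m) x) \<le> C * (1 / cmod (x $ j - c)) ^ m) \<and>
    (\<forall>m x. \<rho> \<le> cmod (x $ j - c) \<longrightarrow> cmod (x $ j - c) < r \<longrightarrow> dbar j (H m) x = 0) \<and>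
    (\<forall>x. cmod (H 0 x) \<le> 1)"

lemma weight_cutoff_exists:
  fixes c :: complex and j :: "'n::finite"
  assumes \<rho>: "0 < \<rho>" "\<rho> < r" "r < s"
  shows "\<exists>C H. weight_cutoff j c \<rho> r s C H"
proof -
  \<comment> \<open>The cutoff ends before \<open>s\<close>, so that \<open>H\<close> and its derivative vanish also where \<open>\<bar>w\<bar> = s\<close>.\<close>
  define s1 where "s1 = (r + s) / 2"
  have s1: "r < s1" "s1 < s" using \<rho> by (auto simp: s1_def)
  have "r\<^sup>2 < s1\<^sup>2" using \<rho> s1 by (intro power_strict_mono) auto
  then obtain \<psi> \<psi>' :: "real \<Rightarrow> real" and C0 where
    \<psi>: "smooth \<psi>" "\<And>t. (\<psi> has_real_derivative \<psi>' t) (at t)" "\<And>t. \<bar>\<psi>' t\<bar> \<le> C0"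
      "\<And>t. 0 \<le> \<psi> t" "\<And>t. \<psi> t \<le> 1" "\<And>t. t \<le> r\<^sup>2 \<Longrightarrow> \<psi> t = 1" "\<And>t. s1\<^sup>2 \<le> t \<Longrightarrow> \<psi> t = 0"
      "\<And>t. t < r\<^sup>2 \<Longrightarrow> \<psi>' t = 0" "\<And>t. s1\<^sup>2 < t \<Longrightarrow> \<psi>' t = 0"
    by (rule smooth_real_cutoff) blast
  have C0: "C0 \<ge> 0" using \<psi>(3)[of 0] by linarith
  define N where "N = (\<lambda>x::complex^'n. (cmod (x $ j - c))\<^sup>2)"
  define a where "a = \<rho>\<^sup>2 / 2"
  have a: "a > 0" using \<rho> by (simp add: a_def)
  \<comment> \<open>\<open>\<eta>\<close> equals \<open>\<bar>w\<bar>\<^sup>2\<close> for \<open>\<bar>w\<bar>\<^sup>2 \<ge> a\<close> and is positive everywhere; the quotient below is \<open>1 / w\<close> where \<open>\<eta> = \<bar>w\<bar>\<^sup>2\<close>.\<close>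
  define \<eta> where "\<eta> = (\<lambda>x. N x + flat 0 (a - N x))"
  define H where "H = (\<lambda>m x. complex_of_real (\<psi> (N x)) * (cnj (x $ j - c) / complex_of_real (\<eta> x)) ^ m)"
  have sN: "smooth N" unfolding N_def by (rule smooth_cmod_sq[OF smooth_coordinate])
  have \<eta>nz: "\<eta> x \<noteq> 0" for x
  proof -
    have "N x \<ge> 0" by (simp add: N_def)
    then have "\<eta> x > 0"
      using flat_pos[of "a - N x" 0] flat_nonneg[of 0 "a - N x"] a
      unfolding \<eta>_def by (cases "N x < a") (auto intro: add_nonneg_pos add_pos_nonneg)
    then show ?thesis by simp
  qed
  have sm: "smooth (H m)" for m
    unfolding H_def
  proof (intro smooth_mult smooth_of_real smooth_power smooth_divide smooth_cnj smooth_coordinate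
      smooth_compose_real[OF \<psi>(1)] sN)
    show "smooth \<eta>"
      unfolding \<eta>_def
      by (intro smooth_add sN smooth_compose_real[OF smooth_flat] smooth_diff smooth_const)
    show "complex_of_real (\<eta> x) \<noteq> 0" for x using \<eta>nz[of x] by simp
  qed
  define S where "S = {x. a < N x}"
  have "open S" unfolding S_def
    by (intro open_Collect_less continuous_on_const smooth_continuous[OF sN])
  have HS: "H m x = complex_of_real (\<psi> (N x)) * (1 / (x $ j - c)) ^ m" if "x \<in> S" for m x
  proof -
    have nz: "x $ j - c \<noteq> 0" using that a by (auto simp: S_def N_def)
    have "\<eta> x = N x" using that by (simp add: \<eta>_def S_def flat_eq_0)
    then have "complex_of_real (\<eta> x) = (x $ j - c) * cnj (x $ j - c)"
      unfolding N_def by (simp only: complex_norm_square)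
    then have "cnj (x $ j - c) / complex_of_real (\<eta> x) = 1 / (x $ j - c)"
      using nz by simp
    then show ?thesis by (simp only: H_def)
  qed
  have dS: "dbar j (H m) x = of_real (\<psi>' (N x)) * (x $ j - c) * (1 / (x $ j - c)) ^ m" if "x \<in> S" for m x
  proof -
    have nz: "x $ j - c \<noteq> 0" using that a by (auto simp: S_def N_def)
    obtain D where D: "((\<lambda>w. (1 / w) ^ m) has_field_derivative D) (at (x $ j - c))"
    proof -
      have "(\<lambda>w. (1 / w) ^ m) field_differentiable (at (x $ j - c))"
        using nz by (intro derivative_intros) auto
      then show ?thesis using that by (auto simp: field_differentiable_def)
    qed
    have "dbar j (H m) x = dbar j (\<lambda>x. complex_of_real (\<psi> (N x)) * (1 / (x $ j - c)) ^ m) x"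
      by (rule dbar_cong_open[OF \<open>open S\<close> that HS])
    also have "\<dots> = dbar j (\<lambda>x. complex_of_real (\<psi> (N x))) x * (1 / (x $ j - c)) ^ m"
      by (subst dbar_mult)
         (auto intro!: smooth_differentiable smooth_of_real smooth_compose_real[OF \<psi>(1)] sN
            differentiable_coordinate[OF D] simp: dbar_holomorphic_coordinate[OF D])
    also have "dbar j (\<lambda>x. complex_of_real (\<psi> (N x))) x = of_real (\<psi>' (N x)) * (x $ j - c)"
      unfolding N_def by (rule dbar_radial[OF \<psi>(2)])
    finally show ?thesis .
  qed
  have inS: "x \<in> S" if "\<rho> \<le> cmod (x $ j - c)" for x
  proof -
    have "\<rho>\<^sup>2 \<le> N x" unfolding N_def using that \<rho> by (intro power_mono) auto
    moreover have "\<rho>\<^sup>2 > 0" using \<rho> by simp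
    moreover have "\<rho>\<^sup>2 / 2 < \<rho>\<^sup>2" using \<rho> by simp
    ultimately have "\<rho>\<^sup>2 / 2 < N x" by (metis less_le_trans)
    then show ?thesis by (simp add: S_def a_def)
  qed
  have normH: "cmod (H m x) = \<psi> (N x) * (1 / cmod (x $ j - c)) ^ m" if "\<rho> \<le> cmod (x $ j - c)" for m x
    unfolding HS[OF inS[OF that]] by (simp add: norm_mult norm_power norm_divide \<psi>(4))
  have far: "s1\<^sup>2 < N x" if "s \<le> cmod (x $ j - c)" for x
    unfolding N_def using that s1 \<rho> by (intro power_strict_mono) auto
  have "weight_cutoff j c \<rho> r s (C0 * s) H"
    unfolding weight_cutoff_def
  proof (intro conjI allI impI)
    show "cmod (H 0 x) \<le> 1" for x
      using \<psi>(4,5)[of "N x"] by (simp add: H_def)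
    show "C0 * s \<ge> 0" using C0 \<rho> by simp
    show "smooth (H m)" for m by (rule sm)
    show "H m x = 0" if "s \<le> cmod (x $ j - c)" for m x
      using \<psi>(7)[OF less_imp_le[OF far[OF that]]] by (simp add: H_def)
    show "dbar j (H m) x = 0" if "s \<le> cmod (x $ j - c)" for m x
      using dS[OF inS, of x m] that \<rho> \<psi>(9)[OF far[OF that]] by simp
    show "cmod (H m x) = (1 / cmod (x $ j - c)) ^ m" if "\<rho> \<le> cmod (x $ j - c)" "cmod (x $ j - c) \<le> r" for m x
    proof -
      have "N x \<le> r\<^sup>2" unfolding N_def using that by (intro power_mono) auto
      then show ?thesis using normH[OF that(1)] \<psi>(6) by simp
    qed
    show "cmod (H m x) \<le> (1 / cmod (x $ j - c)) ^ m" if "\<rho> \<le> cmod (x $ j - c)" for m x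
      unfolding normH[OF that] using \<psi>(5)[of "N x"] by (intro mult_left_le_one_le) (auto simp: \<psi>(4))
    show "dbar j (H m) x = 0" if "\<rho> \<le> cmod (x $ j - c)" "cmod (x $ j - c) < r" for m x
    proof -
      have "N x < r\<^sup>2" unfolding N_def using that by (intro power_strict_mono) auto
      then show ?thesis using dS[OF inS[OF that(1)]] \<psi>(8) by simp
    qed
    show "cmod (dbar j (H m) x) \<le> C0 * s * (1 / cmod (x $ j - c)) ^ m" if "\<rho> \<le> cmod (x $ j - c)" for m x
    proof (cases "s \<le> cmod (x $ j - c)")
      case True
      then have "\<psi>' (N x) = 0" using \<psi>(9)[OF far] by simp
      then show ?thesis using dS[OF inS[OF that]] C0 \<rho> by simp
    next
      case False
      have "cmod (dbar j (H m) x) = \<bar>\<psi>' (N x)\<bar> * cmod (x $ j - c) * (1 / cmod (x $ j - c)) ^ m"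
        unfolding dS[OF inS[OF that]] by (simp add: norm_mult norm_power norm_divide)
      also have "\<dots> \<le> C0 * s * (1 / cmod (x $ j - c)) ^ m"
        using False \<psi>(3) C0 by (intro mult_right_mono mult_mono) auto
      finally show ?thesis .
    qed
  qed
  then show ?thesis by blast
qed

section \<open>Restriction to complex lines\<close>

text \<open>
  Translation invariance and the Fubini theorem: an exceptional set that is null has null
  intersections with almost all lines.
\<close>

lemma AE_line_axis:
  fixes P :: "complex ^ 'n \<Rightarrow> bool"
  assumes "AE z in lborel. P z"
  shows "AE x in lborel. AE \<zeta> in lborel. P (x + axis j \<zeta>)"
proof -
  from AE_E[OF assms] obtain N where N: "{x. \<not> P x} \<subseteq> N" "emeasure lborel N = 0" "N \<in> sets borel"
    by auto
  note [measurable] = N(3)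
  have "(\<integral>\<^sup>+x. (\<integral>\<^sup>+\<zeta>. indicator N (x + axis j \<zeta>) \<partial>lborel) \<partial>lborel)
      = (\<integral>\<^sup>+\<zeta>. (\<integral>\<^sup>+x. indicator N (x + axis j \<zeta>) \<partial>lborel) \<partial>(lborel :: complex measure))"
    by (rule lborel_pair.Fubini') measurable
  also have "\<dots> = 0"
    using nn_integral_lborel_shift[of "indicator N" "axis j _"] N by (simp add: add.commute)
  finally have "AE x in lborel. (\<integral>\<^sup>+\<zeta>. indicator N (x + axis j \<zeta>) \<partial>lborel) = 0"
    by (rule nn_integral_0_iff_AE[THEN iffD1, rotated]) measurable
  then show ?thesis
  proof eventually_elim
    case (elim x)
    then have "AE \<zeta> in lborel. indicator N (x + axis j \<zeta>) = (0::ennreal)"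
      by (rule nn_integral_0_iff_AE[THEN iffD1, rotated]) measurable
    then show ?case
      by eventually_elim (use N(1) in \<open>auto simp: indicator_def split: if_splits\<close>)
  qed
qed

text \<open>
  The integral of the measure of the exceptional set over all translations in the plane is 0,
  but the measure is the same for all of them and the plane has infinite area.
\<close>

lemma AE_from_line_axis:
  fixes P :: "complex ^ 'n \<Rightarrow> bool"
  assumes [measurable]: "Measurable.pred borel P"
    and ae: "AE x in lborel. AE \<zeta> in lborel. P (x + axis j \<zeta>)"
  shows "AE z in lborel. P z"
proof -
  define N where "N = {z. \<not> P z}"
  have [measurable]: "N \<in> sets borel" unfolding N_def by measurable
  have "(\<integral>\<^sup>+x. (\<integral>\<^sup>+\<zeta>. indicator N (x + axis j \<zeta>) \<partial>lborel) \<partial>lborel)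
      = (\<integral>\<^sup>+\<zeta>. (\<integral>\<^sup>+x. indicator N (x + axis j \<zeta>) \<partial>lborel) \<partial>(lborel :: complex measure))"
    by (rule lborel_pair.Fubini') measurable
  also have "\<dots> = (\<integral>\<^sup>+\<zeta>. emeasure lborel N \<partial>(lborel :: complex measure))"
    using nn_integral_lborel_shift[of "indicator N" "axis j _"] by (simp add: add.commute)
  also have "(\<integral>\<^sup>+x. (\<integral>\<^sup>+\<zeta>. indicator N (x + axis j \<zeta>) \<partial>lborel) \<partial>lborel) = 0"
  proof (rule nn_integral_0_iff_AE[THEN iffD2])
    show "AE x in lborel. (\<integral>\<^sup>+\<zeta>. indicator N (x + axis j \<zeta>) \<partial>lborel) = 0"
      using ae
    proof eventually_elim
      case (elim x)
      then have "AE \<zeta> in lborel. indicator N (x + axis j \<zeta>) = (0::ennreal)"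
        by eventually_elim (simp add: N_def)
      then show ?case by (rule nn_integral_0_iff_AE[THEN iffD2, rotated]) measurable
    qed
  qed measurable
  finally have "emeasure lborel N = 0"
    by (simp add: emeasure_lborel_UNIV ennreal_mult_eq_top_iff ennreal_mult_top split: if_splits)
  then show ?thesis
    by (intro AE_I[of _ _ N]) (auto simp: N_def)
qed

lemma AE_lborel_shift:
  fixes d :: complex
  assumes "AE \<zeta> in lborel. P \<zeta>" shows "AE \<zeta> in lborel. P (d + \<zeta>)"
proof -
  have "AE \<zeta> in distr lborel borel ((+) d). P \<zeta>" using assms by (subst lborel_distr_plus)
  then show ?thesis by (rule AE_distrD[rotated]) measurable
qed

definition line :: "'n \<Rightarrow> complex \<Rightarrow> complex ^ 'n \<Rightarrow> complex \<Rightarrow> complex ^ 'n" where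
  "line j c x \<zeta> = x + axis j ((c - x $ j) + \<zeta>)"

lemma line_measurable [measurable]: "line j c x \<in> borel_measurable borel"
  unfolding line_def by measurable

lemma line_nth [simp]: "line j c x \<zeta> $ j = c + \<zeta>"
  by (simp add: line_def)

lemma line_nth_other: "i \<noteq> j \<Longrightarrow> line j c x \<zeta> $ i = x $ i"
  by (simp add: line_def axis_def)

lemma line_axis: "line j c x \<zeta> + axis j w = line j c x (\<zeta> + w)"
  by (simp add: line_def axis_add add_ac)

lemma AE_line:
  assumes "AE z in lborel. P z"
  shows "AE x in lborel. AE \<zeta> in lborel. P (line j c x \<zeta>)"
  using AE_line_axis[OF assms, of j]
  by eventually_elim (unfold line_def, rule AE_lborel_shift)

lemma AE_from_line:
  fixes P :: "complex ^ 'n \<Rightarrow> bool"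
  assumes [measurable]: "Measurable.pred borel P"
    and ae: "AE x in lborel. AE \<zeta> in lborel. P (line j c x \<zeta>)"
  shows "AE z in lborel. P z"
proof (rule AE_from_line_axis)
  show "AE x in lborel. AE \<zeta> in lborel. P (x + axis j \<zeta>)"
    using ae
  proof eventually_elim
    case (elim x)
    from AE_lborel_shift[OF this, of "x $ j - c"] show ?case by (simp add: line_def)
  qed
qed measurable

text \<open>
  The line integral does not depend on \<open>x\<^sub>j\<close>, so its integral over \<open>x\<close> may be infinite; the
  integrable positive factor \<open>poisson 1\<close> of \<open>x\<^sub>j\<close> restores finiteness.
\<close>

lemma AE_line_nn_integral_finite:
  fixes F :: "complex ^ 'n \<Rightarrow> ennreal"
  assumes [measurable]: "F \<in> borel_measurable borel" and fin: "(\<integral>\<^sup>+z. F z \<partial>lborel) < \<infinity>"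
  shows "AE x in lborel. (\<integral>\<^sup>+\<zeta>. F (line j c x \<zeta>) \<partial>lborel) < \<infinity>"
proof -
  have "(\<integral>\<^sup>+y. ennreal (poisson 1 (y $ j)) * (\<integral>\<^sup>+w. F (y + axis j w) \<partial>lborel) \<partial>lborel)
     = cauchy_mass * (\<integral>\<^sup>+y. F y \<partial>lborel)"
    using line_average[of F "\<lambda>w. ennreal (poisson 1 w)" j] by (simp add: nn_integral_poisson)
  also have "\<dots> < \<infinity>" using fin cauchy_mass_finite by (simp add: ennreal_mult_less_top)
  finally have "AE y in lborel. ennreal (poisson 1 (y $ j)) * (\<integral>\<^sup>+w. F (y + axis j w) \<partial>lborel) \<noteq> \<infinity>"
    by (intro nn_integral_PInf_AE) auto
  then show ?thesis
  proof eventually_elim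
    case (elim x)
    have "(cmod (x $ j))\<^sup>2 + 1 > 0" by (intro add_nonneg_pos) auto
    then have "poisson 1 (x $ j) > 0" by (simp add: poisson_def)
    then have "ennreal (poisson 1 (x $ j)) \<noteq> 0" by simp
    then have "(\<integral>\<^sup>+w. F (x + axis j w) \<partial>lborel) < \<infinity>"
      using elim by (auto simp: ennreal_mult_eq_top_iff less_top)
    then show ?case
      unfolding line_def using nn_integral_lborel_shift[of "\<lambda>w. F (x + axis j w)" "c - x $ j"] by simp
  qed
qed

lemma line_potential_line:
  assumes [measurable]: "F \<in> borel_measurable borel"
  shows "line_potential j F (line j c x \<zeta>) = cauchy_potential (\<lambda>\<eta>. F (line j c x \<eta>)) \<zeta>"
proof -
  have "cauchy_potential (\<lambda>\<eta>. F (line j c x \<eta>)) \<zeta> = (\<integral>\<^sup>+w. F (line j c x (\<zeta> + w)) * riesz 1 (\<zeta> - (\<zeta> + w)) \<partial>lborel)"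
    unfolding cauchy_potential_def
    by (rule nn_integral_lborel_shift[symmetric]) measurable
  then show ?thesis
    using riesz_minus_commute[of 1 0] by (simp add: line_potential_def line_axis)
qed

text \<open>
  The conditions of \<open>weight_cutoff\<close> as seen on a line, where \<open>dH\<close> stands for d-bar of \<open>H\<close>.
\<close>

definition slice_cutoff :: "real \<Rightarrow> real \<Rightarrow> real \<Rightarrow> real \<Rightarrow> (nat \<Rightarrow> complex \<Rightarrow> complex) \<Rightarrow> (nat \<Rightarrow> complex \<Rightarrow> complex) \<Rightarrow> bool" where
  "slice_cutoff \<rho> r s C H dH \<longleftrightarrow> 0 \<le> C \<and>
    (\<forall>m w. s \<le> cmod w \<longrightarrow> H m w = 0 \<and> dH m w = 0) \<and>
    (\<forall>m w. \<rho> \<le> cmod w \<longrightarrow> cmod w \<le> r \<longrightarrow> cmod (H m w) = (1 / cmod w) ^ m) \<and>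
    (\<forall>m w. \<rho> \<le> cmod w \<longrightarrow> cmod (H m w) \<le> (1 / cmod w) ^ m) \<and>
    (\<forall>m w. \<rho> \<le> cmod w \<longrightarrow> cmod (dH m w) \<le> C * (1 / cmod w) ^ m) \<and>
    (\<forall>m w. \<rho> \<le> cmod w \<longrightarrow> cmod w < r \<longrightarrow> dH m w = 0) \<and>
    (\<forall>w. cmod (H 0 w) \<le> 1)"

lemma cauchy_potential_sum:
  assumes "\<And>k. k \<in> I \<Longrightarrow> f k \<in> borel_measurable borel"
  shows "(\<Sum>k\<in>I. cauchy_potential (f k) z) = cauchy_potential (\<lambda>w. \<Sum>k\<in>I. f k w) z"
  unfolding cauchy_potential_def sum_distrib_right
  by (rule nn_integral_sum[symmetric]) (use assms in measurable)

text \<open>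
  The Cauchy inequalities \<open>ineq\<close> and \<open>ineq0\<close> are the only link between \<open>f\<close> and its derivatives. Summed
  over the components, \<open>ineq\<close> with \<open>g\<close>, which is controlled by \<open>v \<bar>f\<bar>\<close>, gives the Carleman inequality for
  all \<open>m\<close>, and \<open>ineq0\<close> with the square integrable \<open>h\<close> and \<open>m = 0\<close> gives the a priori bound. Both are
  fed into \<open>plane_unique_continuation\<close>.
\<close>

lemma slice_continuation:
  fixes f g h :: "'m::finite \<Rightarrow> complex \<Rightarrow> complex" and v :: "complex \<Rightarrow> real"
    and H dH :: "real \<Rightarrow> real \<Rightarrow> nat \<Rightarrow> complex \<Rightarrow> complex" and C :: "real \<Rightarrow> real \<Rightarrow> real"
  assumes [measurable]: "\<And>k. f k \<in> borel_measurable borel" "\<And>k. g k \<in> borel_measurable borel"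
      "\<And>k. h k \<in> borel_measurable borel" "v \<in> borel_measurable borel"
      "\<And>r s m. H r s m \<in> borel_measurable borel" "\<And>r s m. dH r s m \<in> borel_measurable borel"
    and M0: "M0 > 0" and \<rho>: "0 < \<rho>" "\<rho> < r0" "r0 < R1" "R1 < R"
    and cut: "\<And>r s. \<rho> < r \<Longrightarrow> r < s \<Longrightarrow> slice_cutoff \<rho> r s (C r s) (H r s) (dH r s)"
    and v: "(\<integral>\<^sup>+z. ennreal ((v z)\<^sup>2) * indicator (cball 0 R) z \<partial>lborel) < \<infinity>"
    and f2: "\<And>k. (\<integral>\<^sup>+z. ennreal ((cmod (f k z))\<^sup>2) * indicator (cball 0 R) z \<partial>lborel) < \<infinity>"
    and h2: "\<And>k. (\<integral>\<^sup>+z. ennreal ((cmod (h k z))\<^sup>2) * indicator (cball 0 R) z \<partial>lborel) < \<infinity>"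
    and gv: "AE z in lborel. z \<in> cball 0 R \<longrightarrow> (\<Sum>k\<in>UNIV. cmod (g k z)) \<le> v z * (\<Sum>k\<in>UNIV. cmod (f k z))"
    and f0: "AE z in lborel. z \<in> ball 0 \<rho> \<longrightarrow> (\<forall>k. f k z = 0)"
    and ineq: "\<And>m r s k. r \<in> \<rat> \<Longrightarrow> s \<in> \<rat> \<Longrightarrow> \<rho> < r \<Longrightarrow> r < s \<Longrightarrow> s < r0 \<Longrightarrow>
      AE z in lborel. ennreal M0 * ennreal (cmod (f k z * H r s m z))
        \<le> cauchy_potential (\<lambda>w. ennreal (cmod (g k w * H r s m w + f k w * dH r s m w)) * indicator (cball 0 R) w) z"
    and ineq0: "\<And>k. AE z in lborel. ennreal M0 * ennreal (cmod (f k z * H r0 R1 0 z))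
        \<le> cauchy_potential (\<lambda>w. ennreal (cmod (h k w * H r0 R1 0 w + f k w * dH r0 R1 0 w)) * indicator (cball 0 R) w) z"
  shows "AE z in lborel. z \<in> ball 0 r0 \<longrightarrow> (\<forall>k. f k z = 0)"
proof -
  define U where "U = (\<lambda>z. \<Sum>k\<in>UNIV. cmod (f k z))"
  \<comment> \<open>Division by \<open>M0\<close> moves the constant of the Cauchy inequality into the potential, and the summand 1 provides \<open>1 \<le> V\<close>.\<close>
  define V where "V = (\<lambda>z. 1 + ennreal (\<bar>v z\<bar> / M0) * indicator (cball 0 R) z)"
  define C1 where "C1 = C r0 R1"
  define G where "G = (\<lambda>z. ennreal ((\<Sum>k\<in>UNIV. cmod (h k z) + C1 * cmod (f k z)) / M0) * indicator (ball 0 R) z)"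
  have [measurable]: "U \<in> borel_measurable borel" "V \<in> borel_measurable borel" "G \<in> borel_measurable borel"
    unfolding U_def V_def G_def by measurable
  have U_nonneg: "U z \<ge> 0" for z by (simp add: U_def sum_nonneg)
  have U0: "AE z in lborel. z \<in> ball 0 \<rho> \<longrightarrow> U z = 0"
    using f0 by eventually_elim (simp add: U_def)
  have prod3: "ennreal (a * (b * c)) = ennreal a * (ennreal b * ennreal c)"
    if "0 \<le> a" "0 \<le> b" "0 \<le> c" for a b c
    using that by (simp add: ennreal_mult)
  have C1: "C1 \<ge> 0" using cut[of r0 R1] \<rho> by (simp add: C1_def slice_cutoff_def)
  \<comment> \<open>The Cauchy inequalities of the components are added, and the sources are replaced by a common majorant \<open>F\<close>.\<close>
  have add_up: "AE z in lborel. ennreal (U z * cmod (K z)) \<le> cauchy_potential F z"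
    if [measurable]: "\<And>k. q k \<in> borel_measurable borel" "K \<in> borel_measurable borel" "L \<in> borel_measurable borel" "F \<in> borel_measurable borel"
    and ineq: "\<And>k. AE z in lborel. ennreal M0 * ennreal (cmod (f k z * K z))
        \<le> cauchy_potential (\<lambda>w. ennreal (cmod (q k w * K w + f k w * L w)) * indicator (cball 0 R) w) z"
    and F: "AE w in lborel. w \<in> cball 0 R \<longrightarrow> ennreal ((\<Sum>k\<in>UNIV. cmod (q k w * K w + f k w * L w)) / M0) \<le> F w"
    for q :: "'m \<Rightarrow> complex \<Rightarrow> complex" and K L F
  proof -
    have "AE z in lborel. \<forall>k\<in>UNIV. ennreal M0 * ennreal (cmod (f k z * K z))
        \<le> cauchy_potential (\<lambda>w. ennreal (cmod (q k w * K w + f k w * L w)) * indicator (cball 0 R) w) z"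
      using ineq by (intro AE_finite_allI) auto
    then show ?thesis
    proof eventually_elim
      case (elim z)
      have "ennreal M0 * ennreal (U z * cmod (K z)) = (\<Sum>k\<in>UNIV. ennreal M0 * ennreal (cmod (f k z * K z)))"
        by (simp add: U_def sum_distrib_left[symmetric] sum_distrib_right norm_mult sum_nonneg)
      also have "\<dots> \<le> (\<Sum>k\<in>UNIV. cauchy_potential (\<lambda>w. ennreal (cmod (q k w * K w + f k w * L w)) * indicator (cball 0 R) w) z)"
        using elim by (intro sum_mono) auto
      also have "\<dots> = cauchy_potential (\<lambda>w. \<Sum>k\<in>UNIV. ennreal (cmod (q k w * K w + f k w * L w)) * indicator (cball 0 R) w) z"
        by (rule cauchy_potential_sum) measurable
      also have "\<dots> \<le> cauchy_potential (\<lambda>w. ennreal M0 * F w) z"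
      proof (rule cauchy_potential_mono_AE)
        show "AE w in lborel. (\<Sum>k\<in>UNIV. ennreal (cmod (q k w * K w + f k w * L w)) * indicator (cball 0 R) w) \<le> ennreal M0 * F w"
          using F
        proof eventually_elim
          case (elim w)
          show ?case
          proof (cases "w \<in> cball 0 R")
            case True
            have "(\<Sum>k\<in>UNIV. ennreal (cmod (q k w * K w + f k w * L w)) * indicator (cball 0 R) w)
                = ennreal M0 * ennreal ((\<Sum>k\<in>UNIV. cmod (q k w * K w + f k w * L w)) / M0)"
              using True M0 by (simp add: ennreal_mult[symmetric] sum_nonneg)
            also have "\<dots> \<le> ennreal M0 * F w" using elim True by (intro mult_left_mono) auto
            finally show ?thesis .
          qed simp
        qed
      qed
      also have "\<dots> = ennreal M0 * cauchy_potential F z" by (rule cauchy_potential_cmult) measurable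
      finally show ?case using M0 by (subst (asm) ennreal_mult_le_mult_iff) auto
    qed
  qed
  have "AE z in lborel. z \<in> ball 0 r0 \<longrightarrow> ennreal (U z) = 0"
  proof (rule plane_unique_continuation[where V = V and G = G and R = R and \<rho> = \<rho> and C = "\<lambda>r s. ennreal (C r s / M0)"])
    show "1 \<le> V z" for z by (simp add: V_def)
    have V2: "(V z)\<^sup>2 * indicator (ball 0 R) z
        \<le> 2 * indicator (ball 0 R) z + ennreal (2 / M0\<^sup>2) * (ennreal ((v z)\<^sup>2) * indicator (cball 0 R) z)" for z
    proof (cases "z \<in> ball 0 R")
      case True
      have "(V z)\<^sup>2 \<le> 2 * 1\<^sup>2 + 2 * (ennreal (\<bar>v z\<bar> / M0) * indicator (cball 0 R) z)\<^sup>2"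
        unfolding V_def by (rule ennreal_add_sq_le)
      also have "(ennreal (\<bar>v z\<bar> / M0) * indicator (cball 0 R) z)\<^sup>2 = ennreal ((v z)\<^sup>2 / M0\<^sup>2)"
        using True M0 by (simp add: ennreal_power power_divide)
      also have "2 * ennreal ((v z)\<^sup>2 / M0\<^sup>2) = ennreal (2 / M0\<^sup>2) * ennreal ((v z)\<^sup>2)"
        using M0 by (subst ennreal_mult[symmetric], simp, simp) (subst ennreal_numeral[symmetric], subst ennreal_mult[symmetric], auto)
      finally show ?thesis using True by simp
    qed simp
    have "(\<integral>\<^sup>+z. (V z)\<^sup>2 * indicator (ball 0 R) z \<partial>lborel)
        \<le> (\<integral>\<^sup>+z. 2 * indicator (ball 0 R) z + ennreal (2 / M0\<^sup>2) * (ennreal ((v z)\<^sup>2) * indicator (cball 0 R) z) \<partial>lborel)"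
      by (intro nn_integral_mono V2)
    also have "\<dots> = 2 * emeasure lborel (ball (0::complex) R) + ennreal (2 / M0\<^sup>2) * (\<integral>\<^sup>+z. ennreal ((v z)\<^sup>2) * indicator (cball 0 R) z \<partial>lborel)"
      by (subst nn_integral_add) (auto simp: nn_integral_cmult nn_integral_cmult_indicator)
    also have "\<dots> < \<infinity>"
      using v emeasure_lborel_ball_finite[of "0::complex" R] by (simp add: ennreal_mult_less_top)
    finally show "(\<integral>\<^sup>+z. (V z)\<^sup>2 * indicator (ball 0 R) z \<partial>lborel) < \<infinity>" .
    show "G z = 0" if "z \<notin> ball 0 R" for z using that by (simp add: G_def)
    show "ennreal (C r s / M0) < \<infinity>" for r s by simp
    show "AE z in lborel. z \<in> ball 0 \<rho> \<longrightarrow> ennreal (U z) = 0"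
      using U0 by eventually_elim simp
    show "(\<integral>\<^sup>+z. (G z)\<^sup>2 \<partial>lborel) < \<infinity>"
    proof -
      define c where "c = 2 * real CARD('m) / M0\<^sup>2"
      let ?s = "\<lambda>z. \<Sum>k\<in>UNIV. cmod (h k z) + C1 * cmod (f k z)"
      let ?t = "\<lambda>z. \<Sum>k\<in>UNIV. 2 * (cmod (h k z))\<^sup>2 + 2 * (C1 * cmod (f k z))\<^sup>2"
      let ?q = "\<lambda>z. \<Sum>k\<in>UNIV. c * (cmod (h k z))\<^sup>2 + c * C1\<^sup>2 * (cmod (f k z))\<^sup>2"
      let ?p = "\<lambda>k z. ennreal c * (ennreal ((cmod (h k z))\<^sup>2) * indicator (cball 0 R) z)
          + ennreal (c * C1\<^sup>2) * (ennreal ((cmod (f k z))\<^sup>2) * indicator (cball 0 R) z)"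
      have c: "c \<ge> 0" by (simp add: c_def)
      have "(G z)\<^sup>2 \<le> (\<Sum>k\<in>UNIV. ?p k z)" for z
      proof (cases "z \<in> ball 0 R")
        case True
        have "(?s z)\<^sup>2
            \<le> real CARD('m) * (\<Sum>k\<in>UNIV. (cmod (h k z) + C1 * cmod (f k z))\<^sup>2)"
          using sum_squared_le_sum_of_squares[of "\<lambda>k. cmod (h k z) + C1 * cmod (f k z)" "UNIV :: 'm set"] by (simp add: mult.commute)
        also have "\<dots> \<le> real CARD('m) * (?t z)"
        proof (intro mult_left_mono sum_mono)
          show "(cmod (h k z) + C1 * cmod (f k z))\<^sup>2 \<le> 2 * (cmod (h k z))\<^sup>2 + 2 * (C1 * cmod (f k z))\<^sup>2" for k
            using sum_squares_bound[of "cmod (h k z)" "C1 * cmod (f k z)"] by (simp add: power2_sum)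
        qed simp
        finally have le: "((?s z) / M0)\<^sup>2
            \<le> (?q z)"
        proof -
          assume S: "(?s z)\<^sup>2
            \<le> real CARD('m) * (?t z)"
          have "((?s z) / M0)\<^sup>2
              \<le> real CARD('m) * (?t z) / M0\<^sup>2"
            unfolding power_divide by (intro divide_right_mono S) simp
          also have "\<dots> = (?q z)"
            unfolding sum_distrib_left sum_divide_distrib
            by (intro sum.cong refl) (simp add: c_def power_mult_distrib add_divide_distrib algebra_simps)
          finally show ?thesis .
        qed
        have "(G z)\<^sup>2 = ennreal (((?s z) / M0)\<^sup>2)"
          using True M0 C1 by (simp add: G_def ennreal_power sum_nonneg)
        also have "\<dots> \<le> ennreal (?q z)"
          by (rule ennreal_leI[OF le])
        also have "\<dots> = (\<Sum>k\<in>UNIV. ennreal (c * (cmod (h k z))\<^sup>2 + c * C1\<^sup>2 * (cmod (f k z))\<^sup>2))"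
          using c by (subst sum_ennreal) auto
        also have "\<dots> = (\<Sum>k\<in>UNIV. ?p k z)"
          using c True by (intro sum.cong) (auto simp: ennreal_mult)
        finally show ?thesis .
      qed (simp add: G_def)
      then have "(\<integral>\<^sup>+z. (G z)\<^sup>2 \<partial>lborel) \<le> (\<integral>\<^sup>+z. (\<Sum>k\<in>UNIV. ?p k z) \<partial>lborel)"
        by (intro nn_integral_mono)
      also have "\<dots> = (\<Sum>k\<in>UNIV. ennreal c * (\<integral>\<^sup>+z. ennreal ((cmod (h k z))\<^sup>2) * indicator (cball 0 R) z \<partial>lborel)
          + ennreal (c * C1\<^sup>2) * (\<integral>\<^sup>+z. ennreal ((cmod (f k z))\<^sup>2) * indicator (cball 0 R) z \<partial>lborel))"
        by (simp add: nn_integral_sum nn_integral_add nn_integral_cmult)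
      also have "\<dots> < \<infinity>"
        using f2 h2 by (simp add: ennreal_mult_eq_top_iff ennreal_mult_less_top less_top[symmetric])
      finally show ?thesis .
    qed
    let ?S = "\<lambda>w. \<Sum>k\<in>UNIV. cmod (h k w * H r0 R1 0 w + f k w * dH r0 R1 0 w)"
    have cut0: "slice_cutoff \<rho> r0 R1 C1 (H r0 R1) (dH r0 R1)" using cut[of r0 R1] \<rho> by (simp add: C1_def)
    have "AE z in lborel. ennreal (U z * cmod (H r0 R1 0 z)) \<le> cauchy_potential G z"
    proof (rule add_up[OF _ _ _ _ ineq0])
      show "AE w in lborel. w \<in> cball 0 R \<longrightarrow>
          ennreal (?S w / M0) \<le> G w"
        using f0
      proof eventually_elim
        case (elim w)
        show ?case
        proof (cases "R1 \<le> cmod w")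
          case True
          then show ?thesis using cut0 by (simp add: slice_cutoff_def)
        next
          case False
          have "cmod (h k w * H r0 R1 0 w + f k w * dH r0 R1 0 w) \<le> cmod (h k w) + C1 * cmod (f k w)" for k
          proof (rule order_trans[OF norm_triangle_ineq add_mono])
            show "cmod (h k w * H r0 R1 0 w) \<le> cmod (h k w)"
              using cut0 by (simp add: norm_mult slice_cutoff_def mult_left_le)
            show "cmod (f k w * dH r0 R1 0 w) \<le> C1 * cmod (f k w)"
            proof (cases "cmod w < \<rho>")
              case True then show ?thesis using elim by simp
            next
              case False
              then have "cmod (dH r0 R1 0 w) \<le> C1 * (1 / cmod w) ^ 0"
                using cut0 unfolding slice_cutoff_def by (meson not_less)
              then show ?thesis by (simp add: norm_mult mult_right_mono mult.commute[of _ "cmod (dH r0 R1 0 w)"])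
            qed
          qed
          then have "?S w / M0
              \<le> (\<Sum>k\<in>UNIV. cmod (h k w) + C1 * cmod (f k w)) / M0"
            using M0 by (intro divide_right_mono sum_mono) auto
          then show ?thesis using False \<rho> by (simp add: G_def ennreal_leI)
        qed
      qed
    qed measurable
    then show "AE z in lborel. z \<in> ball 0 r0 \<longrightarrow> ennreal (U z) \<le> cauchy_potential G z"
      using U0
    proof eventually_elim
      case (elim z)
      show ?case
      proof (cases "cmod z < \<rho>")
        case False
        then have "cmod z < r0 \<Longrightarrow> cmod (H r0 R1 0 z) = (1 / cmod z) ^ 0"
          using cut0 unfolding slice_cutoff_def by (meson not_less less_imp_le)
        then show ?thesis using elim by (cases "cmod z < r0") auto
      qed (use elim in simp)
    qed
    fix m :: nat and r s :: real
    assume rs: "r \<in> \<rat>" "s \<in> \<rat>" "\<rho> < r" "r < s" "s < r0"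
    let ?S = "\<lambda>w. \<Sum>k\<in>UNIV. cmod (g k w * H r s m w + f k w * dH r s m w)"
    note ct = cut[OF rs(3,4), unfolded slice_cutoff_def]
    let ?F = "carleman_source (\<lambda>w. ennreal (U w)) V (ennreal (C r s / M0)) r s m"
    have [measurable]: "?F \<in> borel_measurable borel" unfolding carleman_source_def by measurable
    have "AE z in lborel. ennreal (U z * cmod (H r s m z)) \<le> cauchy_potential ?F z"
    proof (rule add_up[OF _ _ _ _ ineq[OF rs]])
      show "AE w in lborel. w \<in> cball 0 R \<longrightarrow>
          ennreal (?S w / M0) \<le> ?F w"
        using gv U0
      proof eventually_elim
        case (elim w)
        show ?case
        proof
          assume w: "w \<in> cball 0 R"
          have VM: "ennreal (\<bar>v w\<bar> / M0) \<le> V w" using w by (simp add: V_def)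
          have "?S w
              \<le> (\<Sum>k\<in>UNIV. cmod (g k w) * cmod (H r s m w) + cmod (f k w) * cmod (dH r s m w))"
            by (intro sum_mono order_trans[OF norm_triangle_ineq]) (simp add: norm_mult)
          also have "\<dots> = (\<Sum>k\<in>UNIV. cmod (g k w)) * cmod (H r s m w) + U w * cmod (dH r s m w)"
            by (simp add: U_def sum.distrib sum_distrib_right)
          also have "\<dots> \<le> (\<bar>v w\<bar> * U w) * cmod (H r s m w) + U w * cmod (dH r s m w)"
          proof (intro add_right_mono mult_right_mono)
            have "(\<Sum>k\<in>UNIV. cmod (g k w)) \<le> v w * U w" using elim(1) w by (simp add: U_def)
            also have "\<dots> \<le> \<bar>v w\<bar> * U w" by (intro mult_right_mono U_nonneg) auto
            finally show "(\<Sum>k\<in>UNIV. cmod (g k w)) \<le> \<bar>v w\<bar> * U w" .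
          qed auto
          finally have "?S w / M0
              \<le> ((\<bar>v w\<bar> * U w) * cmod (H r s m w) + U w * cmod (dH r s m w)) / M0"
            using M0 by (intro divide_right_mono) auto
          also have "\<dots> = (\<bar>v w\<bar> / M0 * cmod (H r s m w) + cmod (dH r s m w) / M0) * U w"
            by (simp add: add_divide_distrib algebra_simps)
          finally have le: "?S w / M0
              \<le> (\<bar>v w\<bar> / M0 * cmod (H r s m w) + cmod (dH r s m w) / M0) * U w" .
          \<comment> \<open>In turn: zeros of \<open>f\<close>, the unmodified weight, the transition of the cutoff, and the region beyond the cutoff.\<close>
          consider "cmod w < \<rho>" | "\<rho> \<le> cmod w" "cmod w < r" | "r \<le> cmod w" "cmod w < s" | "s \<le> cmod w"
            by linarith
          then show "ennreal (?S w / M0) \<le> ?F w"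
          proof cases
            case 1
            then have "U w = 0" using elim(2) by simp
            then have "?S w / M0 \<le> 0" using le by simp
            then show ?thesis by (simp add: ennreal_neg)
          next
            case 2
            then have "cmod (H r s m w) = (1 / cmod w) ^ m" "dH r s m w = 0" using ct by auto
            then have "ennreal (?S w / M0)
                \<le> ennreal ((1 / cmod w) ^ m * ((\<bar>v w\<bar> / M0) * U w))"
              using le by (intro ennreal_leI) (simp add: mult_ac)
            also have "\<dots> = ennreal ((1 / cmod w) ^ m) * (ennreal (\<bar>v w\<bar> / M0) * ennreal (U w))"
              by (rule prod3) (use M0 U_nonneg in auto)
            also have "\<dots> \<le> ennreal ((1 / cmod w) ^ m) * (V w * ennreal (U w))"
              by (intro mult_left_mono mult_right_mono VM) auto
            finally show ?thesis using 2 by (simp add: carleman_source_def)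
          next
            case 3
            have p: "(1 / cmod w) ^ m \<le> (1 / r) ^ m"
              using 3 rs \<rho> by (intro power_mono divide_left_mono) (auto intro!: mult_pos_pos)
            have C: "C r s \<ge> 0" using ct by simp
            have "\<rho> \<le> cmod w" using 3 rs by simp
            then have "cmod (H r s m w) \<le> (1 / cmod w) ^ m" "cmod (dH r s m w) \<le> C r s * (1 / cmod w) ^ m" using ct by auto
            then have "cmod (H r s m w) \<le> (1 / r) ^ m" "cmod (dH r s m w) \<le> C r s * (1 / r) ^ m"
              using p mult_left_mono[OF p C] by linarith+
            then have "(\<bar>v w\<bar> / M0 * cmod (H r s m w) + cmod (dH r s m w) / M0) * U w
                \<le> (\<bar>v w\<bar> / M0 * (1 / r) ^ m + C r s * (1 / r) ^ m / M0) * U w"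
              using M0 by (intro mult_right_mono add_mono mult_left_mono divide_right_mono U_nonneg) auto
            also have "\<dots> = (1 / r) ^ m * ((\<bar>v w\<bar> / M0 + C r s / M0) * U w)" by (simp add: algebra_simps)
            finally have "ennreal (?S w / M0)
                \<le> ennreal ((1 / r) ^ m * ((\<bar>v w\<bar> / M0 + C r s / M0) * U w))"
              using le by (intro ennreal_leI) linarith
            also have "\<dots> = ennreal ((1 / r) ^ m) * (ennreal (\<bar>v w\<bar> / M0 + C r s / M0) * ennreal (U w))"
              by (rule prod3) (use M0 U_nonneg C rs \<rho> in auto)
            also have "ennreal (\<bar>v w\<bar> / M0 + C r s / M0) = ennreal (\<bar>v w\<bar> / M0) + ennreal (C r s / M0)"
              by (rule ennreal_plus) (use M0 C in auto)
            also have "ennreal ((1 / r) ^ m) * ((ennreal (\<bar>v w\<bar> / M0) + ennreal (C r s / M0)) * ennreal (U w))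
                \<le> ennreal ((1 / r) ^ m) * ((V w + ennreal (C r s / M0)) * ennreal (U w))"
              by (intro mult_left_mono mult_right_mono add_right_mono VM) auto
            finally show ?thesis using 3 by (simp add: carleman_source_def)
          next
            case 4
            then have "H r s m w = 0" "dH r s m w = 0" using ct by auto
            then show ?thesis by simp
          qed
        qed
      qed
    qed measurable
    then show "AE z in lborel. z \<in> ball 0 r \<longrightarrow> ennreal ((1 / cmod z) ^ m) * ennreal (U z) \<le> cauchy_potential ?F z"
      using U0
    proof eventually_elim
      case (elim z)
      show ?case
      proof (cases "cmod z < \<rho>")
        case False
        then have "cmod z < r \<Longrightarrow> cmod (H r s m z) = (1 / cmod z) ^ m" using ct by auto
        moreover have "ennreal ((1 / cmod z) ^ m) * ennreal (U z) = ennreal (U z * (1 / cmod z) ^ m)"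
          using U_nonneg by (simp add: ennreal_mult mult.commute)
        ultimately show ?thesis using elim(1) by (cases "cmod z < r") auto
      qed (use elim in simp)
    qed
  qed (use \<rho> in auto)
  then show ?thesis
  proof eventually_elim
    case (elim z)
    then show ?case using U_nonneg[of z] by (auto simp: U_def ennreal_eq_0_iff sum_nonneg_eq_0_iff sum_nonneg
      dest: antisym)
  qed
qed

section \<open>Propagation of zeros in polydiscs\<close>

definition weak_dbar_test :: "(complex ^ 'n) set \<Rightarrow> 'n \<Rightarrow> (complex ^ 'n \<Rightarrow> complex) \<Rightarrow> (complex ^ 'n \<Rightarrow> complex) \<Rightarrow> bool" where
  "weak_dbar_test \<Omega> j f g \<longleftrightarrow>
     (\<forall>\<phi>. test_function \<Omega> \<phi> \<longrightarrow> (\<integral>x. f x * dbar j \<phi> x \<partial>lborel) = - (\<integral>x. g x * \<phi> x \<partial>lborel))"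

lemma weight_cutoff_line:
  assumes W: "weight_cutoff j c \<rho> r s C H"
  shows "slice_cutoff \<rho> r s C (\<lambda>m \<zeta>. H m (line j c x \<zeta>)) (\<lambda>m \<zeta>. dbar j (H m) (line j c x \<zeta>))"
proof -
  let ?l = "line j c x"
  note W = W[unfolded weight_cutoff_def]
  have l: "?l w $ j - c = w" for w by simp
  show ?thesis
    unfolding slice_cutoff_def
  proof (intro conjI allI impI)
    show "0 \<le> C" using W by blast
    show "cmod (H 0 (?l w)) \<le> 1" for w using W by blast
    fix m w
    show "H m (?l w) = 0" "dbar j (H m) (?l w) = 0" if "s \<le> cmod w"
    proof -
      have "\<forall>m x. s \<le> cmod (x $ j - c) \<longrightarrow> H m x = 0 \<and> dbar j (H m) x = 0" using W by blast
      from this[rule_format, of "?l w" m] that show "H m (?l w) = 0" "dbar j (H m) (?l w) = 0" by simp_all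
    qed
    show "cmod (H m (?l w)) = (1 / cmod w) ^ m" if "\<rho> \<le> cmod w" "cmod w \<le> r"
    proof -
      have "\<forall>m x. \<rho> \<le> cmod (x $ j - c) \<longrightarrow> cmod (x $ j - c) \<le> r \<longrightarrow> cmod (H m x) = (1 / cmod (x $ j - c)) ^ m"
        using W by blast
      from this[rule_format, of "?l w" m] that show ?thesis by simp
    qed
    assume w: "\<rho> \<le> cmod w"
    have "\<forall>m x. \<rho> \<le> cmod (x $ j - c) \<longrightarrow> cmod (H m x) \<le> (1 / cmod (x $ j - c)) ^ m" using W by blast
    from this[rule_format, of "?l w" m] w show "cmod (H m (?l w)) \<le> (1 / cmod w) ^ m" by simp
    have "\<forall>m x. \<rho> \<le> cmod (x $ j - c) \<longrightarrow> cmod (dbar j (H m) x) \<le> C * (1 / cmod (x $ j - c)) ^ m" using W by blast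
    from this[rule_format, of "?l w" m] w show "cmod (dbar j (H m) (?l w)) \<le> C * (1 / cmod w) ^ m" by simp
    assume w': "cmod w < r"
    have "\<forall>m x. \<rho> \<le> cmod (x $ j - c) \<longrightarrow> cmod (x $ j - c) < r \<longrightarrow> dbar j (H m) x = 0" using W by blast
    from this[rule_format, of "?l w" m] w w' show "dbar j (H m) (?l w) = 0" by simp
  qed
qed

text \<open>
  For almost every line in direction \<open>j\<close> all the hypotheses of \<open>slice_continuation\<close> hold at once,
  because the Cauchy inequalities are used for countably many weights only.
\<close>

lemma coordinate_propagation:
  fixes f g h :: "'m::finite \<Rightarrow> complex ^ 'n \<Rightarrow> complex" and v :: "complex ^ 'n \<Rightarrow> real"
    and c :: "complex ^ 'n" and \<tau> :: "'n \<Rightarrow> real"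
  assumes [measurable]: "\<And>k. f k \<in> borel_measurable borel" "\<And>k. g k \<in> borel_measurable borel"
      "\<And>k. h k \<in> borel_measurable borel" "v \<in> borel_measurable borel"
    and wg: "\<And>k. weak_dbar_test \<Omega> j (f k) (g k)" and wh: "\<And>k. weak_dbar_test \<Omega> j (f k) (h k)"
    and K: "polydisc c R \<subseteq> \<Omega>"
    and int: "\<And>k. integrable lborel (\<lambda>x. indicator (polydisc c R) x *\<^sub>R f k x)"
      "\<And>k. integrable lborel (\<lambda>x. indicator (polydisc c R) x *\<^sub>R g k x)"
      "\<And>k. integrable lborel (\<lambda>x. indicator (polydisc c R) x *\<^sub>R h k x)"
    and v2: "(\<integral>\<^sup>+x. ennreal ((v x)\<^sup>2) * indicator (polydisc c R) x \<partial>lborel) < \<infinity>"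
    and f2: "\<And>k. (\<integral>\<^sup>+x. ennreal ((cmod (f k x))\<^sup>2) * indicator (polydisc c R) x \<partial>lborel) < \<infinity>"
    and h2: "\<And>k. (\<integral>\<^sup>+x. ennreal ((cmod (h k x))\<^sup>2) * indicator (polydisc c R) x \<partial>lborel) < \<infinity>"
    and gv: "AE x in lborel. x \<in> polydisc c R \<longrightarrow> (\<Sum>k\<in>UNIV. cmod (g k x)) \<le> v x * (\<Sum>k\<in>UNIV. cmod (f k x))"
    and \<rho>: "0 < \<rho>" "\<rho> < r0" "r0 < R" and \<tau>: "\<And>i. \<tau> i \<le> r0"
    and f0: "AE x in lborel. cmod (x $ j - c $ j) < \<rho> \<and> (\<forall>i. i \<noteq> j \<longrightarrow> cmod (x $ i - c $ i) < \<tau> i) \<longrightarrow> (\<forall>k. f k x = 0)"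
  shows "AE x in lborel. cmod (x $ j - c $ j) < r0 \<and> (\<forall>i. i \<noteq> j \<longrightarrow> cmod (x $ i - c $ i) < \<tau> i) \<longrightarrow> (\<forall>k. f k x = 0)"
proof -
  let ?K = "polydisc c R"
  \<comment> \<open>\<open>R1\<close> leaves room for the cutoff that is used in the a priori bound on the disc of radius \<open>r0\<close>.\<close>
  define R1 where "R1 = (r0 + R) / 2"
  have R1: "r0 < R1" "R1 < R" using \<rho> by (auto simp: R1_def)
  obtain M0 where M0: "cauchy_mass = ennreal M0" "M0 \<ge> 0" using cauchy_mass_finite by (cases cauchy_mass) auto
  then have M0_pos: "M0 > 0" using cauchy_mass_pos by (auto simp: less_le)
  have "\<forall>r s. \<exists>C H. \<rho> < r \<and> r < s \<longrightarrow> weight_cutoff j (c $ j) \<rho> r s C H"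
    using weight_cutoff_exists[OF \<rho>(1)] by blast
  then obtain C and H :: "real \<Rightarrow> real \<Rightarrow> nat \<Rightarrow> complex ^ 'n \<Rightarrow> complex"
    where CH: "\<And>r s. \<rho> < r \<Longrightarrow> r < s \<Longrightarrow> weight_cutoff j (c $ j) \<rho> r s (C r s) (H r s)"
    by metis
  \<comment> \<open>The value 0 for other radii makes \<open>H' r s m\<close> smooth for all \<open>r\<close> and \<open>s\<close>.\<close>
  define H' where "H' = (\<lambda>r s. if \<rho> < r \<and> r < s then H r s else (\<lambda>_ _. 0))"
  have good: "weight_cutoff j (c $ j) \<rho> r s (C r s) (H' r s)" if "\<rho> < r" "r < s" for r s
    using CH[OF that] that by (simp add: H'_def)
  have sm: "smooth (H' r s m)" for r s m
    using good[of r s] by (cases "\<rho> < r \<and> r < s") (auto simp: H'_def weight_cutoff_def smooth_const)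
  have [measurable]: "H' r s m \<in> borel_measurable borel" "dbar j (H' r s m) \<in> borel_measurable borel" for r s m
    by (intro borel_measurable_continuous_onI smooth_continuous continuous_on_dbar sm)+
  define pot where "pot = (\<lambda>q r s m k. \<lambda>x. ennreal (cmod (q k x * H' r s m x + f k x * dbar j (H' r s m) x)) * indicator ?K x)"
  have pw: "AE z in lborel. (\<forall>i. i \<noteq> j \<longrightarrow> cmod (z $ i - c $ i) < t) \<longrightarrow>
      cauchy_mass * ennreal (cmod (f k z * H' r s m z)) \<le> line_potential j (pot q r s m k) z"
    if "weak_dbar_test \<Omega> j (f k) (q k)" "integrable lborel (\<lambda>x. indicator (polydisc c R) x *\<^sub>R q k x)"
      "\<rho> < r" "r < s" "s \<le> t" "t < R"
    for q :: "'m \<Rightarrow> complex ^ 'n \<Rightarrow> complex" and r s t m k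
    unfolding pot_def
  proof (rule weak_dbar_cauchy_inequality[where \<Omega> = \<Omega>])
    show "(\<integral>x. f k x * dbar j \<phi> x \<partial>lborel) = - (\<integral>x. q k x * \<phi> x \<partial>lborel)" if "test_function \<Omega> \<phi>" for \<phi>
      using \<open>weak_dbar_test \<Omega> j (f k) (q k)\<close> that by (simp add: weak_dbar_test_def)
    show "H' r s m x = 0" if "cmod (x $ j - c $ j) > t" for x
      using good[OF \<open>\<rho> < r\<close> \<open>r < s\<close>] \<open>s \<le> t\<close> that unfolding weight_cutoff_def by (meson less_imp_le order_trans)
  qed (use K int that sm \<rho> in auto)
  have A: "AE z in lborel. \<forall>m::nat. \<forall>p q::rat. \<forall>k\<in>(UNIV :: 'm set).
      \<rho> < of_rat p \<and> of_rat p < (of_rat q :: real) \<and> of_rat q < r0 \<longrightarrow> (\<forall>i. i \<noteq> j \<longrightarrow> cmod (z $ i - c $ i) < r0) \<longrightarrow>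
      cauchy_mass * ennreal (cmod (f k z * H' (of_rat p) (of_rat q) m z)) \<le> line_potential j (pot g (of_rat p) (of_rat q) m k) z"
    unfolding AE_all_countable
  proof (intro allI AE_finite_allI finite)
    fix m :: nat and p q :: rat and k :: 'm
    show "AE z in lborel. \<rho> < of_rat p \<and> of_rat p < (of_rat q :: real) \<and> of_rat q < r0 \<longrightarrow> (\<forall>i. i \<noteq> j \<longrightarrow> cmod (z $ i - c $ i) < r0) \<longrightarrow>
      cauchy_mass * ennreal (cmod (f k z * H' (of_rat p) (of_rat q) m z)) \<le> line_potential j (pot g (of_rat p) (of_rat q) m k) z"
    proof (cases "\<rho> < of_rat p \<and> of_rat p < (of_rat q :: real) \<and> of_rat q < r0")
      case True
      then show ?thesis using pw[of k g "of_rat p" "of_rat q" r0 m, OF wg int(2)] \<rho> by simp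
    qed auto
  qed
  have B: "AE z in lborel. \<forall>k\<in>(UNIV :: 'm set). (\<forall>i. i \<noteq> j \<longrightarrow> cmod (z $ i - c $ i) < R1) \<longrightarrow>
      cauchy_mass * ennreal (cmod (f k z * H' r0 R1 0 z)) \<le> line_potential j (pot h r0 R1 0 k) z"
    using \<rho> R1 by (intro AE_finite_allI finite pw wh int) auto
  have fin: "AE x in lborel. (\<integral>\<^sup>+\<zeta>. ennreal ((F (line j (c $ j) x \<zeta>))\<^sup>2) * indicator ?K (line j (c $ j) x \<zeta>) \<partial>lborel) < \<infinity>"
    if [measurable]: "F \<in> borel_measurable borel"
      and "(\<integral>\<^sup>+x. ennreal ((F x)\<^sup>2) * indicator ?K x \<partial>lborel) < \<infinity>" for F :: "complex ^ 'n \<Rightarrow> real"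
    using that(2) by (intro AE_line_nn_integral_finite) auto
  have "AE x in lborel. \<forall>k\<in>(UNIV :: 'm set). (\<integral>\<^sup>+\<zeta>. ennreal ((cmod (f k (line j (c $ j) x \<zeta>)))\<^sup>2) * indicator ?K (line j (c $ j) x \<zeta>) \<partial>lborel) < \<infinity>"
    by (intro AE_finite_allI finite fin f2) measurable
  moreover have "AE x in lborel. \<forall>k\<in>(UNIV :: 'm set). (\<integral>\<^sup>+\<zeta>. ennreal ((cmod (h k (line j (c $ j) x \<zeta>)))\<^sup>2) * indicator ?K (line j (c $ j) x \<zeta>) \<partial>lborel) < \<infinity>"
    by (intro AE_finite_allI finite fin h2) measurable
  moreover note fin[OF assms(4) v2] AE_line[OF gv, of j "c $ j"] AE_line[OF f0, of j "c $ j"]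
    AE_line[OF A, of j "c $ j"] AE_line[OF B, of j "c $ j"]
  ultimately have "AE x in lborel. AE \<zeta> in lborel. cmod (line j (c $ j) x \<zeta> $ j - c $ j) < r0 \<and>
      (\<forall>i. i \<noteq> j \<longrightarrow> cmod (line j (c $ j) x \<zeta> $ i - c $ i) < \<tau> i) \<longrightarrow> (\<forall>k. f k (line j (c $ j) x \<zeta>) = 0)"
  proof (eventually_elim, goal_cases)
    case (1 x)
    let ?l = "line j (c $ j) x"
    show ?case
    proof (cases "\<forall>i. i \<noteq> j \<longrightarrow> cmod (x $ i - c $ i) < \<tau> i")
      case False
      then show ?thesis by (intro AE_I2) (auto simp: line_nth_other)
    next
      case True
      then have xr0: "cmod (x $ i - c $ i) < r0" if "i \<noteq> j" for i using \<tau>[of i] that by (meson less_le_trans)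
      have lK: "?l \<zeta> \<in> ?K \<longleftrightarrow> \<zeta> \<in> cball 0 R" for \<zeta>
      proof
        assume "?l \<zeta> \<in> ?K"
        then have "cmod (?l \<zeta> $ j - c $ j) \<le> R" unfolding polydisc_def by blast
        then show "\<zeta> \<in> cball 0 R" by simp
      next
        assume z: "\<zeta> \<in> cball 0 R"
        have "cmod (?l \<zeta> $ i - c $ i) \<le> R" for i
        proof (cases "i = j")
          case False
          then show ?thesis using xr0[OF False] \<rho> by (simp add: line_nth_other)
        qed (use z in simp)
        then show "?l \<zeta> \<in> ?K" by (simp add: polydisc_def)
      qed
      then have iK: "indicator ?K (?l \<zeta>) = (indicator (cball 0 R) \<zeta> :: ennreal)" for \<zeta> by (simp add: indicator_def)
      have lp: "line_potential j (pot q r s m k) (?l \<zeta>) = cauchy_potential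
          (\<lambda>w. ennreal (cmod (q k (?l w) * H' r s m (?l w) + f k (?l w) * dbar j (H' r s m) (?l w))) * indicator (cball 0 R) w) \<zeta>"
        if [measurable]: "\<And>k. q k \<in> borel_measurable borel" for q r s m k \<zeta>
      proof -
        have [measurable]: "pot q r s m k \<in> borel_measurable borel" unfolding pot_def by measurable
        show ?thesis by (subst line_potential_line) (auto simp: pot_def iK)
      qed
      have "AE \<zeta> in lborel. \<zeta> \<in> ball 0 r0 \<longrightarrow> (\<forall>k. f k (?l \<zeta>) = 0)"
      proof (rule slice_continuation[where f = "\<lambda>k \<zeta>. f k (?l \<zeta>)" and g = "\<lambda>k \<zeta>. g k (?l \<zeta>)" and h = "\<lambda>k \<zeta>. h k (?l \<zeta>)"
            and v = "\<lambda>\<zeta>. v (?l \<zeta>)" and H = "\<lambda>r s m \<zeta>. H' r s m (?l \<zeta>)" and dH = "\<lambda>r s m \<zeta>. dbar j (H' r s m) (?l \<zeta>)"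
            and C = C and R = R and ?R1.0 = R1 and \<rho> = \<rho> and ?M0.0 = M0])
        show "slice_cutoff \<rho> r s (C r s) (\<lambda>m \<zeta>. H' r s m (?l \<zeta>)) (\<lambda>m \<zeta>. dbar j (H' r s m) (?l \<zeta>))"
          if "\<rho> < r" "r < s" for r s
          by (rule weight_cutoff_line[OF good[OF that]])
        show "(\<integral>\<^sup>+\<zeta>. ennreal ((v (?l \<zeta>))\<^sup>2) * indicator (cball 0 R) \<zeta> \<partial>lborel) < \<infinity>"
          using 1(3) by (simp add: iK)
        show "(\<integral>\<^sup>+\<zeta>. ennreal ((cmod (f k (?l \<zeta>)))\<^sup>2) * indicator (cball 0 R) \<zeta> \<partial>lborel) < \<infinity>" for k
          using 1(1) by (simp add: iK)
        show "(\<integral>\<^sup>+\<zeta>. ennreal ((cmod (h k (?l \<zeta>)))\<^sup>2) * indicator (cball 0 R) \<zeta> \<partial>lborel) < \<infinity>" for k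
          using 1(2) by (simp add: iK)
        show "AE \<zeta> in lborel. \<zeta> \<in> cball 0 R \<longrightarrow> (\<Sum>k\<in>UNIV. cmod (g k (?l \<zeta>))) \<le> v (?l \<zeta>) * (\<Sum>k\<in>UNIV. cmod (f k (?l \<zeta>)))"
          using 1(4) by (simp only: lK)
        show "AE \<zeta> in lborel. \<zeta> \<in> ball 0 \<rho> \<longrightarrow> (\<forall>k. f k (?l \<zeta>) = 0)"
          using 1(5) by eventually_elim (use True in \<open>auto simp: line_nth_other\<close>)
        show "AE \<zeta> in lborel. ennreal M0 * ennreal (cmod (f k (?l \<zeta>) * H' r0 R1 0 (?l \<zeta>)))
          \<le> cauchy_potential (\<lambda>w. ennreal (cmod (h k (?l w) * H' r0 R1 0 (?l w) + f k (?l w) * dbar j (H' r0 R1 0) (?l w))) * indicator (cball 0 R) w) \<zeta>" for k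
          using 1(7)
        proof eventually_elim
          case (elim \<zeta>)
          have "\<forall>i. i \<noteq> j \<longrightarrow> cmod (?l \<zeta> $ i - c $ i) < R1"
            using xr0 R1 by (auto simp: line_nth_other intro: less_trans)
          then show ?case using elim unfolding M0(1) by (subst lp[symmetric]) auto
        qed
        show "AE \<zeta> in lborel. ennreal M0 * ennreal (cmod (f k (?l \<zeta>) * H' r s m (?l \<zeta>)))
          \<le> cauchy_potential (\<lambda>w. ennreal (cmod (g k (?l w) * H' r s m (?l w) + f k (?l w) * dbar j (H' r s m) (?l w))) * indicator (cball 0 R) w) \<zeta>"
          if rs: "r \<in> \<rat>" "s \<in> \<rat>" "\<rho> < r" "r < s" "s < r0" for m r s k
        proof -
          obtain p q where pq: "r = of_rat p" "s = of_rat q" using rs(1,2) by (auto elim!: Rats_cases)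
          show ?thesis
            using 1(6)
          proof eventually_elim
            case (elim \<zeta>)
            have "\<forall>i. i \<noteq> j \<longrightarrow> cmod (?l \<zeta> $ i - c $ i) < r0"
              using xr0 by (auto simp: line_nth_other)
            then show ?case
              using elim rs unfolding M0(1) pq by (subst lp[symmetric]) auto
          qed
        qed
      qed (use M0_pos \<rho> R1 in \<open>auto\<close>)
      then show ?thesis by eventually_elim simp
    qed
  qed
  then show ?thesis
    by (rule AE_from_line[rotated]) measurable
qed

text \<open>
  The zeros spread from the small polydisc in one coordinate after the other: the induction
  enlarges the set \<open>S\<close> of coordinates in which the radius is already \<open>r0\<close>.
\<close>

theorem polydisc_propagation:
  fixes f :: "'m::finite \<Rightarrow> complex ^ 'n \<Rightarrow> complex" and g h :: "'n \<Rightarrow> 'm \<Rightarrow> complex ^ 'n \<Rightarrow> complex"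
    and v :: "complex ^ 'n \<Rightarrow> real"
  assumes [measurable]: "\<And>k. f k \<in> borel_measurable borel" "\<And>j k. g j k \<in> borel_measurable borel"
      "\<And>j k. h j k \<in> borel_measurable borel" "v \<in> borel_measurable borel"
    and wg: "\<And>j k. weak_dbar_test \<Omega> j (f k) (g j k)" and wh: "\<And>j k. weak_dbar_test \<Omega> j (f k) (h j k)"
    and K: "polydisc c R \<subseteq> \<Omega>"
    and int: "\<And>k. integrable lborel (\<lambda>x. indicator (polydisc c R) x *\<^sub>R f k x)"
      "\<And>j k. integrable lborel (\<lambda>x. indicator (polydisc c R) x *\<^sub>R g j k x)"
      "\<And>j k. integrable lborel (\<lambda>x. indicator (polydisc c R) x *\<^sub>R h j k x)"
    and v2: "(\<integral>\<^sup>+x. ennreal ((v x)\<^sup>2) * indicator (polydisc c R) x \<partial>lborel) < \<infinity>"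
    and f2: "\<And>k. (\<integral>\<^sup>+x. ennreal ((cmod (f k x))\<^sup>2) * indicator (polydisc c R) x \<partial>lborel) < \<infinity>"
    and h2: "\<And>j k. (\<integral>\<^sup>+x. ennreal ((cmod (h j k x))\<^sup>2) * indicator (polydisc c R) x \<partial>lborel) < \<infinity>"
    and gv: "\<And>j. AE x in lborel. x \<in> polydisc c R \<longrightarrow> (\<Sum>k\<in>UNIV. cmod (g j k x)) \<le> v x * (\<Sum>k\<in>UNIV. cmod (f k x))"
    and \<rho>: "0 < \<rho>" "\<rho> < r0" "r0 < R"
    and f0: "AE x in lborel. (\<forall>i. cmod (x $ i - c $ i) < \<rho>) \<longrightarrow> (\<forall>k. f k x = 0)"
  shows "AE x in lborel. (\<forall>i. cmod (x $ i - c $ i) < r0) \<longrightarrow> (\<forall>k. f k x = 0)"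
proof -
  have "AE x in lborel. (\<forall>i. cmod (x $ i - c $ i) < (if i \<in> S then r0 else \<rho>)) \<longrightarrow> (\<forall>k. f k x = 0)"
    if "finite S" for S :: "'n set"
    using that
  proof (induction S)
    case empty
    then show ?case using f0 by simp
  next
    case (insert j S)
    let ?\<tau> = "\<lambda>i. if i \<in> S then r0 else \<rho>"
    have "AE x in lborel. cmod (x $ j - c $ j) < r0 \<and> (\<forall>i. i \<noteq> j \<longrightarrow> cmod (x $ i - c $ i) < ?\<tau> i) \<longrightarrow> (\<forall>k. f k x = 0)"
    proof (rule coordinate_propagation[where \<tau> = ?\<tau> and g = "g j" and h = "h j" and v = v and \<rho> = \<rho> and R = R and \<Omega> = \<Omega>])
      show "AE x in lborel. cmod (x $ j - c $ j) < \<rho> \<and> (\<forall>i. i \<noteq> j \<longrightarrow> cmod (x $ i - c $ i) < ?\<tau> i) \<longrightarrow> (\<forall>k. f k x = 0)"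
        using insert.IH
      proof eventually_elim
        case (elim x)
        show ?case
        proof
          assume a: "cmod (x $ j - c $ j) < \<rho> \<and> (\<forall>i. i \<noteq> j \<longrightarrow> cmod (x $ i - c $ i) < ?\<tau> i)"
          have "cmod (x $ i - c $ i) < ?\<tau> i" for i
            using a insert.hyps(2) by (cases "i = j") auto
          then show "\<forall>k. f k x = 0" using elim by blast
        qed
      qed
    qed (use wg wh K int v2 f2 h2 gv \<rho> in auto)
    then show ?case
    proof eventually_elim
      case (elim x)
      show ?case
      proof
        assume a: "\<forall>i. cmod (x $ i - c $ i) < (if i \<in> insert j S then r0 else \<rho>)"
        have "cmod (x $ j - c $ j) < r0" using a by (metis insertI1)
        moreover have "cmod (x $ i - c $ i) < ?\<tau> i" if "i \<noteq> j" for i using a that by (metis insert_iff)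
        ultimately show "\<forall>k. f k x = 0" using elim by blast
      qed
    qed
  qed
  from this[of UNIV] show ?thesis by simp
qed

section \<open>Borel representatives\<close>

text \<open>
  Sections of Lebesgue measurable functions need not be measurable, so the arguments along lines
  use Borel representatives. Their value 0 outside \<open>\<Omega>\<close> turns integrals over \<open>\<Omega>\<close> into integrals over
  the whole space.
\<close>

definition borel_version :: "'a::euclidean_space set \<Rightarrow> ('a \<Rightarrow> 'b::real_normed_vector) \<Rightarrow> ('a \<Rightarrow> 'b) \<Rightarrow> bool" where
  "borel_version \<Omega> f f' \<longleftrightarrow> f' \<in> borel_measurable borel \<and> (AE x in lborel. x \<in> \<Omega> \<longrightarrow> f' x = f x) \<and> (\<forall>x. x \<notin> \<Omega> \<longrightarrow> f' x = 0)"

lemma borel_version_real_exists: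
  fixes f :: "'a::euclidean_space \<Rightarrow> real"
  assumes f: "f \<in> borel_measurable (lebesgue_on \<Omega>)" and \<Omega>: "open \<Omega>"
  shows "\<exists>f'. borel_version \<Omega> f f'"
proof -
  have [measurable]: "\<Omega> \<in> sets borel" using \<Omega> by (rule borel_open)
  have "(\<lambda>x. indicator \<Omega> x *\<^sub>R f x) \<in> borel_measurable lebesgue"
    using f by (subst (asm) borel_measurable_restrict_space_iff) auto
  then obtain g where g: "g \<in> borel_measurable lborel" "AE x in lborel. indicator \<Omega> x *\<^sub>R f x = g x"
    using completion_ex_borel_measurable_real by blast
  have [measurable]: "g \<in> borel_measurable borel" using g(1) by simp
  have "borel_version \<Omega> f (\<lambda>x. indicator \<Omega> x * g x)"
    unfolding borel_version_def
  proof (intro conjI)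
    show "AE x in lborel. x \<in> \<Omega> \<longrightarrow> indicator \<Omega> x * g x = f x"
      using g(2) by eventually_elim auto
  qed auto
  then show ?thesis by blast
qed

lemma borel_version_complex_exists:
  fixes f :: "'a::euclidean_space \<Rightarrow> complex"
  assumes f: "f \<in> borel_measurable (lebesgue_on \<Omega>)" and \<Omega>: "open \<Omega>"
  shows "\<exists>f'. borel_version \<Omega> f f'"
proof -
  have "(\<lambda>x. Re (f x)) \<in> borel_measurable (lebesgue_on \<Omega>)" "(\<lambda>x. Im (f x)) \<in> borel_measurable (lebesgue_on \<Omega>)"
    using f by measurable
  then obtain a b where a: "borel_version \<Omega> (\<lambda>x. Re (f x)) a" and b: "borel_version \<Omega> (\<lambda>x. Im (f x)) b"
    using borel_version_real_exists[OF _ \<Omega>] by blast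
  have [measurable]: "a \<in> borel_measurable borel" "b \<in> borel_measurable borel"
    using a b by (auto simp: borel_version_def)
  have "borel_version \<Omega> f (\<lambda>x. Complex (a x) (b x))"
    unfolding borel_version_def
  proof (intro conjI)
    show "(\<lambda>x. Complex (a x) (b x)) \<in> borel_measurable borel" unfolding Complex_eq by measurable
    have "AE x in lborel. x \<in> \<Omega> \<longrightarrow> a x = Re (f x)" "AE x in lborel. x \<in> \<Omega> \<longrightarrow> b x = Im (f x)"
      using a b by (auto simp: borel_version_def)
    then show "AE x in lborel. x \<in> \<Omega> \<longrightarrow> Complex (a x) (b x) = f x"
      by eventually_elim (auto simp: complex_eq_iff)
  qed (use a b in \<open>auto simp: borel_version_def Complex_eq\<close>)
  then show ?thesis by blast
qed

lemma AE_lebesgue_on_iff: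
  assumes "open \<Omega>"
  shows "(AE x in lebesgue_on \<Omega>. P x) \<longleftrightarrow> (AE x in lborel. x \<in> \<Omega> \<longrightarrow> P x)"
proof -
  have "\<Omega> \<in> sets lebesgue" using assms by (simp add: borel_open)
  then show ?thesis
    by (subst AE_restrict_space_iff) (auto simp: AE_completion_iff)
qed

lemma integral_lebesgue_on_borel_version:
  fixes f D :: "'a::euclidean_space \<Rightarrow> complex"
  assumes \<Omega>: "open \<Omega>" and f: "f \<in> borel_measurable (lebesgue_on \<Omega>)" and v: "borel_version \<Omega> f f'"
    and D: "continuous_on UNIV D"
  shows "(LINT x|lebesgue_on \<Omega>. f x * D x) = (\<integral>x. f' x * D x \<partial>lborel)"
proof -
  have \<Omega>s: "\<Omega> \<in> sets lebesgue" using \<Omega> by (simp add: borel_open)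
  have [measurable]: "f' \<in> borel_measurable borel" "D \<in> borel_measurable borel"
    using v by (auto simp: borel_version_def intro: borel_measurable_continuous_onI[OF D])
  have Dl: "D \<in> borel_measurable lebesgue"
    by (rule measurable_completion) simp
  have fl: "(\<lambda>x. indicator \<Omega> x *\<^sub>R f x) \<in> borel_measurable lebesgue"
    using f \<Omega>s by (subst (asm) borel_measurable_restrict_space_iff) auto
  have eq: "indicator \<Omega> x *\<^sub>R (f x * D x) = (indicator \<Omega> x *\<^sub>R f x) * D x" for x by simp
  have "(LINT x|lebesgue_on \<Omega>. f x * D x) = (\<integral>x. indicator \<Omega> x *\<^sub>R (f x * D x) \<partial>lebesgue)"
    using \<Omega>s by (intro integral_restrict_space) simp
  also have "\<dots> = (\<integral>x. f' x * D x \<partial>lebesgue)"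
  proof (rule integral_cong_AE)
    show "(\<lambda>x. indicator \<Omega> x *\<^sub>R (f x * D x)) \<in> borel_measurable lebesgue"
      unfolding eq by (intro borel_measurable_times fl Dl)
    show "(\<lambda>x. f' x * D x) \<in> borel_measurable lebesgue"
      by (rule measurable_completion) measurable
    have "AE x in lborel. x \<in> \<Omega> \<longrightarrow> f' x = f x" using v by (simp add: borel_version_def)
    then have "AE x in lebesgue. x \<in> \<Omega> \<longrightarrow> f' x = f x" by (rule AE_completion)
    then show "AE x in lebesgue. indicator \<Omega> x *\<^sub>R (f x * D x) = f' x * D x"
      by eventually_elim (use v in \<open>auto simp: borel_version_def indicator_def\<close>)
  qed
  also have "\<dots> = (\<integral>x. f' x * D x \<partial>lborel)"
    by (rule integral_completion) measurable
  finally show ?thesis .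
qed

lemma Lp_loc_borel_version_finite:
  fixes f :: "'a::euclidean_space \<Rightarrow> 'b::{real_normed_vector, second_countable_topology}"
  assumes L: "Lp_loc p \<Omega> f" and v: "borel_version \<Omega> f f'" and K: "compact K" "K \<subseteq> \<Omega>"
  shows "(\<integral>\<^sup>+x. ennreal (norm (f' x) ^ p) * indicator K x \<partial>lborel) < \<infinity>"
proof -
  have [measurable]: "f' \<in> borel_measurable borel" "K \<in> sets borel"
    using v K by (auto simp: borel_version_def borel_compact)
  have "integrable (lebesgue_on K) (\<lambda>x. norm (f x) ^ p)" using L K by (simp add: Lp_loc_def)
  then have "(\<integral>\<^sup>+x. ennreal (norm (f x) ^ p) \<partial>lebesgue_on K) < \<infinity>"
    by (simp add: integrable_iff_bounded)
  moreover have "(\<integral>\<^sup>+x. ennreal (norm (f x) ^ p) \<partial>lebesgue_on K) = (\<integral>\<^sup>+x. ennreal (norm (f x) ^ p) * indicator K x \<partial>lebesgue)"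
    by (rule nn_integral_restrict_space) simp
  moreover have "\<dots> = (\<integral>\<^sup>+x. ennreal (norm (f' x) ^ p) * indicator K x \<partial>lebesgue)"
  proof (rule nn_integral_cong_AE)
    have "AE x in lborel. x \<in> \<Omega> \<longrightarrow> f' x = f x" using v by (simp add: borel_version_def)
    then have "AE x in lebesgue. x \<in> \<Omega> \<longrightarrow> f' x = f x" by (rule AE_completion)
    then show "AE x in lebesgue. ennreal (norm (f x) ^ p) * indicator K x = ennreal (norm (f' x) ^ p) * indicator K x"
      by eventually_elim (use K in \<open>auto simp: indicator_def\<close>)
  qed
  moreover have "\<dots> = (\<integral>\<^sup>+x. ennreal (norm (f' x) ^ p) * indicator K x \<partial>lborel)"
    by (rule nn_integral_completion)
  ultimately show ?thesis by simp
qed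

lemma Lp_loc_1_borel_version_integrable:
  fixes f :: "'a::euclidean_space \<Rightarrow> complex"
  assumes "Lp_loc 1 \<Omega> f" and v: "borel_version \<Omega> f f'" and K: "compact K" "K \<subseteq> \<Omega>"
  shows "integrable lborel (\<lambda>x. indicator K x *\<^sub>R f' x)"
proof (rule integrableI_bounded)
  have [measurable]: "f' \<in> borel_measurable borel" "K \<in> sets borel"
    using v K by (auto simp: borel_version_def borel_compact)
  show "(\<lambda>x. indicator K x *\<^sub>R f' x) \<in> borel_measurable lborel" by measurable
  have "(\<integral>\<^sup>+x. ennreal (norm (indicator K x *\<^sub>R f' x)) \<partial>lborel) = (\<integral>\<^sup>+x. ennreal (norm (f' x) ^ 1) * indicator K x \<partial>lborel)"
    by (intro nn_integral_cong) (simp add: indicator_def)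
  also have "\<dots> < \<infinity>" by (rule Lp_loc_borel_version_finite[OF assms])
  finally show "(\<integral>\<^sup>+x. ennreal (norm (indicator K x *\<^sub>R f' x)) \<partial>lborel) < \<infinity>" .
qed

lemma test_function_smooth: "test_function \<Omega> \<phi> \<Longrightarrow> smooth \<phi>"
  by (simp add: test_function_def smooth_def)

lemma weak_dbar_test_of_has_weak_dbar:
  assumes \<Omega>: "open \<Omega>" and w: "has_weak_dbar \<Omega> j f g"
    and f': "borel_version \<Omega> f f'" and g': "borel_version \<Omega> g g'"
  shows "weak_dbar_test \<Omega> j f' g'"
  unfolding weak_dbar_test_def
proof (intro allI impI)
  fix \<phi> assume t: "test_function \<Omega> \<phi>"
  have m: "f \<in> borel_measurable (lebesgue_on \<Omega>)" "g \<in> borel_measurable (lebesgue_on \<Omega>)"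
    using w by (auto simp: has_weak_dbar_def Lp_loc_def)
  have "(LINT x|lebesgue_on \<Omega>. f x * dbar j \<phi> x) = - (LINT x|lebesgue_on \<Omega>. g x * \<phi> x)"
    using w t by (simp add: has_weak_dbar_def)
  then show "(\<integral>x. f' x * dbar j \<phi> x \<partial>lborel) = - (\<integral>x. g' x * \<phi> x \<partial>lborel)"
    using integral_lebesgue_on_borel_version[OF \<Omega> m(1) f' continuous_on_dbar[OF test_function_smooth[OF t]]]
      integral_lebesgue_on_borel_version[OF \<Omega> m(2) g' smooth_continuous[OF test_function_smooth[OF t]]]
    by simp
qed

lemma frechet_derivative_outside_support:
  assumes "x \<notin> closure {x. \<phi> x \<noteq> 0}"
  shows "frechet_derivative \<phi> (at x) b = 0"
proof -
  have "(\<phi> has_derivative (\<lambda>_. 0)) (at x)"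
  proof (rule has_derivative_transform_within_open[of "\<lambda>_. 0"])
    show "open (- closure {x. \<phi> x \<noteq> 0})" by auto
    show "0 = \<phi> y" if "y \<in> - closure {x. \<phi> x \<noteq> 0}" for y
      using that closure_subset[of "{x. \<phi> x \<noteq> 0}"] by auto
  qed (use assms in auto)
  then show ?thesis by (simp add: frechet_derivative_at[symmetric])
qed

text \<open>
  The combination of weak real derivatives that defines d-bar is a weak d-bar derivative; it
  inherits the square integrability of the real derivatives.
\<close>

lemma weak_dbar_test_of_weak_derivs:
  assumes \<Omega>: "open \<Omega>" and w1: "has_weak_deriv \<Omega> (axis j 1) f g1" and w2: "has_weak_deriv \<Omega> (axis j \<i>) f g2"
    and f': "borel_version \<Omega> f f'" and g1': "borel_version \<Omega> g1 g1'" and g2': "borel_version \<Omega> g2 g2'"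
  shows "weak_dbar_test \<Omega> j f' (\<lambda>x. (g1' x + \<i> * g2' x) / 2)"
  unfolding weak_dbar_test_def
proof (intro allI impI)
  fix \<phi> assume t: "test_function \<Omega> \<phi>"
  let ?K = "closure {x. \<phi> x \<noteq> 0}"
  have K: "compact ?K" "?K \<subseteq> \<Omega>" using t by (auto simp: test_function_def)
  have sm: "smooth \<phi>" using t by (rule test_function_smooth)
  have c\<phi>: "continuous_on UNIV \<phi>" by (rule smooth_continuous[OF sm])
  have m: "Lp_loc 1 \<Omega> f" "Lp_loc 1 \<Omega> g1" "Lp_loc 1 \<Omega> g2"
    using w1 w2 by (auto simp: has_weak_deriv_def)
  then have mm: "f \<in> borel_measurable (lebesgue_on \<Omega>)" "g1 \<in> borel_measurable (lebesgue_on \<Omega>)" "g2 \<in> borel_measurable (lebesgue_on \<Omega>)"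
    by (auto simp: Lp_loc_def)
  have cD: "continuous_on UNIV (\<lambda>x. frechet_derivative \<phi> (at x) (axis j b))" if "b = 1 \<or> b = \<i>" for b
    using that sm by (intro smooth_continuous smooth_derivative) (auto simp: Basis_vec_def Basis_complex_def)
  have e: "(\<integral>x. f' x * frechet_derivative \<phi> (at x) (axis j b) \<partial>lborel) = - (\<integral>x. q' x * \<phi> x \<partial>lborel)"
    if "has_weak_deriv \<Omega> (axis j b) f q" "borel_version \<Omega> q q'" "b = 1 \<or> b = \<i>" "q \<in> borel_measurable (lebesgue_on \<Omega>)" for b q q'
    using that t integral_lebesgue_on_borel_version[OF \<Omega> mm(1) f' cD[OF that(3)]]
      integral_lebesgue_on_borel_version[OF \<Omega> that(4) that(2) c\<phi>]
    by (simp add: has_weak_deriv_def)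
  have iD: "integrable lborel (\<lambda>x. f' x * frechet_derivative \<phi> (at x) (axis j b))" if "b = 1 \<or> b = \<i>" for b
  proof -
    have "f' x * frechet_derivative \<phi> (at x) (axis j b) = indicator ?K x *\<^sub>R (f' x * frechet_derivative \<phi> (at x) (axis j b))" for x
      using frechet_derivative_outside_support[of x \<phi>] by (auto simp: indicator_def)
    then show ?thesis
      using integrable_compact_mult_continuous[OF K(1) Lp_loc_1_borel_version_integrable[OF m(1) f' K] cD[OF that]] by simp
  qed
  have i\<phi>: "integrable lborel (\<lambda>x. q' x * \<phi> x)" if "Lp_loc 1 \<Omega> q" "borel_version \<Omega> q q'" for q q'
  proof -
    have "q' x * \<phi> x = indicator ?K x *\<^sub>R (q' x * \<phi> x)" for x
      using closure_subset[of "{x. \<phi> x \<noteq> 0}"] by (auto simp: indicator_def)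
    then show ?thesis
      using integrable_compact_mult_continuous[OF K(1) Lp_loc_1_borel_version_integrable[OF that K] c\<phi>] by simp
  qed
  let ?D = "\<lambda>b x. frechet_derivative \<phi> (at x) (axis j b)"
  have "(\<integral>x. f' x * dbar j \<phi> x \<partial>lborel) = (\<integral>x. (f' x * ?D 1 x) / 2 + \<i> * (f' x * ?D \<i> x) / 2 \<partial>lborel)"
    by (intro Bochner_Integration.integral_cong) (auto simp: dbar_def algebra_simps add_divide_distrib)
  also have "\<dots> = (\<integral>x. f' x * ?D 1 x \<partial>lborel) / 2 + \<i> * (\<integral>x. f' x * ?D \<i> x \<partial>lborel) / 2"
    using iD by (subst Bochner_Integration.integral_add) auto
  also have "\<dots> = - ((\<integral>x. g1' x * \<phi> x \<partial>lborel) / 2 + \<i> * (\<integral>x. g2' x * \<phi> x \<partial>lborel) / 2)"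
    using e[OF w1 g1' _ mm(2)] e[OF w2 g2' _ mm(3)] by simp
  also have "(\<integral>x. g1' x * \<phi> x \<partial>lborel) / 2 + \<i> * (\<integral>x. g2' x * \<phi> x \<partial>lborel) / 2
      = (\<integral>x. (g1' x * \<phi> x) / 2 + \<i> * (g2' x * \<phi> x) / 2 \<partial>lborel)"
    using i\<phi>[OF m(2) g1'] i\<phi>[OF m(3) g2'] by (subst Bochner_Integration.integral_add) auto
  also have "\<dots> = (\<integral>x. (g1' x + \<i> * g2' x) / 2 * \<phi> x \<partial>lborel)"
    by (intro Bochner_Integration.integral_cong) (auto simp: algebra_simps add_divide_distrib)
  finally show "(\<integral>x. f' x * dbar j \<phi> x \<partial>lborel) = - (\<integral>x. (g1' x + \<i> * g2' x) / 2 * \<phi> x \<partial>lborel)" .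
qed

section \<open>From polydiscs to domains\<close>

lemma AE_from_local:
  fixes P :: "'a::euclidean_space \<Rightarrow> bool"
  assumes "\<And>x. x \<in> \<Omega> \<Longrightarrow> \<exists>e>0. AE y in lborel. y \<in> ball x e \<longrightarrow> P y"
  shows "AE y in lborel. y \<in> \<Omega> \<longrightarrow> P y"
proof -
  define F where "F = {B. open B \<and> (AE y in lborel. y \<in> B \<longrightarrow> P y)}"
  have "\<And>S. S \<in> F \<Longrightarrow> open S" by (simp add: F_def)
  then obtain F' where F': "F' \<subseteq> F" "countable F'" "\<Union>F' = \<Union>F" by (rule Lindelof) blast
  have "AE y in lborel. \<forall>B\<in>F'. y \<in> B \<longrightarrow> P y"
    using F' by (subst AE_ball_countable) (auto simp: F_def)
  moreover have "\<Omega> \<subseteq> \<Union>F"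
  proof
    fix x assume "x \<in> \<Omega>"
    then obtain e where e: "e > 0" "AE y in lborel. y \<in> ball x e \<longrightarrow> P y" using assms by blast
    then have "ball x e \<in> F" by (simp add: F_def)
    then show "x \<in> \<Union>F" using e(1) by (meson UnionI centre_in_ball)
  qed
  ultimately show ?thesis
    by (elim eventually_mono) (use F'(3) in blast)
qed

lemma norm_vec_less_of_components:
  fixes x :: "complex ^ 'n"
  assumes "\<And>i. cmod (x $ i) < d / real CARD('n)" shows "norm x < d"
proof -
  have "norm x \<le> (\<Sum>i\<in>UNIV. cmod (x $ i))" unfolding norm_vec_def by (rule L2_set_le_sum) auto
  also have "\<dots> < (\<Sum>i\<in>(UNIV :: 'n set). d / real CARD('n))" using assms by (intro sum_strict_mono) auto
  finally show ?thesis by simp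
qed

lemma polydisc_subset_ball:
  fixes x :: "complex ^ 'n"
  assumes "e > 0" obtains R where "R > 0" "polydisc x R \<subseteq> ball x e"
proof
  show "e / (2 * real CARD('n)) > 0" using assms by simp
  show "polydisc x (e / (2 * real CARD('n))) \<subseteq> ball x e"
  proof
    fix y assume y: "y \<in> polydisc x (e / (2 * real CARD('n)))"
    have "cmod ((y - x) $ i) < e / real CARD('n)" for i
    proof -
      have "cmod ((y - x) $ i) \<le> e / (2 * real CARD('n))" using y by (simp add: polydisc_def)
      also have "\<dots> < e / real CARD('n)" using assms by (simp add: field_simps)
      finally show ?thesis .
    qed
    then have "norm (y - x) < e" by (rule norm_vec_less_of_components)
    then show "y \<in> ball x e" by (simp add: dist_norm norm_minus_commute)
  qed
qed

text \<open>
  The points with a neighbourhood on which \<open>P\<close> holds almost everywhere form an open set \<open>Z\<close>. Its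
  complement in \<open>\<Omega>\<close> is open as well: a polydisc around a point of \<open>Z\<close> that is close to \<open>x\<close> reaches \<open>x\<close>
  while staying in \<open>\<Omega>\<close>.
\<close>

lemma connected_propagation:
  fixes P :: "complex ^ 'n \<Rightarrow> bool"
  assumes \<Omega>: "open \<Omega>" "connected \<Omega>"
    and U: "open U" "U \<noteq> {}" "U \<subseteq> \<Omega>" "AE x in lborel. x \<in> U \<longrightarrow> P x"
    and propagate: "\<And>c R \<rho> r0. polydisc c R \<subseteq> \<Omega> \<Longrightarrow> 0 < \<rho> \<Longrightarrow> \<rho> < r0 \<Longrightarrow> r0 < R \<Longrightarrow>
      AE x in lborel. (\<forall>i. cmod (x $ i - c $ i) < \<rho>) \<longrightarrow> P x \<Longrightarrow>
      AE x in lborel. (\<forall>i. cmod (x $ i - c $ i) < r0) \<longrightarrow> P x"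
  shows "AE x in lborel. x \<in> \<Omega> \<longrightarrow> P x"
proof -
  define Z where "Z = {x \<in> \<Omega>. \<exists>e>0. AE y in lborel. y \<in> ball x e \<longrightarrow> P y}"
  have ZI: "x \<in> Z" if "x \<in> \<Omega>" "open S" "x \<in> S" "AE y in lborel. y \<in> S \<longrightarrow> P y" for x S
  proof -
    obtain e where e: "e > 0" "ball x e \<subseteq> S" using \<open>open S\<close> \<open>x \<in> S\<close> open_contains_ball by blast
    have "AE y in lborel. y \<in> ball x e \<longrightarrow> P y"
      using that(4) by eventually_elim (use e in blast)
    then show ?thesis using e(1) that(1) by (auto simp: Z_def)
  qed
  have "U \<subseteq> Z" using U ZI by blast
  have openZ: "open Z"
    unfolding open_contains_ball
  proof
    fix x assume x: "x \<in> Z"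
    then obtain e where e: "e > 0" "AE y in lborel. y \<in> ball x e \<longrightarrow> P y" by (auto simp: Z_def)
    have "x \<in> \<Omega>" using x by (simp add: Z_def)
    then obtain e' where e': "e' > 0" "ball x e' \<subseteq> \<Omega>" using \<Omega>(1) open_contains_ball by blast
    have "ball x (min e e') \<subseteq> Z"
      using ZI[OF _ open_ball _ e(2)] e'(2) by auto
    then show "\<exists>e>0. ball x e \<subseteq> Z" using e(1) e'(1) by (intro exI[of _ "min e e'"]) auto
  qed
  have "open (\<Omega> - Z)"
    unfolding open_contains_ball
  proof
    fix x assume x: "x \<in> \<Omega> - Z"
    obtain e where e: "e > 0" "ball x e \<subseteq> \<Omega>" using x \<Omega>(1) open_contains_ball by blast
    obtain R where R: "R > 0" "polydisc x R \<subseteq> ball x e" by (rule polydisc_subset_ball[OF e(1)])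
    \<comment> \<open>If \<open>y\<close> is within \<open>R / 4\<close> of \<open>x\<close>, the polydisc of radius \<open>R / 2\<close> around \<open>y\<close> lies in the one of radius \<open>R\<close> around
      \<open>x\<close>, and the one of radius \<open>3 R / 8\<close> around \<open>y\<close> contains the ball of radius \<open>R / 8\<close> around \<open>x\<close>.\<close>
    have "y \<notin> Z" if y: "y \<in> ball x (R / 4)" for y
    proof
      assume "y \<in> Z"
      then obtain d where d: "d > 0" "AE z in lborel. z \<in> ball y d \<longrightarrow> P z" by (auto simp: Z_def)
      have yx: "cmod (y $ i - x $ i) < R / 4" for i
      proof -
        have "cmod ((y - x) $ i) \<le> norm (y - x)" by (rule Finite_Cartesian_Product.norm_nth_le)
        then show ?thesis using y by (simp add: dist_norm norm_minus_commute)
      qed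
      have tri: "cmod (a - c) \<le> cmod (a - b) + cmod (b - c)" for a b c :: complex
        using norm_triangle_ineq[of "a - b" "b - c"] by simp
      have "polydisc y (R / 2) \<subseteq> polydisc x R"
      proof
        fix z assume z: "z \<in> polydisc y (R / 2)"
        have "cmod (z $ i - x $ i) \<le> R" for i
        proof -
          have "cmod (z $ i - y $ i) \<le> R / 2" using z by (simp add: polydisc_def)
          then show ?thesis using tri[of "z $ i" "x $ i" "y $ i"] yx[of i] R(1) by linarith
        qed
        then show "z \<in> polydisc x R" by (simp add: polydisc_def)
      qed
      then have K: "polydisc y (R / 2) \<subseteq> \<Omega>" using R(2) e(2) by blast
      define \<rho> where "\<rho> = min (d / real CARD('n)) (R / 8)"
      have \<rho>: "\<rho> > 0" "\<rho> < 3 * R / 8" using d(1) R(1) by (auto simp: \<rho>_def min_def)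
      have "AE z in lborel. (\<forall>i. cmod (z $ i - y $ i) < \<rho>) \<longrightarrow> P z"
        using d(2)
      proof eventually_elim
        case (elim z)
        show ?case
        proof
          assume a: "\<forall>i. cmod (z $ i - y $ i) < \<rho>"
          have "cmod ((z - y) $ i) < d / real CARD('n)" for i
            using a[rule_format, of i] by (simp add: \<rho>_def)
          then have "norm (z - y) < d" by (rule norm_vec_less_of_components)
          then show "P z" using elim by (simp add: dist_norm norm_minus_commute)
        qed
      qed
      from propagate[OF K \<rho> _ this] have ae: "AE z in lborel. (\<forall>i. cmod (z $ i - y $ i) < 3 * R / 8) \<longrightarrow> P z"
        using R(1) by simp
      have near: "AE z in lborel. z \<in> ball x (R / 8) \<longrightarrow> P z"
        using ae
      proof eventually_elim
        case (elim z)
        show ?case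
        proof
          assume z: "z \<in> ball x (R / 8)"
          have "cmod (z $ i - y $ i) < 3 * R / 8" for i
          proof -
            have "cmod ((z - x) $ i) \<le> norm (z - x)" by (rule Finite_Cartesian_Product.norm_nth_le)
            then have "cmod (z $ i - x $ i) < R / 8" using z by (simp add: dist_norm norm_minus_commute)
            then show ?thesis
              using tri[of "z $ i" "y $ i" "x $ i"] yx[of i] by (simp add: norm_minus_commute)
          qed
          then show "P z" using elim by blast
        qed
      qed
      have "x \<in> Z" by (rule ZI[OF _ open_ball _ near]) (use x R(1) in auto)
      then show False using x by blast
    qed
    then have "ball x (min e (R / 4)) \<subseteq> \<Omega> - Z" using e(2) by auto
    then show "\<exists>e>0. ball x e \<subseteq> \<Omega> - Z" using e(1) R(1) by (intro exI[of _ "min e (R / 4)"]) auto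
  qed
  then have "\<Omega> \<subseteq> Z"
    using connectedD[OF \<Omega>(2) openZ \<open>open (\<Omega> - Z)\<close>] \<open>U \<subseteq> Z\<close> U(2,3) by blast
  then show ?thesis by (intro AE_from_local) (auto simp: Z_def)
qed

lemma half_sum_sq_le: "((a + b) / 2)\<^sup>2 \<le> a\<^sup>2 + (b :: real)\<^sup>2"
proof -
  have "a\<^sup>2 + b\<^sup>2 - ((a + b) / 2)\<^sup>2 = ((a - b) / 2)\<^sup>2 + (a\<^sup>2 + b\<^sup>2) / 2"
    by (simp add: power2_eq_square field_simps)
  also have "\<dots> \<ge> 0" by simp
  finally show ?thesis by simp
qed

theorem theorem1p3:
  fixes \<Omega> U :: "(complex ^ 'n) set"
    and u :: "complex ^ 'n \<Rightarrow> complex ^ 'm"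
    and du :: "'n \<Rightarrow> 'm \<Rightarrow> complex ^ 'n \<Rightarrow> complex"
    and V :: "complex ^ 'n \<Rightarrow> real"
  assumes "open \<Omega>" and "connected \<Omega>"
    and "H1_loc \<Omega> u"
    and "\<And>j k. has_weak_dbar \<Omega> j (\<lambda>x. u x $ k) (du j k)"
    and "Lp_loc 2 \<Omega> V"
    and "AE x in lebesgue_on \<Omega>.
           sqrt (\<Sum>j\<in>UNIV. \<Sum>k\<in>UNIV. (cmod (du j k x))\<^sup>2) \<le> V x * norm (u x)"
    and "open U" and "U \<noteq> {}" and "U \<subseteq> \<Omega>"
    and "AE x in lebesgue_on U. u x = 0"
  shows "AE x in lebesgue_on \<Omega>. u x = 0"
proof -
  note \<Omega> = \<open>open \<Omega>\<close>
  let ?N = "real CARD('m)"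
  have u2: "Lp_loc 2 \<Omega> (\<lambda>x. u x $ k)" for k using assms(3) by (simp add: H1_loc_def)
  have u1: "Lp_loc 1 \<Omega> (\<lambda>x. u x $ k)" for k using assms(4) by (simp add: has_weak_dbar_def)
  have du1: "Lp_loc 1 \<Omega> (du j k)" for j k using assms(4) by (simp add: has_weak_dbar_def)
  have bm: "f \<in> borel_measurable (lebesgue_on \<Omega>)" if "Lp_loc p \<Omega> f" for p and f :: "complex ^ 'n \<Rightarrow> complex"
    using that by (simp add: Lp_loc_def)
  have ax: "axis j 1 \<in> (Basis :: (complex ^ 'n) set)" "axis j \<i> \<in> (Basis :: (complex ^ 'n) set)" for j
    by (auto simp: Basis_vec_def Basis_complex_def)
  have "\<forall>b\<in>Basis. \<exists>g. Lp_loc 2 \<Omega> g \<and> has_weak_deriv \<Omega> b (\<lambda>x. u x $ k) g" for k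
    using assms(3) by (simp add: H1_loc_def)
  then have "\<forall>j k. \<exists>g. Lp_loc 2 \<Omega> g \<and> has_weak_deriv \<Omega> (axis j 1) (\<lambda>x. u x $ k) g"
    "\<forall>j k. \<exists>g. Lp_loc 2 \<Omega> g \<and> has_weak_deriv \<Omega> (axis j \<i>) (\<lambda>x. u x $ k) g"
    using ax by blast+
  then obtain p q where p: "\<And>j k. Lp_loc 2 \<Omega> (p j k)" "\<And>j k. has_weak_deriv \<Omega> (axis j 1) (\<lambda>x. u x $ k) (p j k)"
    and q: "\<And>j k. Lp_loc 2 \<Omega> (q j k)" "\<And>j k. has_weak_deriv \<Omega> (axis j \<i>) (\<lambda>x. u x $ k) (q j k)"
    by metis
  have ex: "\<exists>f'. borel_version \<Omega> f f'" if "Lp_loc i \<Omega> f" for i and f :: "complex ^ 'n \<Rightarrow> complex"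
    by (rule borel_version_complex_exists[OF bm[OF that] \<Omega>])
  obtain f where f: "\<And>k. borel_version \<Omega> (\<lambda>x. u x $ k) (f k)" using ex[OF u2] by metis
  obtain g where g: "\<And>j k. borel_version \<Omega> (du j k) (g j k)" using ex[OF du1] by metis
  obtain p' where p': "\<And>j k. borel_version \<Omega> (p j k) (p' j k)" using ex[OF p(1)] by metis
  obtain q' where q': "\<And>j k. borel_version \<Omega> (q j k) (q' j k)" using ex[OF q(1)] by metis
  obtain V' where V': "borel_version \<Omega> V V'"
    using borel_version_real_exists[OF _ \<Omega>] assms(5) unfolding Lp_loc_def by blast
  \<comment> \<open>\<open>h\<close> is the square integrable d-bar derivative that \<open>H\<^sup>1\<close> provides, \<open>g\<close> the one that satisfies the inequality.\<close>
  define h where "h = (\<lambda>j k x. (p' j k x + \<i> * q' j k x) / 2)"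
  \<comment> \<open>Each component of \<open>g\<close> is bounded by \<open>\<bar>V\<bar> \<bar>u\<bar>\<close>; the factor is the number of components.\<close>
  define v where "v = (\<lambda>x. ?N * \<bar>V' x\<bar>)"
  have [measurable]: "\<And>k. f k \<in> borel_measurable borel" "\<And>j k. g j k \<in> borel_measurable borel"
    "\<And>j k. p' j k \<in> borel_measurable borel" "\<And>j k. q' j k \<in> borel_measurable borel" "V' \<in> borel_measurable borel"
    using f g p' q' V' by (auto simp: borel_version_def)
  have [measurable]: "\<And>j k. h j k \<in> borel_measurable borel" "v \<in> borel_measurable borel"
    unfolding h_def v_def by measurable
  have wg: "weak_dbar_test \<Omega> j (f k) (g j k)" for j k
    by (rule weak_dbar_test_of_has_weak_dbar[OF \<Omega> assms(4) f g])
  have wh: "weak_dbar_test \<Omega> j (f k) (h j k)" for j k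
    unfolding h_def by (rule weak_dbar_test_of_weak_derivs[OF \<Omega> p(2) q(2) f p' q'])
  have p1: "Lp_loc 1 \<Omega> (p j k)" "Lp_loc 1 \<Omega> (q j k)" for j k
    using p(2) q(2) by (auto simp: has_weak_deriv_def)
  have uf: "AE x in lborel. x \<in> \<Omega> \<longrightarrow> (\<forall>k. f k x = u x $ k)"
  proof -
    have "AE x in lborel. \<forall>k\<in>UNIV. x \<in> \<Omega> \<longrightarrow> f k x = u x $ k"
      using f by (intro AE_finite_allI) (auto simp: borel_version_def)
    then show ?thesis by eventually_elim auto
  qed
  have gv: "AE x in lborel. x \<in> \<Omega> \<longrightarrow> (\<Sum>k\<in>UNIV. cmod (g j k x)) \<le> v x * (\<Sum>k\<in>UNIV. cmod (f k x))" for j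
  proof -
    have 1: "AE x in lborel. \<forall>k\<in>UNIV. x \<in> \<Omega> \<longrightarrow> g j k x = du j k x"
      using g by (intro AE_finite_allI) (auto simp: borel_version_def)
    have 2: "AE x in lborel. x \<in> \<Omega> \<longrightarrow> V' x = V x" using V' by (simp add: borel_version_def)
    have 3: "AE x in lborel. x \<in> \<Omega> \<longrightarrow> sqrt (\<Sum>j\<in>UNIV. \<Sum>k\<in>UNIV. (cmod (du j k x))\<^sup>2) \<le> V x * norm (u x)"
      using assms(6) by (simp add: AE_lebesgue_on_iff[OF \<Omega>])
    show ?thesis
      using 1 2 3 uf
    proof eventually_elim
      case (elim x)
      show ?case
      proof
        assume x: "x \<in> \<Omega>"
        let ?s = "sqrt (\<Sum>j\<in>UNIV. \<Sum>k\<in>UNIV. (cmod (du j k x))\<^sup>2)"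
        have le: "cmod (g j k x) \<le> \<bar>V' x\<bar> * (\<Sum>k\<in>UNIV. cmod (f k x))" for k
        proof -
          have "(cmod (du j k x))\<^sup>2 \<le> (\<Sum>k\<in>UNIV. (cmod (du j k x))\<^sup>2)"
            by (intro member_le_sum) auto
          also have "\<dots> \<le> (\<Sum>j\<in>UNIV. \<Sum>k\<in>UNIV. (cmod (du j k x))\<^sup>2)"
            by (rule member_le_sum[where f = "\<lambda>j. \<Sum>k\<in>UNIV. (cmod (du j k x))\<^sup>2"]) (auto intro: sum_nonneg)
          finally have "cmod (du j k x) \<le> ?s" by (rule real_le_rsqrt)
          also have "\<dots> \<le> V x * norm (u x)" using elim(3) x by simp
          also have "\<dots> \<le> \<bar>V' x\<bar> * norm (u x)" using elim(2) x by (intro mult_right_mono) auto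
          also have "\<dots> \<le> \<bar>V' x\<bar> * (\<Sum>k\<in>UNIV. cmod (f k x))"
          proof (intro mult_left_mono)
            have "norm (u x) \<le> (\<Sum>k\<in>UNIV. cmod (u x $ k))"
              unfolding norm_vec_def by (rule L2_set_le_sum) auto
            then show "norm (u x) \<le> (\<Sum>k\<in>UNIV. cmod (f k x))" using elim(4) x by simp
          qed simp
          finally show ?thesis using elim(1) x by simp
        qed
        have "(\<Sum>k\<in>(UNIV :: 'm set). cmod (g j k x)) \<le> (\<Sum>k\<in>(UNIV :: 'm set). \<bar>V' x\<bar> * (\<Sum>k\<in>UNIV. cmod (f k x)))"
          by (intro sum_mono le)
        then show "(\<Sum>k\<in>UNIV. cmod (g j k x)) \<le> v x * (\<Sum>k\<in>UNIV. cmod (f k x))"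
          by (simp add: v_def)
      qed
    qed
  qed
  have U0: "AE x in lborel. x \<in> U \<longrightarrow> (\<forall>k. f k x = 0)"
  proof -
    have "AE x in lborel. x \<in> U \<longrightarrow> u x = 0"
      using assms(10) by (simp add: AE_lebesgue_on_iff[OF \<open>open U\<close>])
    then show ?thesis using uf by eventually_elim (use \<open>U \<subseteq> \<Omega>\<close> in auto)
  qed
  have "AE x in lborel. x \<in> \<Omega> \<longrightarrow> (\<forall>k. f k x = 0)"
  proof (rule connected_propagation[OF assms(1,2,7,8,9) U0])
    fix c :: "complex ^ 'n" and R \<rho> r0 :: real
    assume K: "polydisc c R \<subseteq> \<Omega>" and \<rho>: "0 < \<rho>" "\<rho> < r0" "r0 < R"
      and f0: "AE x in lborel. (\<forall>i. cmod (x $ i - c $ i) < \<rho>) \<longrightarrow> (\<forall>k. f k x = 0)"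
    note cK = compact_polydisc[of c R] K
    have sq: "(\<integral>\<^sup>+x. ennreal ((cmod (a x))\<^sup>2) * indicator (polydisc c R) x \<partial>lborel) < \<infinity>"
      if "Lp_loc 2 \<Omega> b" "borel_version \<Omega> b a" for a b :: "complex ^ 'n \<Rightarrow> complex"
      using Lp_loc_borel_version_finite[OF that cK] .
    show "AE x in lborel. (\<forall>i. cmod (x $ i - c $ i) < r0) \<longrightarrow> (\<forall>k. f k x = 0)"
    proof (rule polydisc_propagation[where g = g and h = h and v = v and \<Omega> = \<Omega> and R = R, OF _ _ _ _ wg wh K _ _ _ _ _ _ _ \<rho> f0])
      show "integrable lborel (\<lambda>x. indicator (polydisc c R) x *\<^sub>R f k x)" for k
        by (rule Lp_loc_1_borel_version_integrable[OF u1 f cK])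
      show "integrable lborel (\<lambda>x. indicator (polydisc c R) x *\<^sub>R g j k x)" for j k
        by (rule Lp_loc_1_borel_version_integrable[OF du1 g cK])
      show "integrable lborel (\<lambda>x. indicator (polydisc c R) x *\<^sub>R h j k x)" for j k
      proof -
        have "integrable lborel (\<lambda>x. (indicator (polydisc c R) x *\<^sub>R p' j k x + \<i> * (indicator (polydisc c R) x *\<^sub>R q' j k x)) / 2)"
          by (intro integrable_divide Bochner_Integration.integrable_add integrable_mult_right
              Lp_loc_1_borel_version_integrable[OF p1(1) p' cK] Lp_loc_1_borel_version_integrable[OF p1(2) q' cK])
        also have "(\<lambda>x. (indicator (polydisc c R) x *\<^sub>R p' j k x + \<i> * (indicator (polydisc c R) x *\<^sub>R q' j k x)) / 2)
            = (\<lambda>x. indicator (polydisc c R) x *\<^sub>R h j k x)"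
          by (auto simp: h_def indicator_def)
        finally show ?thesis .
      qed
      show "(\<integral>\<^sup>+x. ennreal ((cmod (f k x))\<^sup>2) * indicator (polydisc c R) x \<partial>lborel) < \<infinity>" for k
        by (rule sq[OF u2 f])
      show "(\<integral>\<^sup>+x. ennreal ((cmod (h j k x))\<^sup>2) * indicator (polydisc c R) x \<partial>lborel) < \<infinity>" for j k
      proof -
        have le: "(cmod (h j k x))\<^sup>2 \<le> (cmod (p' j k x))\<^sup>2 + (cmod (q' j k x))\<^sup>2" for x
        proof -
          have "cmod (h j k x) \<le> (cmod (p' j k x) + cmod (q' j k x)) / 2"
            using norm_triangle_ineq[of "p' j k x" "\<i> * q' j k x"] by (simp add: h_def norm_divide norm_mult)
          then have "(cmod (h j k x))\<^sup>2 \<le> ((cmod (p' j k x) + cmod (q' j k x)) / 2)\<^sup>2" by (intro power_mono) auto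
          also have "\<dots> \<le> (cmod (p' j k x))\<^sup>2 + (cmod (q' j k x))\<^sup>2"
            by (rule half_sum_sq_le)
          finally show ?thesis .
        qed
        have "(\<integral>\<^sup>+x. ennreal ((cmod (h j k x))\<^sup>2) * indicator (polydisc c R) x \<partial>lborel)
          \<le> (\<integral>\<^sup>+x. ennreal ((cmod (p' j k x))\<^sup>2) * indicator (polydisc c R) x + ennreal ((cmod (q' j k x))\<^sup>2) * indicator (polydisc c R) x \<partial>lborel)"
          unfolding distrib_right[symmetric]
          by (intro nn_integral_mono mult_right_mono) (use le in \<open>auto simp: ennreal_leI simp flip: ennreal_plus\<close>)
        also have "\<dots> = (\<integral>\<^sup>+x. ennreal ((cmod (p' j k x))\<^sup>2) * indicator (polydisc c R) x \<partial>lborel)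
            + (\<integral>\<^sup>+x. ennreal ((cmod (q' j k x))\<^sup>2) * indicator (polydisc c R) x \<partial>lborel)"
          by (rule nn_integral_add) measurable
        also have "\<dots> < \<infinity>" using sq[OF p(1) p', of j k] sq[OF q(1) q', of j k] by simp
        finally show ?thesis .
      qed
      show "(\<integral>\<^sup>+x. ennreal ((v x)\<^sup>2) * indicator (polydisc c R) x \<partial>lborel) < \<infinity>"
      proof -
        have "(\<integral>\<^sup>+x. ennreal ((v x)\<^sup>2) * indicator (polydisc c R) x \<partial>lborel)
            = (\<integral>\<^sup>+x. ennreal (?N\<^sup>2) * (ennreal (norm (V' x) ^ 2) * indicator (polydisc c R) x) \<partial>lborel)"
          by (intro nn_integral_cong) (simp add: v_def power_mult_distrib ennreal_mult mult.assoc)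
        also have "\<dots> = ennreal (?N\<^sup>2) * (\<integral>\<^sup>+x. ennreal (norm (V' x) ^ 2) * indicator (polydisc c R) x \<partial>lborel)"
          by (rule nn_integral_cmult) measurable
        also have "\<dots> < \<infinity>"
          using Lp_loc_borel_version_finite[OF assms(5) V' cK] by (simp add: ennreal_mult_less_top)
        finally show ?thesis .
      qed
      show "AE x in lborel. x \<in> polydisc c R \<longrightarrow> (\<Sum>k\<in>UNIV. cmod (g j k x)) \<le> v x * (\<Sum>k\<in>UNIV. cmod (f k x))" for j
        using gv[of j] by eventually_elim (use K in blast)
    qed measurable
  qed
  then have "AE x in lborel. x \<in> \<Omega> \<longrightarrow> u x = 0"
    using uf by eventually_elim (auto simp: vec_eq_iff)
  then show ?thesis by (simp add: AE_lebesgue_on_iff[OF \<Omega>])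
qed

end
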